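(* Let $\mathscr{A}$ and $\mathscr{B}$ be abelian categories such that $\mathscr{A}$ has enough injectives and enough projectives, and let $F : \mathscr{A} \to \mathscr{B}$ be a half-exact additive covariant functor. Then the $F$-component $c_F : S^1S_1F \to F$ of the counit of the adjunction $(S^1, S_1)$ is isomorphic to the inclusion $\alpha_F : \overline{F} \to F$ of the injective stabilization of $F$; that is, there is a natural isomorphism $\theta : S^1S_1F \to \overline{F}$ with $\alpha_F\theta = c_F$.
   Context: All functors are additive and covariant $\mathscr{A} \to \mathscr{B}$; kernels, cokernels and exactness of functors are computed componentwise. $F$ is half-exact if for each short exact sequence $0 \to A' \to A \to A'' \to 0$ the sequence $F(A') \to F(A) \to F(A'')$ is exact. Injective stabilization: for an object $B$ choose an injective copresentation $0 \to B \overset{\iota}{\to} I^0 \overset{\partial}{\to} I^1$ (exact, with $I^0, I^1$ injective). Then $R^0F(B) = \ker F(\partial)$, the map $F(\iota)$ induces a natural transformation $\rho_F : F \to R^0F$, and $\overline{F} := \ker \rho_F$, with inclusion $\alpha_F : \overline{F} \to F$. Satellites: for an object $A$ choose an exact sequence $0 \to \Omega A \overset{\iota}{\to} P \to A \to 0$ with $P$ projective; the left satellite is $S_1F(A) := \ker F(\iota)$. Choose an exact sequence $0 \to A \to I \overset{\pi}{\to} \Sigma A \to 0$ with $I$ injective; the right satellite is $S^1F(A) := \operatorname{coker} F(\pi)$. Values on morphisms are defined by lifting (resp. extending) morphisms along these sequences. It is known (Fisher-Palmquist and Newell) that $S^1$ is left adjoint to $S_1$ as endofunctors of the category of additive functors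 $\mathscr{A} \to \mathscr{B}$; $c : S^1S_1 \to 1$ denotes the counit of this adjunction. *)

theory Defs
  imports "HOL-Algebra.Group"
begin

section \<open>Categories, functors, adjunctions\<close>

text \<open>
  Composition is in applicative order: \<open>g \<cdot> f\<close> means ``first \<open>f\<close>, then \<open>g\<close>''; it is only
  constrained on composable pairs.
\<close>

record ('o, 'a) cat =
  Ob :: "'o set"
  Ar :: "'a set"
  Dm :: "'a \<Rightarrow> 'o"
  Cd :: "'a \<Rightarrow> 'o"
  Id :: "'o \<Rightarrow> 'a"
  Cmp :: "'a \<Rightarrow> 'a \<Rightarrow> 'a" (infixl "\<cdot>\<index>" 70)

definition Hom :: "('o, 'a, 'x) cat_scheme \<Rightarrow> 'o \<Rightarrow> 'o \<Rightarrow> 'a set" where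
  "Hom C X Y = {f \<in> Ar C. Dm C f = X \<and> Cd C f = Y}"

locale category =
  fixes C :: "('o, 'a, 'x) cat_scheme" (structure)
  assumes Dm_in_Ob: "f \<in> Ar C \<Longrightarrow> Dm C f \<in> Ob C"
    and Cd_in_Ob: "f \<in> Ar C \<Longrightarrow> Cd C f \<in> Ob C"
    and Id_in_Hom: "X \<in> Ob C \<Longrightarrow> Id C X \<in> Hom C X X"
    and Cmp_in_Hom: "f \<in> Hom C X Y \<Longrightarrow> g \<in> Hom C Y Z \<Longrightarrow> g \<cdot> f \<in> Hom C X Z"
    and Cmp_Id: "f \<in> Hom C X Y \<Longrightarrow> f \<cdot> Id C X = f"
    and Id_Cmp: "f \<in> Hom C X Y \<Longrightarrow> Id C Y \<cdot> f = f"
    and Cmp_assoc: "f \<in> Hom C W X \<Longrightarrow> g \<in> Hom C X Y \<Longrightarrow> h \<in> Hom C Y Z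
      \<Longrightarrow> (h \<cdot> g) \<cdot> f = h \<cdot> (g \<cdot> f)"

definition isomorphism_in :: "('o, 'a, 'x) cat_scheme \<Rightarrow> 'a \<Rightarrow> bool" where
  "isomorphism_in C f \<longleftrightarrow> f \<in> Ar C \<and>
     (\<exists>g \<in> Hom C (Cd C f) (Dm C f).
        g \<cdot>\<^bsub>C\<^esub> f = Id C (Dm C f) \<and> f \<cdot>\<^bsub>C\<^esub> g = Id C (Cd C f))"

definition monic :: "('o, 'a, 'x) cat_scheme \<Rightarrow> 'a \<Rightarrow> bool" where
  "monic C m \<longleftrightarrow> m \<in> Ar C \<and>
     (\<forall>X. \<forall>f \<in> Hom C X (Dm C m). \<forall>g \<in> Hom C X (Dm C m).
        m \<cdot>\<^bsub>C\<^esub> f = m \<cdot>\<^bsub>C\<^esub> g \<longrightarrow> f = g)"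

definition epic :: "('o, 'a, 'x) cat_scheme \<Rightarrow> 'a \<Rightarrow> bool" where
  "epic C e \<longleftrightarrow> e \<in> Ar C \<and>
     (\<forall>Y. \<forall>f \<in> Hom C (Cd C e) Y. \<forall>g \<in> Hom C (Cd C e) Y.
        f \<cdot>\<^bsub>C\<^esub> e = g \<cdot>\<^bsub>C\<^esub> e \<longrightarrow> f = g)"

definition projective :: "('o, 'a, 'x) cat_scheme \<Rightarrow> 'o \<Rightarrow> bool" where
  "projective C P \<longleftrightarrow> P \<in> Ob C \<and>
     (\<forall>e. epic C e \<longrightarrow> (\<forall>f \<in> Hom C P (Cd C e). \<exists>g \<in> Hom C P (Dm C e). e \<cdot>\<^bsub>C\<^esub> g = f))"

definition injective :: "('o, 'a, 'x) cat_scheme \<Rightarrow> 'o \<Rightarrow> bool" where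
  "injective C I \<longleftrightarrow> I \<in> Ob C \<and>
     (\<forall>m. monic C m \<longrightarrow> (\<forall>f \<in> Hom C (Dm C m) I. \<exists>g \<in> Hom C (Cd C m) I. g \<cdot>\<^bsub>C\<^esub> m = f))"

definition enough_projectives :: "('o, 'a, 'x) cat_scheme \<Rightarrow> bool" where
  "enough_projectives C \<longleftrightarrow>
     (\<forall>X \<in> Ob C. \<exists>e. epic C e \<and> Cd C e = X \<and> projective C (Dm C e))"

definition enough_injectives :: "('o, 'a, 'x) cat_scheme \<Rightarrow> bool" where
  "enough_injectives C \<longleftrightarrow>
     (\<forall>X \<in> Ob C. \<exists>m. monic C m \<and> Dm C m = X \<and> injective C (Cd C m))"

text \<open>
  The object and arrow parts of a functor are required to be \<^const>\<open>extensional\<close>, so that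
  equality of functors is equality on the objects and arrows of the source category.
  The same convention is used for the components of natural transformations.
\<close>

record ('o, 'a, 'p, 'b) func =
  FOb :: "'o \<Rightarrow> 'p"
  FAr :: "'a \<Rightarrow> 'b"

locale is_functor = source: category C + target: category D
  for C :: "('o, 'a, 'x) cat_scheme" and D :: "('p, 'b, 'y) cat_scheme" +
  fixes F :: "('o, 'a, 'p, 'b) func"
  assumes FOb_PiE: "FOb F \<in> Ob C \<rightarrow>\<^sub>E Ob D"
    and FAr_PiE: "FAr F \<in> Ar C \<rightarrow>\<^sub>E Ar D"
    and FAr_Hom: "f \<in> Hom C X Y \<Longrightarrow> FAr F f \<in> Hom D (FOb F X) (FOb F Y)"
    and FAr_Id: "X \<in> Ob C \<Longrightarrow> FAr F (Id C X) = Id D (FOb F X)"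
    and FAr_Cmp: "f \<in> Hom C X Y \<Longrightarrow> g \<in> Hom C Y Z
      \<Longrightarrow> FAr F (g \<cdot>\<^bsub>C\<^esub> f) = FAr F g \<cdot>\<^bsub>D\<^esub> FAr F f"

definition id_functor :: "('o, 'a, 'x) cat_scheme \<Rightarrow> ('o, 'a, 'o, 'a) func" where
  "id_functor C = \<lparr>FOb = (\<lambda>X \<in> Ob C. X), FAr = (\<lambda>f \<in> Ar C. f)\<rparr>"

definition comp_functor :: "('o, 'a, 'x) cat_scheme \<Rightarrow> ('p, 'b, 'q, 'c) func
    \<Rightarrow> ('o, 'a, 'p, 'b) func \<Rightarrow> ('o, 'a, 'q, 'c) func" where
  "comp_functor C G F =
     \<lparr>FOb = (\<lambda>X \<in> Ob C. FOb G (FOb F X)), FAr = (\<lambda>f \<in> Ar C. FAr G (FAr F f))\<rparr>"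

record ('o, 'a, 'p, 'b) ntrans =
  NSrc :: "('o, 'a, 'p, 'b) func"
  NTgt :: "('o, 'a, 'p, 'b) func"
  NMap :: "'o \<Rightarrow> 'b"

locale nat_trans =
  source: is_functor C D "NSrc \<tau>" + target: is_functor C D "NTgt \<tau>"
  for C :: "('o, 'a, 'x) cat_scheme" and D :: "('p, 'b, 'y) cat_scheme"
    and \<tau> :: "('o, 'a, 'p, 'b) ntrans" +
  assumes NMap_extensional: "NMap \<tau> \<in> extensional (Ob C)"
    and NMap_Hom: "X \<in> Ob C \<Longrightarrow> NMap \<tau> X \<in> Hom D (FOb (NSrc \<tau>) X) (FOb (NTgt \<tau>) X)"
    and naturality: "f \<in> Hom C X Y
      \<Longrightarrow> NMap \<tau> Y \<cdot>\<^bsub>D\<^esub> FAr (NSrc \<tau>) f = FAr (NTgt \<tau>) f \<cdot>\<^bsub>D\<^esub> NMap \<tau> X"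

text \<open>\<open>L : C \<rightarrow> D\<close> is left adjoint to \<open>R : D \<rightarrow> C\<close> with unit \<open>\<eta>\<close> and counit \<open>\<epsilon>\<close>.\<close>

locale adjunction =
  left: is_functor C D L + right: is_functor D C R +
  unit: nat_trans C C \<eta> + counit: nat_trans D D \<epsilon>
  for C :: "('o, 'a, 'x) cat_scheme" and D :: "('p, 'b, 'y) cat_scheme"
    and L :: "('o, 'a, 'p, 'b) func" and R :: "('p, 'b, 'o, 'a) func"
    and \<eta> :: "('o, 'a, 'o, 'a) ntrans" and \<epsilon> :: "('p, 'b, 'p, 'b) ntrans" +
  assumes unit_src: "NSrc \<eta> = id_functor C"
    and unit_tgt: "NTgt \<eta> = comp_functor C R L"
    and counit_src: "NSrc \<epsilon> = comp_functor D L R"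
    and counit_tgt: "NTgt \<epsilon> = id_functor D"
    and triangle_left: "X \<in> Ob C
      \<Longrightarrow> NMap \<epsilon> (FOb L X) \<cdot>\<^bsub>D\<^esub> FAr L (NMap \<eta> X) = Id D (FOb L X)"
    and triangle_right: "Y \<in> Ob D
      \<Longrightarrow> FAr R (NMap \<epsilon> Y) \<cdot>\<^bsub>C\<^esub> NMap \<eta> (FOb R Y) = Id C (FOb R Y)"

section \<open>Abelian categories\<close>

record ('o, 'a) ab_cat = "('o, 'a) cat" +
  Add :: "'a \<Rightarrow> 'a \<Rightarrow> 'a"
  Zero :: "'o \<Rightarrow> 'o \<Rightarrow> 'a"

definition Hom_group :: "('o, 'a, 'x) ab_cat_scheme \<Rightarrow> 'o \<Rightarrow> 'o \<Rightarrow> 'a monoid" where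
  "Hom_group C X Y = \<lparr>carrier = Hom C X Y, mult = Add C, one = Zero C X Y\<rparr>"

locale preadditive = category C
  for C :: "('o, 'a, 'x) ab_cat_scheme" (structure) +
  assumes Hom_comm_group: "X \<in> Ob C \<Longrightarrow> Y \<in> Ob C \<Longrightarrow> comm_group (Hom_group C X Y)"
    and Cmp_Add: "f \<in> Hom C X Y \<Longrightarrow> f' \<in> Hom C X Y \<Longrightarrow> g \<in> Hom C Y Z
      \<Longrightarrow> g \<cdot> Add C f f' = Add C (g \<cdot> f) (g \<cdot> f')"
    and Add_Cmp: "f \<in> Hom C X Y \<Longrightarrow> g \<in> Hom C Y Z \<Longrightarrow> g' \<in> Hom C Y Z
      \<Longrightarrow> Add C g g' \<cdot> f = Add C (g \<cdot> f) (g' \<cdot> f)"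

definition zero_object :: "('o, 'a, 'x) cat_scheme \<Rightarrow> 'o \<Rightarrow> bool" where
  "zero_object C Z \<longleftrightarrow> Z \<in> Ob C \<and>
     (\<forall>X \<in> Ob C. (\<exists>!f. f \<in> Hom C X Z) \<and> (\<exists>!f. f \<in> Hom C Z X))"

definition is_biproduct ::
    "('o, 'a, 'x) ab_cat_scheme \<Rightarrow> 'o \<Rightarrow> 'o \<Rightarrow> 'o \<Rightarrow> 'a \<Rightarrow> 'a \<Rightarrow> 'a \<Rightarrow> 'a \<Rightarrow> bool" where
  "is_biproduct C X Y S i j p q \<longleftrightarrow>
     i \<in> Hom C X S \<and> j \<in> Hom C Y S \<and> p \<in> Hom C S X \<and> q \<in> Hom C S Y \<and>
     p \<cdot>\<^bsub>C\<^esub> i = Id C X \<and> q \<cdot>\<^bsub>C\<^esub> j = Id C Y \<and>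
     q \<cdot>\<^bsub>C\<^esub> i = Zero C X Y \<and> p \<cdot>\<^bsub>C\<^esub> j = Zero C Y X \<and>
     Add C (i \<cdot>\<^bsub>C\<^esub> p) (j \<cdot>\<^bsub>C\<^esub> q) = Id C S"

definition is_kernel :: "('o, 'a, 'x) ab_cat_scheme \<Rightarrow> 'a \<Rightarrow> 'a \<Rightarrow> bool" where
  "is_kernel C k f \<longleftrightarrow> f \<in> Ar C \<and> k \<in> Ar C \<and> Cd C k = Dm C f \<and>
     f \<cdot>\<^bsub>C\<^esub> k = Zero C (Dm C k) (Cd C f) \<and>
     (\<forall>X. \<forall>h \<in> Hom C X (Dm C f). f \<cdot>\<^bsub>C\<^esub> h = Zero C X (Cd C f) \<longrightarrow>
        (\<exists>!u. u \<in> Hom C X (Dm C k) \<and> k \<cdot>\<^bsub>C\<^esub> u = h))"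

definition is_cokernel :: "('o, 'a, 'x) ab_cat_scheme \<Rightarrow> 'a \<Rightarrow> 'a \<Rightarrow> bool" where
  "is_cokernel C c f \<longleftrightarrow> f \<in> Ar C \<and> c \<in> Ar C \<and> Dm C c = Cd C f \<and>
     c \<cdot>\<^bsub>C\<^esub> f = Zero C (Dm C f) (Cd C c) \<and>
     (\<forall>Y. \<forall>h \<in> Hom C (Cd C f) Y. h \<cdot>\<^bsub>C\<^esub> f = Zero C (Dm C f) Y \<longrightarrow>
        (\<exists>!u. u \<in> Hom C (Cd C c) Y \<and> u \<cdot>\<^bsub>C\<^esub> c = h))"

locale abelian = preadditive C
  for C :: "('o, 'a, 'x) ab_cat_scheme" (structure) +
  assumes ex_zero_object: "\<exists>Z. zero_object C Z"
    and ex_biproduct: "X \<in> Ob C \<Longrightarrow> Y \<in> Ob C \<Longrightarrow> \<exists>S i j p q. is_biproduct C X Y S i j p q"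
    and ex_kernel: "f \<in> Ar C \<Longrightarrow> \<exists>k. is_kernel C k f"
    and ex_cokernel: "f \<in> Ar C \<Longrightarrow> \<exists>c. is_cokernel C c f"
    and monic_normal: "monic C m \<Longrightarrow> \<exists>f. is_kernel C m f"
    and epic_normal: "epic C e \<Longrightarrow> \<exists>f. is_cokernel C e f"

text \<open>Fixed choices of kernels and cokernels, which exist for all arrows of an abelian category.\<close>

definition ker_map :: "('o, 'a, 'x) ab_cat_scheme \<Rightarrow> 'a \<Rightarrow> 'a" where
  "ker_map C f = (SOME k. is_kernel C k f)"

definition coker_map :: "('o, 'a, 'x) ab_cat_scheme \<Rightarrow> 'a \<Rightarrow> 'a" where
  "coker_map C f = (SOME c. is_cokernel C c f)"

definition is_image :: "('o, 'a, 'x) ab_cat_scheme \<Rightarrow> 'a \<Rightarrow> 'a \<Rightarrow> bool" where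
  "is_image C m f \<longleftrightarrow> (\<exists>c. is_cokernel C c f \<and> is_kernel C m c)"

text \<open>Exactness of \<open>\<bullet> \<midarrow>f\<rightarrow> \<bullet> \<midarrow>g\<rightarrow> \<bullet>\<close>: the image of \<open>f\<close> is the kernel of \<open>g\<close>, as subobjects.\<close>

definition exact :: "('o, 'a, 'x) ab_cat_scheme \<Rightarrow> 'a \<Rightarrow> 'a \<Rightarrow> bool" where
  "exact C f g \<longleftrightarrow> (\<exists>m. is_image C m f \<and> is_kernel C m g)"

definition short_exact :: "('o, 'a, 'x) ab_cat_scheme \<Rightarrow> 'a \<Rightarrow> 'a \<Rightarrow> bool" where
  "short_exact C f g \<longleftrightarrow> monic C f \<and> exact C f g \<and> epic C g"

section \<open>The category of additive functors\<close>

locale additive_functor = source: preadditive C + target: preadditive D + is_functor C D F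
  for C :: "('o, 'a, 'x) ab_cat_scheme" and D :: "('p, 'b, 'y) ab_cat_scheme"
    and F :: "('o, 'a, 'p, 'b) func" +
  assumes FAr_Add: "f \<in> Hom C X Y \<Longrightarrow> g \<in> Hom C X Y
      \<Longrightarrow> FAr F (Add C f g) = Add D (FAr F f) (FAr F g)"

definition half_exact :: "('o, 'a, 'x) ab_cat_scheme \<Rightarrow> ('p, 'b, 'y) ab_cat_scheme
    \<Rightarrow> ('o, 'a, 'p, 'b) func \<Rightarrow> bool" where
  "half_exact C D F \<longleftrightarrow> (\<forall>f g. short_exact C f g \<longrightarrow> exact D (FAr F f) (FAr F g))"

definition functor_cat :: "('o, 'a, 'x) ab_cat_scheme \<Rightarrow> ('p, 'b, 'y) ab_cat_scheme
    \<Rightarrow> (('o, 'a, 'p, 'b) func, ('o, 'a, 'p, 'b) ntrans) cat" where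
  "functor_cat C D = \<lparr>
     Ob = {F. additive_functor C D F},
     Ar = {\<tau>. nat_trans C D \<tau> \<and> additive_functor C D (NSrc \<tau>) \<and> additive_functor C D (NTgt \<tau>)},
     Dm = NSrc,
     Cd = NTgt,
     Id = (\<lambda>F. \<lparr>NSrc = F, NTgt = F, NMap = (\<lambda>X \<in> Ob C. Id D (FOb F X))\<rparr>),
     Cmp = (\<lambda>\<sigma> \<tau>. \<lparr>NSrc = NSrc \<tau>, NTgt = NTgt \<sigma>,
                     NMap = (\<lambda>X \<in> Ob C. NMap \<sigma> X \<cdot>\<^bsub>D\<^esub> NMap \<tau> X)\<rparr>)\<rparr>"

text \<open>The (componentwise) kernel of a natural transformation, as an arrow into its source.\<close>

definition ntrans_ker :: "('o, 'a, 'x) ab_cat_scheme \<Rightarrow> ('p, 'b, 'y) ab_cat_scheme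
    \<Rightarrow> ('o, 'a, 'p, 'b) ntrans \<Rightarrow> ('o, 'a, 'p, 'b) ntrans" where
  "ntrans_ker C D \<tau> =
     (let k = (\<lambda>X. ker_map D (NMap \<tau> X)) in
      \<lparr>NSrc = \<lparr>FOb = (\<lambda>X \<in> Ob C. Dm D (k X)),
               FAr = (\<lambda>f \<in> Ar C. THE g. g \<in> Hom D (Dm D (k (Dm C f))) (Dm D (k (Cd C f))) \<and>
                        k (Cd C f) \<cdot>\<^bsub>D\<^esub> g = FAr (NSrc \<tau>) f \<cdot>\<^bsub>D\<^esub> k (Dm C f))\<rparr>,
       NTgt = NSrc \<tau>,
       NMap = (\<lambda>X \<in> Ob C. k X)\<rparr>)"

section \<open>The injective stabilization\<close>

text \<open>
  A choice, for every object \<open>X\<close>, of an injective copresentation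
  \<open>0 \<rightarrow> X \<midarrow>\<iota> X\<rightarrow> I\<^sup>0 \<midarrow>\<delta> X\<rightarrow> I\<^sup>1\<close>.
\<close>

definition injective_copresentations ::
    "('o, 'a, 'x) ab_cat_scheme \<Rightarrow> ('o \<Rightarrow> 'a) \<Rightarrow> ('o \<Rightarrow> 'a) \<Rightarrow> bool" where
  "injective_copresentations C \<iota> \<delta> \<longleftrightarrow>
     (\<forall>X \<in> Ob C. Dm C (\<iota> X) = X \<and> monic C (\<iota> X) \<and> exact C (\<iota> X) (\<delta> X) \<and>
        injective C (Cd C (\<iota> X)) \<and> injective C (Cd C (\<delta> X)))"

definition R0 :: "('o, 'a, 'x) ab_cat_scheme \<Rightarrow> ('p, 'b, 'y) ab_cat_scheme
    \<Rightarrow> ('o \<Rightarrow> 'a) \<Rightarrow> ('o \<Rightarrow> 'a) \<Rightarrow> ('o, 'a, 'p, 'b) func \<Rightarrow> ('o, 'a, 'p, 'b) func" where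
  "R0 C D \<iota> \<delta> F =
     (let k = (\<lambda>X. ker_map D (FAr F (\<delta> X))) in
      \<lparr>FOb = (\<lambda>X \<in> Ob C. Dm D (k X)),
       FAr = (\<lambda>f \<in> Ar C. let X = Dm C f; Y = Cd C f in
         THE g. g \<in> Hom D (Dm D (k X)) (Dm D (k Y)) \<and>
           (\<exists>u \<in> Hom C (Cd C (\<iota> X)) (Cd C (\<iota> Y)). \<exists>v \<in> Hom C (Cd C (\<delta> X)) (Cd C (\<delta> Y)).
              u \<cdot>\<^bsub>C\<^esub> \<iota> X = \<iota> Y \<cdot>\<^bsub>C\<^esub> f \<and> v \<cdot>\<^bsub>C\<^esub> \<delta> X = \<delta> Y \<cdot>\<^bsub>C\<^esub> u \<and>
              k Y \<cdot>\<^bsub>D\<^esub> g = FAr F u \<cdot>\<^bsub>D\<^esub> k X))\<rparr>)"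

text \<open>The natural transformation \<open>\<rho>\<^sub>F : F \<rightarrow> R\<^sup>0F\<close> induced by the arrows \<open>F(\<iota>)\<close>.\<close>

definition rho :: "('o, 'a, 'x) ab_cat_scheme \<Rightarrow> ('p, 'b, 'y) ab_cat_scheme
    \<Rightarrow> ('o \<Rightarrow> 'a) \<Rightarrow> ('o \<Rightarrow> 'a) \<Rightarrow> ('o, 'a, 'p, 'b) func \<Rightarrow> ('o, 'a, 'p, 'b) ntrans" where
  "rho C D \<iota> \<delta> F = \<lparr>
     NSrc = F,
     NTgt = R0 C D \<iota> \<delta> F,
     NMap = (\<lambda>X \<in> Ob C. THE r. r \<in> Hom D (FOb F X) (FOb (R0 C D \<iota> \<delta> F) X) \<and>
               ker_map D (FAr F (\<delta> X)) \<cdot>\<^bsub>D\<^esub> r = FAr F (\<iota> X))\<rparr>"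

definition inj_stab_incl :: "('o, 'a, 'x) ab_cat_scheme \<Rightarrow> ('p, 'b, 'y) ab_cat_scheme
    \<Rightarrow> ('o \<Rightarrow> 'a) \<Rightarrow> ('o \<Rightarrow> 'a) \<Rightarrow> ('o, 'a, 'p, 'b) func \<Rightarrow> ('o, 'a, 'p, 'b) ntrans" where
  "inj_stab_incl C D \<iota> \<delta> F = ntrans_ker C D (rho C D \<iota> \<delta> F)"

definition inj_stab :: "('o, 'a, 'x) ab_cat_scheme \<Rightarrow> ('p, 'b, 'y) ab_cat_scheme
    \<Rightarrow> ('o \<Rightarrow> 'a) \<Rightarrow> ('o \<Rightarrow> 'a) \<Rightarrow> ('o, 'a, 'p, 'b) func \<Rightarrow> ('o, 'a, 'p, 'b) func" where
  "inj_stab C D \<iota> \<delta> F = NSrc (inj_stab_incl C D \<iota> \<delta> F)"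

section \<open>Satellites\<close>

text \<open>
  Choices, for every object \<open>X\<close>, of a short exact sequence
  \<open>0 \<rightarrow> \<Omega>X \<midarrow>i X\<rightarrow> P \<midarrow>p X\<rightarrow> X \<rightarrow> 0\<close> with \<open>P\<close> projective, and of a short exact sequence
  \<open>0 \<rightarrow> X \<midarrow>j X\<rightarrow> I \<midarrow>q X\<rightarrow> \<Sigma>X \<rightarrow> 0\<close> with \<open>I\<close> injective.
\<close>

definition projective_presentations ::
    "('o, 'a, 'x) ab_cat_scheme \<Rightarrow> ('o \<Rightarrow> 'a) \<Rightarrow> ('o \<Rightarrow> 'a) \<Rightarrow> bool" where
  "projective_presentations C i p \<longleftrightarrow>
     (\<forall>X \<in> Ob C. short_exact C (i X) (p X) \<and> Cd C (p X) = X \<and> projective C (Dm C (p X)))"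

definition injective_presentations ::
    "('o, 'a, 'x) ab_cat_scheme \<Rightarrow> ('o \<Rightarrow> 'a) \<Rightarrow> ('o \<Rightarrow> 'a) \<Rightarrow> bool" where
  "injective_presentations C j q \<longleftrightarrow>
     (\<forall>X \<in> Ob C. short_exact C (j X) (q X) \<and> Dm C (j X) = X \<and> injective C (Cd C (j X)))"

text \<open>
  In the arrow parts below, \<open>u\<close> and \<open>w\<close> form a lift (resp. extension) of \<open>f\<close> to the chosen
  sequences; the resulting arrow does not depend on it.
\<close>

definition left_sat_ob :: "('o, 'a, 'x) ab_cat_scheme \<Rightarrow> ('p, 'b, 'y) ab_cat_scheme
    \<Rightarrow> ('o \<Rightarrow> 'a) \<Rightarrow> ('o \<Rightarrow> 'a) \<Rightarrow> ('o, 'a, 'p, 'b) func \<Rightarrow> ('o, 'a, 'p, 'b) func" where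
  "left_sat_ob C D i p F =
     (let k = (\<lambda>X. ker_map D (FAr F (i X))) in
      \<lparr>FOb = (\<lambda>X \<in> Ob C. Dm D (k X)),
       FAr = (\<lambda>f \<in> Ar C. let X = Dm C f; Y = Cd C f in
         THE g. g \<in> Hom D (Dm D (k X)) (Dm D (k Y)) \<and>
           (\<exists>u \<in> Hom C (Dm C (p X)) (Dm C (p Y)). \<exists>w \<in> Hom C (Dm C (i X)) (Dm C (i Y)).
              p Y \<cdot>\<^bsub>C\<^esub> u = f \<cdot>\<^bsub>C\<^esub> p X \<and> i Y \<cdot>\<^bsub>C\<^esub> w = u \<cdot>\<^bsub>C\<^esub> i X \<and>
              k Y \<cdot>\<^bsub>D\<^esub> g = FAr F w \<cdot>\<^bsub>D\<^esub> k X))\<rparr>)"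

definition right_sat_ob :: "('o, 'a, 'x) ab_cat_scheme \<Rightarrow> ('p, 'b, 'y) ab_cat_scheme
    \<Rightarrow> ('o \<Rightarrow> 'a) \<Rightarrow> ('o \<Rightarrow> 'a) \<Rightarrow> ('o, 'a, 'p, 'b) func \<Rightarrow> ('o, 'a, 'p, 'b) func" where
  "right_sat_ob C D j q F =
     (let c = (\<lambda>X. coker_map D (FAr F (q X))) in
      \<lparr>FOb = (\<lambda>X \<in> Ob C. Cd D (c X)),
       FAr = (\<lambda>f \<in> Ar C. let X = Dm C f; Y = Cd C f in
         THE g. g \<in> Hom D (Cd D (c X)) (Cd D (c Y)) \<and>
           (\<exists>u \<in> Hom C (Cd C (j X)) (Cd C (j Y)). \<exists>w \<in> Hom C (Cd C (q X)) (Cd C (q Y)).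
              u \<cdot>\<^bsub>C\<^esub> j X = j Y \<cdot>\<^bsub>C\<^esub> f \<and> w \<cdot>\<^bsub>C\<^esub> q X = q Y \<cdot>\<^bsub>C\<^esub> u \<and>
              g \<cdot>\<^bsub>D\<^esub> c X = c Y \<cdot>\<^bsub>D\<^esub> FAr F w))\<rparr>)"

text \<open>
  The satellites as endofunctors of the category of additive functors: at \<open>X\<close>, the left
  satellite of \<open>\<tau> : F \<rightarrow> G\<close> is the restriction of \<open>\<tau>\<close> at \<open>\<Omega>X\<close> to the kernels of \<open>F(i X)\<close> and
  \<open>G(i X)\<close>, and the right satellite is induced by \<open>\<tau>\<close> at \<open>\<Sigma>X\<close> on the cokernels of \<open>F(q X)\<close>
  and \<open>G(q X)\<close>.
\<close>

definition left_satellite :: "('o, 'a, 'x) ab_cat_scheme \<Rightarrow> ('p, 'b, 'y) ab_cat_scheme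
    \<Rightarrow> ('o \<Rightarrow> 'a) \<Rightarrow> ('o \<Rightarrow> 'a)
    \<Rightarrow> (('o, 'a, 'p, 'b) func, ('o, 'a, 'p, 'b) ntrans,
        ('o, 'a, 'p, 'b) func, ('o, 'a, 'p, 'b) ntrans) func" where
  "left_satellite C D i p =
     (let S = left_sat_ob C D i p; k = (\<lambda>F X. ker_map D (FAr F (i X))) in
      \<lparr>FOb = (\<lambda>F \<in> Ob (functor_cat C D). S F),
       FAr = (\<lambda>\<tau> \<in> Ar (functor_cat C D). let F = NSrc \<tau>; G = NTgt \<tau> in
         \<lparr>NSrc = S F, NTgt = S G,
          NMap = (\<lambda>X \<in> Ob C. THE g. g \<in> Hom D (FOb (S F) X) (FOb (S G) X) \<and>
                    k G X \<cdot>\<^bsub>D\<^esub> g = NMap \<tau> (Dm C (i X)) \<cdot>\<^bsub>D\<^esub> k F X)\<rparr>)\<rparr>)"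

definition right_satellite :: "('o, 'a, 'x) ab_cat_scheme \<Rightarrow> ('p, 'b, 'y) ab_cat_scheme
    \<Rightarrow> ('o \<Rightarrow> 'a) \<Rightarrow> ('o \<Rightarrow> 'a)
    \<Rightarrow> (('o, 'a, 'p, 'b) func, ('o, 'a, 'p, 'b) ntrans,
        ('o, 'a, 'p, 'b) func, ('o, 'a, 'p, 'b) ntrans) func" where
  "right_satellite C D j q =
     (let S = right_sat_ob C D j q; c = (\<lambda>F X. coker_map D (FAr F (q X))) in
      \<lparr>FOb = (\<lambda>F \<in> Ob (functor_cat C D). S F),
       FAr = (\<lambda>\<tau> \<in> Ar (functor_cat C D). let F = NSrc \<tau>; G = NTgt \<tau> in
         \<lparr>NSrc = S F, NTgt = S G,
          NMap = (\<lambda>X \<in> Ob C. THE g. g \<in> Hom D (FOb (S F) X) (FOb (S G) X) \<and>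
                    g \<cdot>\<^bsub>D\<^esub> c F X = c G X \<cdot>\<^bsub>D\<^esub> NMap \<tau> (Cd C (q X)))\<rparr>)\<rparr>)"

end

theory Submission
  imports Defs
begin

text \<open>
  Let \<open>S\<close> and \<open>T\<close> be the left and the right satellite on objects. For a short exact sequence
  \<open>0 \<rightarrow> A' \<rightarrow> A \<rightarrow> Y \<rightarrow> 0\<close>, the identity of \<open>Y\<close> lifts to a morphism from
  \<open>0 \<rightarrow> \<Omega>Y \<rightarrow> P \<rightarrow> Y \<rightarrow> 0\<close>, and applying \<open>G\<close> to the resulting arrow \<open>s : \<Omega>Y \<rightarrow> A'\<close> gives a connecting
  arrow \<open>S G(Y) \<rightarrow> G(A')\<close>. It does not depend on the lift, because two choices of \<open>s\<close> differ by an
  arrow that factors through \<open>\<Omega>Y \<rightarrow> P\<close>, and \<open>S G(Y)\<close> is the kernel of \<open>G(\<Omega>Y \<rightarrow> P)\<close>.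

  The connecting arrow of \<open>0 \<rightarrow> X \<rightarrow> I \<rightarrow> \<Sigma>X \<rightarrow> 0\<close> vanishes on \<open>S G(I)\<close>, so it factors through the
  cokernel \<open>T(S G)(X)\<close> of \<open>S G(I) \<rightarrow> S G(\<Sigma>X)\<close>: this is the counit \<open>T(S G)(X) \<rightarrow> G(X)\<close>. The whole
  situation is self-dual, with the two satellites exchanged, and the unit is the dual arrow. In the
  triangle identity at \<open>T F\<close>, unit and counit together amount to applying \<open>F\<close> to an endomorphism of
  \<open>\<Sigma>X\<close> that induces the same arrow \<open>\<Omega>\<Sigma>X \<rightarrow> X\<close> as the identity; hence it is \<open>1 + q h\<close> for some
  \<open>h : \<Sigma>X \<rightarrow> I\<close>, where \<open>q : I \<rightarrow> \<Sigma>X\<close>, and the summand \<open>q h\<close> is invisible in the cokernel of \<open>F(q)\<close>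
  (lemma \<open>triangle\<close>).

  If \<open>F\<close> is half-exact, the sequence \<open>S F(A) \<rightarrow> S F(Y) \<rightarrow> F(A') \<rightarrow> F(A)\<close> is exact. Exactness at
  \<open>F(A')\<close> comes from applying \<open>F\<close> to the short exact sequence \<open>0 \<rightarrow> \<Omega>Y \<rightarrow> A' \<oplus> P \<rightarrow> A \<rightarrow> 0\<close>, and
  exactness at \<open>S F(Y)\<close> is the same statement for that sequence in place of the given one (lemmas
  \<open>connecting_exact\<close> and \<open>connecting_exact'\<close>). For \<open>0 \<rightarrow> X \<rightarrow> I \<rightarrow> \<Sigma>X \<rightarrow> 0\<close> this says that the counit at
  \<open>X\<close> is a kernel of \<open>F(X) \<rightarrow> F(I)\<close> (lemma \<open>counit_kernel\<close>). The injective stabilization at \<open>X\<close> is a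
  kernel of \<open>F(X) \<rightarrow> F(I\<^sup>0)\<close>, since \<open>R\<^sup>0F(X)\<close> is a subobject of \<open>F(I\<^sup>0)\<close>; and these two kernels agree,
  as any two embeddings of \<open>X\<close> into injective objects extend along each other. Finally, the counit
  of any other adjunction between the same functors differs from this one by an automorphism of
  \<open>T(S F)\<close> (lemma \<open>counits_differ_by_automorphism\<close>).
\<close>

section \<open>Opposite categories\<close>

definition opp :: "('o, 'a, 'x) ab_cat_scheme \<Rightarrow> ('o, 'a) ab_cat" where
  "opp C = \<lparr>Ob = Ob C, Ar = Ar C, Dm = Cd C, Cd = Dm C, Id = Id C, Cmp = (\<lambda>g f. f \<cdot>\<^bsub>C\<^esub> g),
     Add = Add C, Zero = (\<lambda>X Y. Zero C Y X)\<rparr>"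

lemma opp_simps [simp]:
  "Ob (opp C) = Ob C" "Ar (opp C) = Ar C" "Dm (opp C) = Cd C" "Cd (opp C) = Dm C"
  "Id (opp C) = Id C" "g \<cdot>\<^bsub>opp C\<^esub> f = f \<cdot>\<^bsub>C\<^esub> g" "Add (opp C) = Add C"
  "Zero (opp C) X Y = Zero C Y X"
  by (simp_all add: opp_def)

lemma Hom_opp [simp]: "Hom (opp C) X Y = Hom C Y X"
  by (auto simp: Hom_def)

lemma monic_opp [simp]: "monic (opp C) = epic C"
  by (auto simp: monic_def epic_def fun_eq_iff)

lemma epic_opp [simp]: "epic (opp C) = monic C"
  by (auto simp: monic_def epic_def fun_eq_iff)

lemma projective_opp [simp]: "projective (opp C) = injective C"
  by (auto simp: projective_def injective_def fun_eq_iff)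

lemma injective_opp [simp]: "injective (opp C) = projective C"
  by (auto simp: projective_def injective_def fun_eq_iff)

lemma is_kernel_opp [simp]: "is_kernel (opp C) = is_cokernel C"
  by (auto simp: is_kernel_def is_cokernel_def fun_eq_iff)

lemma is_cokernel_opp [simp]: "is_cokernel (opp C) = is_kernel C"
  by (auto simp: is_kernel_def is_cokernel_def fun_eq_iff)

lemma ker_map_opp [simp]: "ker_map (opp C) = coker_map C"
  by (simp add: ker_map_def coker_map_def fun_eq_iff)

lemma coker_map_opp [simp]: "coker_map (opp C) = ker_map C"
  by (simp add: ker_map_def coker_map_def fun_eq_iff)

section \<open>Arithmetic of arrows\<close>

context category
begin

lemma Cmp_types [simp]:
  assumes "f \<in> Ar C" "g \<in> Ar C" "Cd C f = Dm C g"
  shows "g \<cdot> f \<in> Ar C" "Dm C (g \<cdot> f) = Dm C f" "Cd C (g \<cdot> f) = Cd C g"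
  using Cmp_in_Hom[of f "Dm C f" "Cd C f" g "Cd C g"] assms by (auto simp: Hom_def)

lemma Id_types [simp]:
  assumes "X \<in> Ob C"
  shows "Id C X \<in> Ar C" "Dm C (Id C X) = X" "Cd C (Id C X) = X"
  using Id_in_Hom[OF assms] by (auto simp: Hom_def)

lemma Dm_Cd_Ob [simp]: "f \<in> Ar C \<Longrightarrow> Dm C f \<in> Ob C" "f \<in> Ar C \<Longrightarrow> Cd C f \<in> Ob C"
  by (auto simp: Dm_in_Ob Cd_in_Ob)

lemma Id_right [simp]: "f \<in> Ar C \<Longrightarrow> Dm C f = X \<Longrightarrow> f \<cdot> Id C X = f"
  using Cmp_Id[of f] by (simp add: Hom_def)

lemma Id_left [simp]: "f \<in> Ar C \<Longrightarrow> Cd C f = X \<Longrightarrow> Id C X \<cdot> f = f"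
  using Id_Cmp[of f] by (simp add: Hom_def)

lemma assoc [simp]:
  assumes "f \<in> Ar C" "g \<in> Ar C" "h \<in> Ar C" "Cd C f = Dm C g" "Cd C g = Dm C h"
  shows "(h \<cdot> g) \<cdot> f = h \<cdot> (g \<cdot> f)"
  using Cmp_assoc[of f _ _ g _ h] assms by (auto simp: Hom_def)

text \<open>
  The simplifier associates composites to the right, which hides the left-hand side of an equation
  between composites as soon as a further right factor is present.
\<close>

lemma extend:
  assumes "g \<cdot> f = g' \<cdot> f'" "f \<in> Ar C" "g \<in> Ar C" "f' \<in> Ar C" "g' \<in> Ar C" "x \<in> Ar C"
    "Cd C f = Dm C g" "Cd C f' = Dm C g'" "Cd C x = Dm C f" "Cd C x = Dm C f'"
  shows "g \<cdot> (f \<cdot> x) = g' \<cdot> (f' \<cdot> x)"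
proof -
  have "g \<cdot> (f \<cdot> x) = (g \<cdot> f) \<cdot> x"
    using assms(2-) by simp
  also have "\<dots> = (g' \<cdot> f') \<cdot> x"
    by (simp only: assms(1))
  also have "\<dots> = g' \<cdot> (f' \<cdot> x)"
    using assms(2-) by simp
  finally show ?thesis .
qed

lemma retract:
  assumes "g \<cdot> f = Id C (Dm C f)" "f \<in> Ar C" "g \<in> Ar C" "x \<in> Ar C"
    "Cd C f = Dm C g" "Cd C x = Dm C f"
  shows "g \<cdot> (f \<cdot> x) = x"
proof -
  have "g \<cdot> (f \<cdot> x) = (g \<cdot> f) \<cdot> x"
    using assms(2-) by simp
  also have "\<dots> = x"
    unfolding assms(1) using assms by simp
  finally show ?thesis .
qed

lemma monic_cancel:
  assumes "monic C m" "f \<in> Ar C" "g \<in> Ar C" "Cd C f = Dm C m" "Cd C g = Dm C m" "Dm C f = Dm C g"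
    "m \<cdot> f = m \<cdot> g"
  shows "f = g"
  using assms by (auto simp: monic_def Hom_def)

lemma epic_cancel:
  assumes "epic C e" "f \<in> Ar C" "g \<in> Ar C" "Dm C f = Cd C e" "Dm C g = Cd C e" "Cd C f = Cd C g"
    "f \<cdot> e = g \<cdot> e"
  shows "f = g"
  using assms by (auto simp: epic_def Hom_def)

lemma monic_Ar: "monic C m \<Longrightarrow> m \<in> Ar C" and epic_Ar: "epic C m \<Longrightarrow> m \<in> Ar C"
  by (auto simp: monic_def epic_def)

lemma epic_Cmp:
  assumes "epic C e" "epic C e'" "Cd C e = Dm C e'"
  shows "epic C (e' \<cdot> e)"
  unfolding epic_def
proof (intro conjI ballI allI impI)
  have [simp]: "e \<in> Ar C" "e' \<in> Ar C"
    using assms by (auto simp: epic_def)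
  show "e' \<cdot> e \<in> Ar C"
    using assms(3) by simp
  fix Y f g
  assume "f \<in> Hom C (Cd C (e' \<cdot> e)) Y" "g \<in> Hom C (Cd C (e' \<cdot> e)) Y"
    and eq: "f \<cdot> (e' \<cdot> e) = g \<cdot> (e' \<cdot> e)"
  then have [simp]: "f \<in> Ar C" "g \<in> Ar C" "Dm C f = Cd C e'" "Dm C g = Cd C e'"
      "Cd C f = Y" "Cd C g = Y"
    using assms(3) by (auto simp: Hom_def)
  have "f \<cdot> e' = g \<cdot> e'"
    by (rule epic_cancel[OF assms(1)]) (use assms(3) eq in simp_all)
  show "f = g"
    by (rule epic_cancel[OF assms(2)]) (use \<open>f \<cdot> e' = g \<cdot> e'\<close> in simp_all)
qed

end

context preadditive
begin

lemma Zero_types [simp]: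
  assumes "X \<in> Ob C" "Y \<in> Ob C"
  shows "Zero C X Y \<in> Ar C" "Dm C (Zero C X Y) = X" "Cd C (Zero C X Y) = Y"
proof -
  interpret comm_group "Hom_group C X Y"
    using assms by (rule Hom_comm_group)
  show "Zero C X Y \<in> Ar C" "Dm C (Zero C X Y) = X" "Cd C (Zero C X Y) = Y"
    using one_closed by (auto simp: Hom_group_def Hom_def)
qed

lemma Add_types [simp]:
  assumes "f \<in> Ar C" "g \<in> Ar C" "Dm C f = Dm C g" "Cd C f = Cd C g"
  shows "Add C f g \<in> Ar C" "Dm C (Add C f g) = Dm C f" "Cd C (Add C f g) = Cd C f"
proof -
  interpret comm_group "Hom_group C (Dm C f) (Cd C f)"
    using assms by (intro Hom_comm_group) auto
  show "Add C f g \<in> Ar C" "Dm C (Add C f g) = Dm C f" "Cd C (Add C f g) = Cd C f"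
    using m_closed[of f g] assms by (auto simp: Hom_group_def Hom_def)
qed

lemma Add_Zero [simp]:
  assumes "f \<in> Ar C" "Dm C f = X" "Cd C f = Y"
  shows "Add C f (Zero C X Y) = f" "Add C (Zero C X Y) f = f"
proof -
  interpret comm_group "Hom_group C X Y"
    using assms by (intro Hom_comm_group) auto
  show "Add C f (Zero C X Y) = f" "Add C (Zero C X Y) f = f"
    using r_one[of f] l_one[of f] assms by (auto simp: Hom_group_def Hom_def)
qed

lemma Add_commute:
  assumes "f \<in> Ar C" "g \<in> Ar C" "Dm C f = Dm C g" "Cd C f = Cd C g"
  shows "Add C f g = Add C g f"
proof -
  interpret comm_group "Hom_group C (Dm C f) (Cd C f)"
    using assms by (intro Hom_comm_group) auto
  show ?thesis
    using m_comm[of f g] assms by (auto simp: Hom_group_def Hom_def)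
qed

lemma Add_cancel:
  assumes "Add C f g = Add C f h" "f \<in> Ar C" "g \<in> Ar C" "h \<in> Ar C"
    "Dm C f = Dm C g" "Cd C f = Cd C g" "Dm C f = Dm C h" "Cd C f = Cd C h"
  shows "g = h"
proof -
  interpret comm_group "Hom_group C (Dm C f) (Cd C f)"
    using assms by (intro Hom_comm_group) auto
  let ?G = "Hom_group C (Dm C f) (Cd C f)"
  have "f \<in> carrier ?G" "g \<in> carrier ?G" "h \<in> carrier ?G" "f \<otimes>\<^bsub>?G\<^esub> g = f \<otimes>\<^bsub>?G\<^esub> h"
    using assms by (auto simp: Hom_group_def Hom_def)
  then show ?thesis
    by (simp add: Units_l_cancel Units_eq)
qed

lemma Add_cancel_Zero:
  assumes "Add C f g = f" "f \<in> Ar C" "g \<in> Ar C" "Dm C f = Dm C g" "Cd C f = Cd C g"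
  shows "g = Zero C (Dm C f) (Cd C f)"
  by (rule Add_cancel[of f]) (use assms in auto)

lemma difference:
  assumes "f \<in> Ar C" "g \<in> Ar C" "Dm C f = Dm C g" "Cd C f = Cd C g"
  obtains d where "d \<in> Ar C" "Dm C d = Dm C g" "Cd C d = Cd C g" "f = Add C g d"
proof -
  interpret comm_group "Hom_group C (Dm C g) (Cd C g)"
    using assms by (intro Hom_comm_group) auto
  let ?G = "Hom_group C (Dm C g) (Cd C g)"
  have fg: "f \<in> carrier ?G" "g \<in> carrier ?G"
    using assms by (auto simp: Hom_group_def Hom_def)
  let ?d = "inv\<^bsub>?G\<^esub> g \<otimes>\<^bsub>?G\<^esub> f"
  have "?d \<in> carrier ?G" "g \<otimes>\<^bsub>?G\<^esub> ?d = f"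
    using fg by (simp_all add: m_assoc[symmetric])
  then show thesis
    by (intro that[of ?d]) (auto simp: Hom_group_def Hom_def)
qed

lemma negative:
  assumes "s \<in> Ar C"
  obtains n where "n \<in> Ar C" "Dm C n = Dm C s" "Cd C n = Cd C s" "Add C s n = Zero C (Dm C s) (Cd C s)"
  by (rule difference[of "Zero C (Dm C s) (Cd C s)" s]) (use assms that in \<open>simp_all\<close>)

lemma Cmp_Add' [simp]:
  assumes "f \<in> Ar C" "f' \<in> Ar C" "g \<in> Ar C" "Dm C f = Dm C f'" "Cd C f = Dm C g" "Cd C f' = Dm C g"
  shows "g \<cdot> Add C f f' = Add C (g \<cdot> f) (g \<cdot> f')"
  using Cmp_Add[of f "Dm C f" "Cd C f" f' g "Cd C g"] assms by (auto simp: Hom_def)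

lemma Add_Cmp' [simp]:
  assumes "f \<in> Ar C" "g \<in> Ar C" "g' \<in> Ar C" "Cd C g = Cd C g'" "Cd C f = Dm C g" "Cd C f = Dm C g'"
  shows "Add C g g' \<cdot> f = Add C (g \<cdot> f) (g' \<cdot> f)"
  using Add_Cmp[of f "Dm C f" "Cd C f" g "Cd C g" g'] assms by (auto simp: Hom_def)

lemma Cmp_Zero [simp]:
  assumes "g \<in> Ar C" "X \<in> Ob C" "Dm C g = Y"
  shows "g \<cdot> Zero C X Y = Zero C X (Cd C g)"
proof -
  have [simp]: "Y \<in> Ob C"
    using assms by auto
  have "g \<cdot> Zero C X Y = g \<cdot> Add C (Zero C X Y) (Zero C X Y)"
    using assms by simp
  also have "\<dots> = Add C (g \<cdot> Zero C X Y) (g \<cdot> Zero C X Y)"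
    using assms by (subst Cmp_Add') auto
  finally show ?thesis
    using Add_cancel_Zero[of "g \<cdot> Zero C X Y" "g \<cdot> Zero C X Y"] assms by simp
qed

lemma Zero_Cmp [simp]:
  assumes "f \<in> Ar C" "Z \<in> Ob C" "Cd C f = Y"
  shows "Zero C Y Z \<cdot> f = Zero C (Dm C f) Z"
proof -
  have [simp]: "Y \<in> Ob C"
    using assms by auto
  have "Zero C Y Z \<cdot> f = Add C (Zero C Y Z) (Zero C Y Z) \<cdot> f"
    using assms by simp
  also have "\<dots> = Add C (Zero C Y Z \<cdot> f) (Zero C Y Z \<cdot> f)"
    using assms by (subst Add_Cmp') auto
  finally show ?thesis
    using Add_cancel_Zero[of "Zero C Y Z \<cdot> f" "Zero C Y Z \<cdot> f"] assms by simp
qed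

lemma extend_Zero:
  assumes "g \<cdot> f = Zero C (Dm C f) (Cd C g)" "f \<in> Ar C" "g \<in> Ar C" "x \<in> Ar C"
    "Cd C f = Dm C g" "Cd C x = Dm C f"
  shows "g \<cdot> (f \<cdot> x) = Zero C (Dm C x) (Cd C g)"
proof -
  have "g \<cdot> (f \<cdot> x) = (g \<cdot> f) \<cdot> x"
    using assms(2-) by simp
  also have "\<dots> = Zero C (Dm C f) (Cd C g) \<cdot> x"
    by (simp only: assms(1))
  finally show ?thesis
    using assms(2-) by simp
qed

lemma biproduct_simps:
  assumes "is_biproduct C X Y S i j p q"
  shows "i \<in> Ar C" "Dm C i = X" "Cd C i = S" "j \<in> Ar C" "Dm C j = Y" "Cd C j = S"
    "p \<in> Ar C" "Dm C p = S" "Cd C p = X" "q \<in> Ar C" "Dm C q = S" "Cd C q = Y"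
    "p \<cdot> i = Id C X" "q \<cdot> j = Id C Y" "q \<cdot> i = Zero C X Y" "p \<cdot> j = Zero C Y X"
    "\<And>x. x \<in> Ar C \<Longrightarrow> Cd C x = X \<Longrightarrow> p \<cdot> (i \<cdot> x) = x"
    "\<And>x. x \<in> Ar C \<Longrightarrow> Cd C x = Y \<Longrightarrow> q \<cdot> (j \<cdot> x) = x"
    "\<And>x. x \<in> Ar C \<Longrightarrow> Cd C x = X \<Longrightarrow> q \<cdot> (i \<cdot> x) = Zero C (Dm C x) Y"
    "\<And>x. x \<in> Ar C \<Longrightarrow> Cd C x = Y \<Longrightarrow> p \<cdot> (j \<cdot> x) = Zero C (Dm C x) X"
proof -
  show *: "i \<in> Ar C" "Dm C i = X" "Cd C i = S" "j \<in> Ar C" "Dm C j = Y" "Cd C j = S"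
    "p \<in> Ar C" "Dm C p = S" "Cd C p = X" "q \<in> Ar C" "Dm C q = S" "Cd C q = Y"
    "p \<cdot> i = Id C X" "q \<cdot> j = Id C Y" "q \<cdot> i = Zero C X Y" "p \<cdot> j = Zero C Y X"
    using assms by (auto simp: is_biproduct_def Hom_def)
  show "p \<cdot> (i \<cdot> x) = x" "q \<cdot> (i \<cdot> x) = Zero C (Dm C x) Y" if "x \<in> Ar C" "Cd C x = X" for x
    using retract[of p i x] extend_Zero[of q i x] that by (simp_all add: *)
  show "q \<cdot> (j \<cdot> x) = x" "p \<cdot> (j \<cdot> x) = Zero C (Dm C x) X" if "x \<in> Ar C" "Cd C x = Y" for x
    using retract[of q j x] extend_Zero[of p j x] that by (simp_all add: *)
qed

lemma biproduct_sum:
  assumes "is_biproduct C X Y S i j p q"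
  shows "Add C (i \<cdot> p) (j \<cdot> q) = Id C S"
  using assms by (simp add: is_biproduct_def)

lemma monicI:
  assumes "m \<in> Ar C"
    and "\<And>x. x \<in> Ar C \<Longrightarrow> Cd C x = Dm C m \<Longrightarrow> m \<cdot> x = Zero C (Dm C x) (Cd C m)
      \<Longrightarrow> x = Zero C (Dm C x) (Dm C m)"
  shows "monic C m"
  unfolding monic_def
proof (intro conjI allI ballI impI)
  fix X f g
  assume "f \<in> Hom C X (Dm C m)" "g \<in> Hom C X (Dm C m)" and eq: "m \<cdot> f = m \<cdot> g"
  then have [simp]: "f \<in> Ar C" "g \<in> Ar C" "Dm C f = X" "Dm C g = X" "Cd C f = Dm C m" "Cd C g = Dm C m"
    by (auto simp: Hom_def)
  note [simp] = assms(1)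
  obtain d where [simp]: "d \<in> Ar C" "Dm C d = X" "Cd C d = Dm C m" and d: "f = Add C g d"
    using difference[of f g] by auto
  have "Add C (m \<cdot> g) (m \<cdot> d) = m \<cdot> g"
    using eq by (simp add: d)
  then have "m \<cdot> d = Zero C X (Cd C m)"
    using Add_cancel_Zero[of "m \<cdot> g" "m \<cdot> d"] by simp
  then have "d = Zero C X (Dm C m)"
    using assms(2)[of d] by simp
  then show "f = g"
    by (simp add: d)
qed (rule assms(1))

lemma epicI:
  assumes "e \<in> Ar C"
    and "\<And>x. x \<in> Ar C \<Longrightarrow> Dm C x = Cd C e \<Longrightarrow> x \<cdot> e = Zero C (Dm C e) (Cd C x)
      \<Longrightarrow> x = Zero C (Cd C e) (Cd C x)"
  shows "epic C e"
  unfolding epic_def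
proof (intro conjI allI ballI impI)
  fix Y f g
  assume "f \<in> Hom C (Cd C e) Y" "g \<in> Hom C (Cd C e) Y" and eq: "f \<cdot> e = g \<cdot> e"
  then have [simp]: "f \<in> Ar C" "g \<in> Ar C" "Cd C f = Y" "Cd C g = Y" "Dm C f = Cd C e" "Dm C g = Cd C e"
    by (auto simp: Hom_def)
  note [simp] = assms(1)
  obtain d where [simp]: "d \<in> Ar C" "Cd C d = Y" "Dm C d = Cd C e" and d: "f = Add C g d"
    using difference[of f g] by auto
  have "Add C (g \<cdot> e) (d \<cdot> e) = g \<cdot> e"
    using eq by (simp add: d)
  then have "d \<cdot> e = Zero C (Dm C e) Y"
    using Add_cancel_Zero[of "g \<cdot> e" "d \<cdot> e"] by simp
  then have "d = Zero C (Cd C e) Y"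
    using assms(2)[of d] by simp
  then show "f = g"
    by (simp add: d)
qed (rule assms(1))

lemma monic_Zero:
  assumes "monic C m" "x \<in> Ar C" "Cd C x = Dm C m" "m \<cdot> x = Zero C (Dm C x) (Cd C m)"
  shows "x = Zero C (Dm C x) (Dm C m)"
  by (rule monic_cancel[OF assms(1)]) (use assms monic_Ar in auto)

lemma epic_Zero:
  assumes "epic C e" "x \<in> Ar C" "Dm C x = Cd C e" "x \<cdot> e = Zero C (Dm C e) (Cd C x)"
  shows "x = Zero C (Cd C e) (Cd C x)"
  by (rule epic_cancel[OF assms(1)]) (use assms epic_Ar in auto)

lemma kernel_types:
  assumes "is_kernel C k f"
  shows "f \<in> Ar C" "k \<in> Ar C" "Cd C k = Dm C f" "f \<cdot> k = Zero C (Dm C k) (Cd C f)"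
  using assms by (auto simp: is_kernel_def)

lemma cokernel_types:
  assumes "is_cokernel C c f"
  shows "f \<in> Ar C" "c \<in> Ar C" "Dm C c = Cd C f" "c \<cdot> f = Zero C (Dm C f) (Cd C c)"
  using assms by (auto simp: is_cokernel_def)

lemma kernel_factor:
  assumes "is_kernel C k f" "h \<in> Ar C" "Cd C h = Dm C f" "f \<cdot> h = Zero C (Dm C h) (Cd C f)"
  obtains u where "u \<in> Ar C" "Dm C u = Dm C h" "Cd C u = Dm C k" "k \<cdot> u = h"
  using assms unfolding is_kernel_def Hom_def by blast

lemma cokernel_factor:
  assumes "is_cokernel C c f" "h \<in> Ar C" "Dm C h = Cd C f" "h \<cdot> f = Zero C (Dm C f) (Cd C h)"
  obtains u where "u \<in> Ar C" "Cd C u = Cd C h" "Dm C u = Cd C c" "u \<cdot> c = h"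
  using assms unfolding is_cokernel_def Hom_def by blast

lemma kernel_monic:
  assumes "is_kernel C k f"
  shows "monic C k"
proof (rule monicI)
  note [simp] = kernel_types[OF assms]
  show "k \<in> Ar C" by simp
  fix x assume [simp]: "x \<in> Ar C" "Cd C x = Dm C k" and eq: "k \<cdot> x = Zero C (Dm C x) (Cd C k)"
  have "\<exists>!u. u \<in> Hom C (Dm C x) (Dm C k) \<and> k \<cdot> u = Zero C (Dm C x) (Cd C k)"
    using assms unfolding is_kernel_def
    by (elim conjE allE[of _ "Dm C x"] ballE[of _ _ "Zero C (Dm C x) (Cd C k)"])
      (simp_all add: Hom_def)
  moreover have "x \<in> Hom C (Dm C x) (Dm C k)" "Zero C (Dm C x) (Dm C k) \<in> Hom C (Dm C x) (Dm C k)"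
    by (simp_all add: Hom_def)
  moreover have "k \<cdot> Zero C (Dm C x) (Dm C k) = Zero C (Dm C x) (Cd C k)"
    by (subst Cmp_Zero) auto
  ultimately show "x = Zero C (Dm C x) (Dm C k)"
    using eq by blast
qed

lemma is_kernelI:
  assumes "monic C k" "f \<in> Ar C" "Cd C k = Dm C f" "f \<cdot> k = Zero C (Dm C k) (Cd C f)"
    and "\<And>h. h \<in> Ar C \<Longrightarrow> Cd C h = Dm C f \<Longrightarrow> f \<cdot> h = Zero C (Dm C h) (Cd C f)
      \<Longrightarrow> \<exists>u. u \<in> Ar C \<and> Dm C u = Dm C h \<and> Cd C u = Dm C k \<and> k \<cdot> u = h"
  shows "is_kernel C k f"
  unfolding is_kernel_def
proof (intro conjI allI ballI impI)
  fix X h assume "h \<in> Hom C X (Dm C f)" "f \<cdot> h = Zero C X (Cd C f)"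
  then obtain u where u: "u \<in> Ar C" "Dm C u = X" "Cd C u = Dm C k" "k \<cdot> u = h"
    using assms(5)[of h] by (auto simp: Hom_def)
  show "\<exists>!u. u \<in> Hom C X (Dm C k) \<and> k \<cdot> u = h"
  proof (rule ex1I[of _ u])
    fix v assume v: "v \<in> Hom C X (Dm C k) \<and> k \<cdot> v = h"
    show "v = u"
      by (rule monic_cancel[OF assms(1)]) (use u v in \<open>auto simp: Hom_def\<close>)
  qed (use u in \<open>simp add: Hom_def\<close>)
qed (use assms monic_Ar in auto)

lemma preadditive_opp: "preadditive (opp C)"
proof (intro preadditive.intro preadditive_axioms.intro category.intro)
  show "comm_group (Hom_group (opp C) X Y)" if "X \<in> Ob (opp C)" "Y \<in> Ob (opp C)" for X Y
    using Hom_comm_group[of Y X] that by (simp add: Hom_group_def)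
qed (auto simp: Id_in_Hom Cmp_in_Hom Id_Cmp Cmp_Id Cmp_assoc Cmp_Add Add_Cmp)

lemma cokernel_epic:
  assumes "is_cokernel C k f"
  shows "epic C k"
  using preadditive.kernel_monic[OF preadditive_opp, of k f] assms by simp

end

section \<open>Exactness through generalized elements\<close>

context abelian
begin

lemma abelian_opp: "abelian (opp C)"
proof -
  interpret opp: preadditive "opp C"
    by (rule preadditive_opp)
  show ?thesis
  proof
    show "\<exists>Z. zero_object (opp C) Z"
      using ex_zero_object unfolding zero_object_def by (simp add: conj_commute)
    fix X Y assume "X \<in> Ob (opp C)" "Y \<in> Ob (opp C)"
    then obtain S i j p q where S: "is_biproduct C X Y S i j p q"
      using ex_biproduct[of X Y] by auto
    then have "is_biproduct (opp C) X Y S p q i j"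
      by (simp add: is_biproduct_def)
    then show "\<exists>S i j p q. is_biproduct (opp C) X Y S i j p q"
      by blast
  qed (simp_all add: ex_kernel ex_cokernel monic_normal epic_normal)
qed

lemma ker_map: "f \<in> Ar C \<Longrightarrow> is_kernel C (ker_map C f) f"
  unfolding ker_map_def by (rule someI_ex, rule ex_kernel)

lemma coker_map: "f \<in> Ar C \<Longrightarrow> is_cokernel C (coker_map C f) f"
  unfolding coker_map_def by (rule someI_ex, rule ex_cokernel)

lemma monic_kernel_of_cokernel:
  assumes "monic C m" "is_cokernel C c m"
  shows "is_kernel C m c"
proof -
  note [simp] = cokernel_types[OF assms(2)]
  obtain f where f: "is_kernel C m f"
    using monic_normal[OF assms(1)] by auto
  note [simp] = kernel_types[OF f]
  obtain u where u [simp]: "u \<in> Ar C" "Cd C u = Cd C f" "Dm C u = Cd C c" and uc: "u \<cdot> c = f"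
    using cokernel_factor[OF assms(2), of f] by auto
  show ?thesis
  proof (rule is_kernelI[OF assms(1)])
    fix h assume h [simp]: "h \<in> Ar C" "Cd C h = Dm C c" and "c \<cdot> h = Zero C (Dm C h) (Cd C c)"
    then have "(u \<cdot> c) \<cdot> h = Zero C (Dm C h) (Cd C f)"
      by simp
    then have "f \<cdot> h = Zero C (Dm C h) (Cd C f)"
      by (simp only: uc)
    then show "\<exists>u. u \<in> Ar C \<and> Dm C u = Dm C h \<and> Cd C u = Dm C m \<and> m \<cdot> u = h"
      using kernel_factor[OF f, of h] by auto
  qed auto
qed

lemma epic_cokernel_of_kernel:
  assumes "epic C e" "is_kernel C k e"
  shows "is_cokernel C e k"
  using abelian.monic_kernel_of_cokernel[OF abelian_opp, of e k] assms by simp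

text \<open>
  A form of short exactness that is visibly invariant under passage to the opposite category, which
  the defining condition, stated with an image, is not.
\<close>

lemma short_exact_iff: "short_exact C f g \<longleftrightarrow> is_kernel C f g \<and> is_cokernel C g f"
proof
  assume "short_exact C f g"
  then obtain m c where f: "monic C f" and g: "epic C g"
      and c: "is_cokernel C c f" and m: "is_kernel C m c" "is_kernel C m g"
    by (auto simp: short_exact_def exact_def is_image_def)
  note [simp] = kernel_types[OF m(1)] kernel_types[OF m(2)] cokernel_types[OF c]
  have fc: "is_kernel C f c"
    by (rule monic_kernel_of_cokernel[OF f c])
  obtain u where u [simp]: "u \<in> Ar C" "Dm C u = Dm C m" "Cd C u = Dm C f" and fu: "f \<cdot> u = m"
    using kernel_factor[OF fc, of m] by auto
  obtain v where v [simp]: "v \<in> Ar C" "Dm C v = Dm C f" "Cd C v = Dm C m" and mv: "m \<cdot> v = f"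
    using kernel_factor[OF m(1), of f] by auto
  have Dg [simp]: "Cd C f = Dm C g"
    using kernel_types(3)[OF fc] kernel_types(3)[OF m(1)] kernel_types(3)[OF m(2)] by simp
  have gf: "g \<cdot> f = Zero C (Dm C f) (Cd C g)"
    using extend_Zero[of g m v] by (simp add: mv)
  have "is_kernel C f g"
  proof (rule is_kernelI[OF f _ _ gf])
    fix h assume h [simp]: "h \<in> Ar C" "Cd C h = Dm C g" and gh: "g \<cdot> h = Zero C (Dm C h) (Cd C g)"
    obtain w where w [simp]: "w \<in> Ar C" "Dm C w = Dm C h" "Cd C w = Dm C m" and mw: "m \<cdot> w = h"
      using kernel_factor[OF m(2), of h] gh by auto
    have "f \<cdot> (u \<cdot> w) = (f \<cdot> u) \<cdot> w"
      by simp
    then have "f \<cdot> (u \<cdot> w) = h"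
      by (simp only: fu mw)
    then show "\<exists>u. u \<in> Ar C \<and> Dm C u = Dm C h \<and> Cd C u = Dm C f \<and> f \<cdot> u = h"
      by (intro exI[of _ "u \<cdot> w"]) simp
  qed auto
  then show "is_kernel C f g \<and> is_cokernel C g f"
    using epic_cokernel_of_kernel[OF g] by blast
next
  assume *: "is_kernel C f g \<and> is_cokernel C g f"
  then show "short_exact C f g"
    unfolding short_exact_def exact_def is_image_def
    using kernel_monic cokernel_epic by blast
qed

text \<open>
  That the first factor is an epimorphism rests on monomorphisms being kernels: an arrow vanishing
  on it has a kernel through which the image factors.
\<close>

lemma image_factor:
  assumes c: "is_cokernel C c f" and m: "is_kernel C m c"
  obtains e where "epic C e" "Dm C e = Dm C f" "Cd C e = Dm C m" "m \<cdot> e = f"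
proof -
  note [simp] = cokernel_types[OF c] kernel_types[OF m]
  obtain e where e [simp]: "e \<in> Ar C" "Dm C e = Dm C f" "Cd C e = Dm C m" and me: "m \<cdot> e = f"
    using kernel_factor[OF m, of f] by auto
  have "epic C e"
  proof (rule epicI)
    fix h assume h [simp]: "h \<in> Ar C" "Dm C h = Cd C e" and he: "h \<cdot> e = Zero C (Dm C e) (Cd C h)"
    \<comment> \<open>The kernel \<open>n\<close> of \<open>h\<close> gives a subobject \<open>m n\<close> through which \<open>f\<close> factors; it is the
      kernel of some \<open>g\<close>, and minimality of the image forces \<open>m\<close> to factor through \<open>m n\<close>.\<close>
    obtain n where n: "is_kernel C n h"
      using ex_kernel[of h] by auto
    note [simp] = kernel_types[OF n]
    obtain e' where e' [simp]: "e' \<in> Ar C" "Dm C e' = Dm C f" "Cd C e' = Dm C n" and ne: "n \<cdot> e' = e"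
      using kernel_factor[OF n, of e] he by auto
    have mn: "monic C (m \<cdot> n)"
    proof (rule monicI)
      fix x assume x [simp]: "x \<in> Ar C" "Cd C x = Dm C (m \<cdot> n)"
        and z: "(m \<cdot> n) \<cdot> x = Zero C (Dm C x) (Cd C (m \<cdot> n))"
      have [simp]: "Cd C x = Dm C n" using x(2) by simp
      have "n \<cdot> x = Zero C (Dm C x) (Dm C m)"
        using monic_Zero[OF kernel_monic[OF m], of "n \<cdot> x"] z by simp
      then show "x = Zero C (Dm C x) (Dm C (m \<cdot> n))"
        using monic_Zero[OF kernel_monic[OF n], of x] by simp
    qed simp
    obtain g where g: "is_kernel C (m \<cdot> n) g"
      using monic_normal[OF mn] by auto
    note [simp] = kernel_types(1)[OF g]
    have Dg [simp]: "Dm C g = Cd C f"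
      using kernel_types(3)[OF g] by simp
    have "g \<cdot> f = g \<cdot> (m \<cdot> (n \<cdot> e'))"
      by (simp only: ne me)
    also have "\<dots> = Zero C (Dm C f) (Cd C g)"
      using extend_Zero[of g "m \<cdot> n" e'] kernel_types(4)[OF g] by simp
    finally obtain g' where g' [simp]: "g' \<in> Ar C" "Cd C g' = Cd C g" "Dm C g' = Cd C c"
        and gc: "g' \<cdot> c = g"
      using cokernel_factor[OF c, of g] by auto
    have "g \<cdot> m = (g' \<cdot> c) \<cdot> m"
      by (simp only: gc)
    also have "\<dots> = Zero C (Dm C m) (Cd C g)"
      by simp
    finally obtain r where r [simp]: "r \<in> Ar C" "Dm C r = Dm C m" "Cd C r = Dm C n"
        and mr: "(m \<cdot> n) \<cdot> r = m"
      using kernel_factor[OF g, of m] by auto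
    have "n \<cdot> r = Id C (Dm C m)"
      by (rule monic_cancel[OF kernel_monic[OF m]]) (use mr in simp_all)
    then have "h = h \<cdot> (n \<cdot> r)"
      by simp
    also have "\<dots> = Zero C (Cd C e) (Cd C h)"
      using extend_Zero[of h n r] by simp
    finally show "h = Zero C (Cd C e) (Cd C h)" .
  qed simp
  then show thesis
    by (rule that) (use me in auto)
qed

text \<open>
  Epimorphisms are stable under pullback: a generalized element \<open>x\<close> of the target of an
  epimorphism \<open>e\<close> lifts along \<open>e\<close> after passing to a cover \<open>t\<close>. The pullback is the kernel of
  \<open>e - x\<close> on a biproduct; since \<open>e - x\<close> is the cokernel of this kernel, an arrow killing \<open>t\<close>
  extends along \<open>e - x\<close> and is then killed by \<open>e\<close>.
\<close>

lemma epic_cover: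
  assumes e: "epic C e" and x [simp]: "x \<in> Ar C" "Cd C x = Cd C e"
  obtains t y where "epic C t" "Cd C t = Dm C x" "y \<in> Ar C" "Dm C y = Dm C t" "Cd C y = Dm C e"
    "e \<cdot> y = x \<cdot> t"
proof -
  have [simp]: "e \<in> Ar C"
    using e by (rule epic_Ar)
  obtain S i j p q where S: "is_biproduct C (Dm C e) (Dm C x) S i j p q"
    using ex_biproduct[of "Dm C e" "Dm C x"] by auto
  note [simp] = biproduct_simps[OF S]
  obtain x' where x' [simp]: "x' \<in> Ar C" "Dm C x' = Dm C x" "Cd C x' = Cd C e"
      and xx: "Add C x x' = Zero C (Dm C x) (Cd C e)"
    using negative[OF x(1)] x(2) by metis
  define g where "g = Add C (e \<cdot> p) (x' \<cdot> q)"
  have g [simp]: "g \<in> Ar C" "Dm C g = S" "Cd C g = Cd C e"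
    by (simp_all add: g_def)
  have gi: "g \<cdot> i = e"
    by (simp add: g_def)
  have "epic C g"
  proof (rule epicI)
    fix h assume h [simp]: "h \<in> Ar C" "Dm C h = Cd C g" and hg: "h \<cdot> g = Zero C (Dm C g) (Cd C h)"
    have "h \<cdot> e = h \<cdot> (g \<cdot> i)"
      by (simp only: gi)
    also have "\<dots> = Zero C (Dm C e) (Cd C h)"
      using extend_Zero[of h g i] hg by simp
    finally show "h = Zero C (Cd C g) (Cd C h)"
      using epic_Zero[OF e, of h] by simp
  qed simp
  obtain k where k: "is_kernel C k g"
    using ex_kernel[of g] by auto
  note [simp] = kernel_types[OF k]
  have gk: "is_cokernel C g k"
    by (rule epic_cokernel_of_kernel) fact+
  have "epic C (q \<cdot> k)"
  proof (rule epicI)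
    fix h assume h [simp]: "h \<in> Ar C" "Dm C h = Cd C (q \<cdot> k)"
      and hz: "h \<cdot> (q \<cdot> k) = Zero C (Dm C (q \<cdot> k)) (Cd C h)"
    have [simp]: "Dm C h = Dm C x" using h by simp
    obtain h' where h' [simp]: "h' \<in> Ar C" "Cd C h' = Cd C h" "Dm C h' = Cd C e" and hg: "h' \<cdot> g = h \<cdot> q"
      using cokernel_factor[OF gk, of "h \<cdot> q"] hz by auto
    have "h' \<cdot> e = (h' \<cdot> g) \<cdot> i"
      using gi by simp
    also have "\<dots> = Zero C (Dm C e) (Cd C h)"
      unfolding hg by simp
    finally have "h' = Zero C (Cd C e) (Cd C h)"
      using epic_Zero[OF e, of h'] by simp
    then have "h \<cdot> q = Zero C S (Cd C h)"
      using hg by simp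
    then have "(h \<cdot> q) \<cdot> j = Zero C (Dm C x) (Cd C h)"
      by simp
    then show "h = Zero C (Cd C (q \<cdot> k)) (Cd C h)"
      by simp
  qed simp
  moreover have "e \<cdot> (p \<cdot> k) = x \<cdot> (q \<cdot> k)"
  proof -
    have "Add C (x' \<cdot> (q \<cdot> k)) (e \<cdot> (p \<cdot> k)) = g \<cdot> k"
      unfolding g_def by (subst Add_commute) auto
    also have "\<dots> = Add C x x' \<cdot> (q \<cdot> k)"
      unfolding xx by simp
    also have "\<dots> = Add C (x' \<cdot> (q \<cdot> k)) (x \<cdot> (q \<cdot> k))"
      by (subst Add_commute[of x]) auto
    finally show ?thesis
      by (rule Add_cancel) auto
  qed
  ultimately show thesis
    by (intro that[of "q \<cdot> k" "p \<cdot> k"]) auto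
qed

text \<open>
  Exactness as a lifting property of generalized elements: an element of the kernel of \<open>g\<close> comes
  from an element along \<open>f\<close>, after passing to a cover \<open>t\<close>. This replaces the usual diagram chases.
\<close>

lemma exact_iff:
  assumes [simp]: "f \<in> Ar C" "g \<in> Ar C" "Cd C f = Dm C g"
  shows "exact C f g \<longleftrightarrow> g \<cdot> f = Zero C (Dm C f) (Cd C g) \<and>
    (\<forall>x. x \<in> Ar C \<longrightarrow> Cd C x = Dm C g \<longrightarrow> g \<cdot> x = Zero C (Dm C x) (Cd C g) \<longrightarrow>
      (\<exists>t y. epic C t \<and> Cd C t = Dm C x \<and> y \<in> Ar C \<and> Dm C y = Dm C t \<and> Cd C y = Dm C f \<and> f \<cdot> y = x \<cdot> t))"
    (is "_ = (_ \<and> (\<forall>x. ?a x \<longrightarrow> ?b x \<longrightarrow> ?c x \<longrightarrow> ?E x))")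
proof
  assume "exact C f g"
  then obtain c m where c: "is_cokernel C c f" and m: "is_kernel C m c" "is_kernel C m g"
    by (auto simp: exact_def is_image_def)
  note [simp] = kernel_types[OF m(2)]
  obtain e where e: "epic C e" and [simp]: "Dm C e = Dm C f" "Cd C e = Dm C m" and me: "m \<cdot> e = f"
    using image_factor[OF c m(1)] by blast
  note [simp] = epic_Ar[OF e]
  have "g \<cdot> f = Zero C (Dm C f) (Cd C g)"
    using extend_Zero[of g m e] by (simp add: me)
  moreover have "?E x" if x [simp]: "?a x" "?b x" and gx: "?c x" for x
  proof -
    obtain u where u [simp]: "u \<in> Ar C" "Dm C u = Dm C x" "Cd C u = Dm C m" and mu: "m \<cdot> u = x"
      using kernel_factor[OF m(2), of x] gx by auto
    obtain t y where t: "epic C t" and [simp]: "Cd C t = Dm C u" "y \<in> Ar C" "Dm C y = Dm C t"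
        "Cd C y = Dm C e" and ey: "e \<cdot> y = u \<cdot> t"
      using epic_cover[OF e, of u] by auto
    note [simp] = epic_Ar[OF t]
    have "f \<cdot> y = (m \<cdot> e) \<cdot> y"
      by (simp only: me)
    also have "\<dots> = (m \<cdot> u) \<cdot> t"
      by (simp add: ey)
    finally have "f \<cdot> y = x \<cdot> t"
      by (simp only: mu)
    with t show ?thesis
      by (intro exI[of _ t] exI[of _ y]) simp
  qed
  ultimately show "g \<cdot> f = Zero C (Dm C f) (Cd C g) \<and> (\<forall>x. ?a x \<longrightarrow> ?b x \<longrightarrow> ?c x \<longrightarrow> ?E x)"
    by blast
next
  assume *: "g \<cdot> f = Zero C (Dm C f) (Cd C g) \<and> (\<forall>x. ?a x \<longrightarrow> ?b x \<longrightarrow> ?c x \<longrightarrow> ?E x)"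
  obtain m where m: "is_kernel C m g"
    using ex_kernel[of g] by auto
  note [simp] = kernel_types[OF m]
  obtain c where c: "is_cokernel C c f"
    using ex_cokernel[of f] by auto
  note [simp] = cokernel_types[OF c]
  obtain t y where t: "epic C t" and [simp]: "Cd C t = Dm C m" "y \<in> Ar C" "Dm C y = Dm C t"
      "Cd C y = Dm C f" and fy: "f \<cdot> y = m \<cdot> t"
    using * by (metis kernel_types(2-4)[OF m])
  note [simp] = epic_Ar[OF t]
  have "(c \<cdot> m) \<cdot> t = c \<cdot> (f \<cdot> y)"
    by (simp add: fy)
  also have "\<dots> = Zero C (Dm C t) (Cd C c)"
    using extend_Zero[of c f y] by simp
  finally have cm: "c \<cdot> m = Zero C (Dm C m) (Cd C c)"
    using epic_Zero[OF t, of "c \<cdot> m"] by simp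
  obtain g' where [simp]: "g' \<in> Ar C" "Cd C g' = Cd C g" "Dm C g' = Cd C c" and gc: "g' \<cdot> c = g"
    using cokernel_factor[OF c, of g] * by auto
  have "is_kernel C m c"
  proof (rule is_kernelI)
    show "monic C m"
      by (rule kernel_monic[OF m])
    fix h assume [simp]: "h \<in> Ar C" "Cd C h = Dm C c" and ch: "c \<cdot> h = Zero C (Dm C h) (Cd C c)"
    have "(g' \<cdot> c) \<cdot> h = Zero C (Dm C h) (Cd C g)"
      by (simp add: ch)
    then have "g \<cdot> h = Zero C (Dm C h) (Cd C g)"
      by (simp only: gc)
    then show "\<exists>u. u \<in> Ar C \<and> Dm C u = Dm C h \<and> Cd C u = Dm C m \<and> m \<cdot> u = h"
      using kernel_factor[OF m, of h] by auto
  qed (use cm in auto)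
  with c m show "exact C f g"
    unfolding exact_def is_image_def by blast
qed

text \<open>
  The epimorphism \<open>e\<close> has the same kernel as \<open>d\<close>, namely the image of \<open>f\<close>; so \<open>c\<close> is a monomorphism.
  It has the same image as \<open>d\<close>, which is the kernel of \<open>g\<close>.
\<close>

lemma kernel_from_exact:
  assumes fd: "exact C f d" and dg: "exact C d g" and e: "is_cokernel C e f"
    and [simp]: "d \<in> Ar C" "g \<in> Ar C" "c \<in> Ar C"
      "Cd C f = Dm C d" "Cd C d = Dm C g" "Dm C c = Cd C e" "Cd C c = Dm C g"
    and ce: "c \<cdot> e = d"
  shows "is_kernel C c g"
proof -
  note [simp] = cokernel_types[OF e]
  note fd' = fd[unfolded exact_iff[OF cokernel_types(1)[OF e] \<open>d \<in> Ar C\<close> \<open>Cd C f = Dm C d\<close>]]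
  note dg' = dg[unfolded exact_iff[OF \<open>d \<in> Ar C\<close> \<open>g \<in> Ar C\<close> \<open>Cd C d = Dm C g\<close>]]
  note ee = cokernel_epic[OF e]
  have c: "monic C c"
  proof (rule monicI)
    fix x assume [simp]: "x \<in> Ar C" "Cd C x = Dm C c" and cx: "c \<cdot> x = Zero C (Dm C x) (Cd C c)"
    obtain t y where t: "epic C t" and [simp]: "Cd C t = Dm C x" "y \<in> Ar C" "Dm C y = Dm C t"
        "Cd C y = Dm C d" and ey: "e \<cdot> y = x \<cdot> t"
      using epic_cover[OF ee, of x] by auto
    note [simp] = epic_Ar[OF t]
    have "d \<cdot> y = (c \<cdot> e) \<cdot> y"
      by (simp only: ce)
    also have "\<dots> = Zero C (Dm C y) (Cd C d)"
      using extend_Zero[of c x t] cx by (simp add: ey)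
    finally obtain t' z where t': "epic C t'" and [simp]: "Cd C t' = Dm C y" "z \<in> Ar C" "Dm C z = Dm C t'"
        "Cd C z = Dm C f" and fz: "f \<cdot> z = y \<cdot> t'"
      using fd'[THEN conjunct2, rule_format, of y] by auto
    note [simp] = epic_Ar[OF t']
    have "x \<cdot> (t \<cdot> t') = (e \<cdot> y) \<cdot> t'"
      unfolding ey by simp
    also have "\<dots> = e \<cdot> (f \<cdot> z)"
      by (simp add: fz)
    also have "\<dots> = Zero C (Dm C t') (Cd C e)"
      using extend_Zero[of e f z] by simp
    finally show "x = Zero C (Dm C x) (Dm C c)"
      using epic_Zero[OF epic_Cmp[OF t' t], of x] by simp
  qed simp
  show ?thesis
  proof (rule is_kernelI[OF c])
    have "(g \<cdot> c) \<cdot> e = Zero C (Dm C e) (Cd C g)"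
      using dg' ce by simp
    then show "g \<cdot> c = Zero C (Dm C c) (Cd C g)"
      using epic_Zero[OF ee, of "g \<cdot> c"] by simp
    fix x assume [simp]: "x \<in> Ar C" "Cd C x = Dm C g" and gx: "g \<cdot> x = Zero C (Dm C x) (Cd C g)"
    then obtain t y where t: "epic C t" and [simp]: "Cd C t = Dm C x" "y \<in> Ar C" "Dm C y = Dm C t"
        "Cd C y = Dm C d" and dy: "d \<cdot> y = x \<cdot> t"
      using dg'[THEN conjunct2, rule_format, of x] by auto
    note [simp] = epic_Ar[OF t]
    obtain k where k: "is_kernel C k t"
      using ex_kernel[of t] by auto
    note [simp] = kernel_types[OF k]
    have "(c \<cdot> e) \<cdot> y = x \<cdot> t"
      by (simp only: dy ce)
    then have cey: "c \<cdot> (e \<cdot> y) = x \<cdot> t"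
      by simp
    have "c \<cdot> ((e \<cdot> y) \<cdot> k) = (c \<cdot> (e \<cdot> y)) \<cdot> k"
      by simp
    also have "\<dots> = Zero C (Dm C k) (Cd C c)"
      unfolding cey by simp
    finally have "(e \<cdot> y) \<cdot> k = Zero C (Dm C k) (Dm C c)"
      using monic_Zero[OF c, of "(e \<cdot> y) \<cdot> k"] by simp
    then obtain u where [simp]: "u \<in> Ar C" "Cd C u = Dm C c" "Dm C u = Dm C x" and ut: "u \<cdot> t = e \<cdot> y"
      using cokernel_factor[OF epic_cokernel_of_kernel[OF t k], of "e \<cdot> y"] by auto
    have "(c \<cdot> u) \<cdot> t = x \<cdot> t"
      by (simp add: ut cey)
    then have "c \<cdot> u = x"
      by (rule epic_cancel[OF t, rotated -1]) auto
    then show "\<exists>u. u \<in> Ar C \<and> Dm C u = Dm C x \<and> Cd C u = Dm C c \<and> c \<cdot> u = x"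
      by (intro exI[of _ u]) simp
  qed auto
qed

end

section \<open>Morphisms of short exact sequences\<close>

text \<open>
  The pair \<open>w\<close>, \<open>f\<close> consists of the two outer components of a morphism from \<open>(a, b)\<close> to
  \<open>(a', b')\<close>. Satellites and their connecting arrows only see the outer components; passing to
  the opposite category exchanges them.
\<close>

definition ends :: "('o, 'a, 'x) cat_scheme \<Rightarrow> 'a \<Rightarrow> 'a \<Rightarrow> 'a \<Rightarrow> 'a \<Rightarrow> 'a \<Rightarrow> 'a \<Rightarrow> bool" where
  "ends C a b a' b' w f \<longleftrightarrow> w \<in> Hom C (Dm C a) (Dm C a') \<and> f \<in> Hom C (Cd C b) (Cd C b') \<and>
     (\<exists>u \<in> Hom C (Dm C b) (Dm C b'). u \<cdot>\<^bsub>C\<^esub> a = a' \<cdot>\<^bsub>C\<^esub> w \<and> b' \<cdot>\<^bsub>C\<^esub> u = f \<cdot>\<^bsub>C\<^esub> b)"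

lemma endsI:
  assumes "w \<in> Ar C" "Dm C w = Dm C a" "Cd C w = Dm C a'"
    "f \<in> Ar C" "Dm C f = Cd C b" "Cd C f = Cd C b'"
    "u \<in> Ar C" "Dm C u = Dm C b" "Cd C u = Dm C b'"
    "u \<cdot>\<^bsub>C\<^esub> a = a' \<cdot>\<^bsub>C\<^esub> w" "b' \<cdot>\<^bsub>C\<^esub> u = f \<cdot>\<^bsub>C\<^esub> b"
  shows "ends C a b a' b' w f"
  using assms by (auto simp: ends_def Hom_def)

lemma ends_types:
  assumes "ends C a b a' b' w f"
  shows "w \<in> Ar C" "Dm C w = Dm C a" "Cd C w = Dm C a'"
    "f \<in> Ar C" "Dm C f = Cd C b" "Cd C f = Cd C b'"
  using assms by (auto simp: ends_def Hom_def)

lemma endsE: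
  assumes "ends C a b a' b' w f"
  obtains u where "u \<in> Ar C" "Dm C u = Dm C b" "Cd C u = Dm C b'"
    "u \<cdot>\<^bsub>C\<^esub> a = a' \<cdot>\<^bsub>C\<^esub> w" "b' \<cdot>\<^bsub>C\<^esub> u = f \<cdot>\<^bsub>C\<^esub> b"
  using assms by (auto simp: ends_def Hom_def)

context abelian
begin

lemma ses_types:
  assumes "short_exact C a b"
  shows "a \<in> Ar C" "b \<in> Ar C" "Cd C a = Dm C b" "b \<cdot> a = Zero C (Dm C a) (Cd C b)"
    "is_kernel C a b" "is_cokernel C b a" "monic C a" "epic C b"
  using assms kernel_types[of a b] kernel_monic cokernel_epic by (auto simp: short_exact_iff)

lemma short_exact_opp: "short_exact C a b \<Longrightarrow> short_exact (opp C) b a"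
  by (simp add: short_exact_iff abelian.short_exact_iff[OF abelian_opp])

lemma ends_opp:
  assumes "short_exact C a b" "short_exact C a' b'"
  shows "ends (opp C) b' a' b a f w \<longleftrightarrow> ends C a b a' b' w f"
  using ses_types(3)[OF assms(1)] ses_types(3)[OF assms(2)] by (auto simp: ends_def)

lemma ends_Id:
  assumes "short_exact C a b"
  shows "ends C a b a b (Id C (Dm C a)) (Id C (Cd C b))"
  using ses_types[OF assms] by (intro endsI[where u = "Id C (Dm C b)"]) auto

lemma ends_Cmp:
  assumes "ends C a b a' b' w f" "ends C a' b' a'' b'' w' f'"
    "short_exact C a b" "short_exact C a' b'" "short_exact C a'' b''"
  shows "ends C a b a'' b'' (w' \<cdot> w) (f' \<cdot> f)"
proof -
  note [simp] = ses_types(1-3)[OF assms(3)] ses_types(1-3)[OF assms(4)] ses_types(1-3)[OF assms(5)]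
    ends_types[OF assms(1)] ends_types[OF assms(2)]
  obtain u where [simp]: "u \<in> Ar C" "Dm C u = Dm C b" "Cd C u = Dm C b'"
    and u: "u \<cdot> a = a' \<cdot> w" "b' \<cdot> u = f \<cdot> b"
    using endsE[OF assms(1)] by blast
  obtain u' where [simp]: "u' \<in> Ar C" "Dm C u' = Dm C b'" "Cd C u' = Dm C b''"
    and u': "u' \<cdot> a' = a'' \<cdot> w'" "b'' \<cdot> u' = f' \<cdot> b'"
    using endsE[OF assms(2)] by blast
  show ?thesis
  proof (rule endsI[where u = "u' \<cdot> u"])
    show "(u' \<cdot> u) \<cdot> a = a'' \<cdot> (w' \<cdot> w)"
      using extend[OF u'(1), of w] by (simp add: u)
    show "b'' \<cdot> (u' \<cdot> u) = (f' \<cdot> f) \<cdot> b"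
      using extend[OF u'(2), of u] by (simp add: u)
  qed auto
qed

lemma ends_Add:
  assumes "ends C a b a' b' w f" "ends C a b a' b' w' f'" "short_exact C a b" "short_exact C a' b'"
  shows "ends C a b a' b' (Add C w w') (Add C f f')"
proof -
  note [simp] = ses_types(1-3)[OF assms(3)] ses_types(1-3)[OF assms(4)]
    ends_types[OF assms(1)] ends_types[OF assms(2)]
  obtain u where [simp]: "u \<in> Ar C" "Dm C u = Dm C b" "Cd C u = Dm C b'"
    and u [simp]: "u \<cdot> a = a' \<cdot> w" "b' \<cdot> u = f \<cdot> b"
    using endsE[OF assms(1)] by blast
  obtain u' where [simp]: "u' \<in> Ar C" "Dm C u' = Dm C b" "Cd C u' = Dm C b'"
    and u' [simp]: "u' \<cdot> a = a' \<cdot> w'" "b' \<cdot> u' = f' \<cdot> b"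
    using endsE[OF assms(2)] by blast
  show ?thesis
    by (rule endsI[where u = "Add C u u'"]) auto
qed

lemma ends_lift:
  assumes "short_exact C a b" "short_exact C a' b'" "projective C (Dm C b)"
    "f \<in> Ar C" "Dm C f = Cd C b" "Cd C f = Cd C b'"
  obtains w where "ends C a b a' b' w f"
proof -
  note [simp] = ses_types(1-4)[OF assms(1)] ses_types(1-4)[OF assms(2)] assms(4-6)
  have "f \<cdot> b \<in> Hom C (Dm C b) (Cd C b')"
    by (simp add: Hom_def)
  then obtain u where [simp]: "u \<in> Ar C" "Dm C u = Dm C b" "Cd C u = Dm C b'" and u: "b' \<cdot> u = f \<cdot> b"
    using assms(3) ses_types(8)[OF assms(2)] unfolding projective_def Hom_def by blast
  have "b' \<cdot> (u \<cdot> a) = Zero C (Dm C a) (Cd C b')"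
    using extend[OF u, of a] by simp
  then obtain w where "w \<in> Ar C" "Dm C w = Dm C a" "Cd C w = Dm C a'" "a' \<cdot> w = u \<cdot> a"
    using kernel_factor[OF ses_types(5)[OF assms(2)], of "u \<cdot> a"] by auto
  then have "ends C a b a' b' w f"
    by (intro endsI[where u = u]) (auto simp: u)
  then show thesis ..
qed

text \<open>
  The middle components of two such morphisms differ by an arrow into the kernel \<open>a'\<close> of \<open>b'\<close>, whose
  restriction along \<open>a\<close> is the difference of \<open>w\<close> and \<open>w'\<close>. So the left end is determined by the
  right one up to arrows that factor through \<open>a\<close>, and an additive functor \<open>F\<close> sends these to arrows
  that vanish on the kernel of \<open>F a\<close>.
\<close>

lemma ends_unique:
  assumes "ends C a b a' b' w f" "ends C a b a' b' w' f" "short_exact C a b" "short_exact C a' b'"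
  obtains h where "h \<in> Ar C" "Dm C h = Dm C b" "Cd C h = Dm C a'" "w = Add C w' (h \<cdot> a)"
proof -
  note [simp] = ses_types(1-3)[OF assms(3)] ses_types(1-3)[OF assms(4)]
    ends_types[OF assms(1)] ends_types[OF assms(2)]
  obtain u where [simp]: "u \<in> Ar C" "Dm C u = Dm C b" "Cd C u = Dm C b'"
    and u: "u \<cdot> a = a' \<cdot> w" "b' \<cdot> u = f \<cdot> b"
    using endsE[OF assms(1)] by blast
  obtain u' where [simp]: "u' \<in> Ar C" "Dm C u' = Dm C b" "Cd C u' = Dm C b'"
    and u' [simp]: "u' \<cdot> a = a' \<cdot> w'" "b' \<cdot> u' = f \<cdot> b"
    using endsE[OF assms(2)] by blast
  obtain d where d [simp]: "d \<in> Ar C" "Dm C d = Dm C b" "Cd C d = Dm C b'" and ud: "u = Add C u' d"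
    by (rule difference[of u u']) auto
  have "Add C (f \<cdot> b) (b' \<cdot> d) = f \<cdot> b"
    using u(2) unfolding ud by simp
  then have "b' \<cdot> d = Zero C (Dm C b) (Cd C b')"
    using Add_cancel_Zero[of "f \<cdot> b" "b' \<cdot> d"] by simp
  then obtain h where h [simp]: "h \<in> Ar C" "Dm C h = Dm C b" "Cd C h = Dm C a'" and ah: "a' \<cdot> h = d"
    using kernel_factor[OF ses_types(5)[OF assms(4)], of d] by auto
  have dh: "d \<cdot> a = a' \<cdot> (h \<cdot> a)"
    unfolding ah[symmetric] by simp
  have "a' \<cdot> w = a' \<cdot> Add C w' (h \<cdot> a)"
    using u(1) unfolding ud by (simp add: dh)
  then have "w = Add C w' (h \<cdot> a)"
    by (intro monic_cancel[OF ses_types(7)[OF assms(4)] _ _ _ _ _, of w]) auto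
  then show thesis
    by (rule that[rotated -1]) auto
qed

end

section \<open>Additive functors and their natural transformations\<close>

text \<open>
  Naturality of a bare family of arrows. A natural transformation record carries its source and its
  target, which passage to the opposite categories exchanges; the family itself stays the same.
\<close>

definition natural :: "('o, 'a, 'x) cat_scheme \<Rightarrow> ('p, 'b, 'y) cat_scheme \<Rightarrow> ('o, 'a, 'p, 'b) func
    \<Rightarrow> ('o, 'a, 'p, 'b) func \<Rightarrow> ('o \<Rightarrow> 'b) \<Rightarrow> bool" where
  "natural C D F G t \<longleftrightarrow> (\<forall>X \<in> Ob C. t X \<in> Hom D (FOb F X) (FOb G X)) \<and>
     (\<forall>f \<in> Ar C. t (Cd C f) \<cdot>\<^bsub>D\<^esub> FAr F f = FAr G f \<cdot>\<^bsub>D\<^esub> t (Dm C f))"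

lemma natural_opp [simp]: "natural (opp C) (opp D) F G t \<longleftrightarrow> natural C D G F t"
  by (auto simp: natural_def)

lemma natural_types:
  assumes "natural C D F G t" "X \<in> Ob C"
  shows "t X \<in> Ar D" "Dm D (t X) = FOb F X" "Cd D (t X) = FOb G X"
  using assms by (auto simp: natural_def Hom_def)

lemma natural_square:
  assumes "natural C D F G t" "f \<in> Ar C"
  shows "t (Cd C f) \<cdot>\<^bsub>D\<^esub> FAr F f = FAr G f \<cdot>\<^bsub>D\<^esub> t (Dm C f)"
  using assms by (auto simp: natural_def)

lemma additive_functor_opp:
  assumes "additive_functor C D F"
  shows "additive_functor (opp C) (opp D) F"
proof -
  interpret additive_functor C D F by fact
  show ?thesis
    by (intro additive_functor.intro is_functor.intro additive_functor_axioms.intro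
        is_functor_axioms.intro source.preadditive_opp target.preadditive_opp
        preadditive.axioms(1)[OF source.preadditive_opp] preadditive.axioms(1)[OF target.preadditive_opp])
      (use FOb_PiE FAr_PiE FAr_Hom FAr_Id FAr_Cmp FAr_Add in \<open>auto simp del: PiE_iff\<close>)
qed

locale abelian_pair = A: abelian A + B: abelian B
  for A :: "('o, 'a, 'x) ab_cat_scheme" and B :: "('p, 'b, 'y) ab_cat_scheme"
begin

lemma abelian_pair_opp: "abelian_pair (opp A) (opp B)"
  by (intro abelian_pair.intro A.abelian_opp B.abelian_opp)

lemma additive_functorI:
  assumes "FOb F \<in> Ob A \<rightarrow>\<^sub>E Ob B" "FAr F \<in> extensional (Ar A)"
    and "\<And>f. f \<in> Ar A \<Longrightarrow> FAr F f \<in> Hom B (FOb F (Dm A f)) (FOb F (Cd A f))"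
    and "\<And>X. X \<in> Ob A \<Longrightarrow> FAr F (Id A X) = Id B (FOb F X)"
    and "\<And>f g. f \<in> Ar A \<Longrightarrow> g \<in> Ar A \<Longrightarrow> Cd A f = Dm A g
      \<Longrightarrow> FAr F (g \<cdot>\<^bsub>A\<^esub> f) = FAr F g \<cdot>\<^bsub>B\<^esub> FAr F f"
    and "\<And>f g. f \<in> Ar A \<Longrightarrow> g \<in> Ar A \<Longrightarrow> Dm A f = Dm A g \<Longrightarrow> Cd A f = Cd A g
      \<Longrightarrow> FAr F (Add A f g) = Add B (FAr F f) (FAr F g)"
  shows "additive_functor A B F"
  by (intro additive_functor.intro is_functor.intro additive_functor_axioms.intro
      is_functor_axioms.intro A.preadditive_axioms B.preadditive_axioms A.category_axioms B.category_axioms)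
    (use assms in \<open>auto simp: Hom_def PiE_def\<close>)

context
  fixes F assumes F: "additive_functor A B F"
begin

lemma FOb_Ob [simp]: "X \<in> Ob A \<Longrightarrow> FOb F X \<in> Ob B"
  using is_functor.FOb_PiE[OF additive_functor.axioms(3)[OF F]] by auto

lemma FAr_types [simp]:
  assumes "f \<in> Ar A"
  shows "FAr F f \<in> Ar B" "Dm B (FAr F f) = FOb F (Dm A f)" "Cd B (FAr F f) = FOb F (Cd A f)"
  using is_functor.FAr_Hom[OF additive_functor.axioms(3)[OF F], of f] assms by (auto simp: Hom_def)

lemma FAr_Id' [simp]: "X \<in> Ob A \<Longrightarrow> FAr F (Id A X) = Id B (FOb F X)"
  using is_functor.FAr_Id[OF additive_functor.axioms(3)[OF F]] by auto

lemma FAr_Cmp' [simp]: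
  assumes "f \<in> Ar A" "g \<in> Ar A" "Cd A f = Dm A g"
  shows "FAr F (g \<cdot>\<^bsub>A\<^esub> f) = FAr F g \<cdot>\<^bsub>B\<^esub> FAr F f"
  using is_functor.FAr_Cmp[OF additive_functor.axioms(3)[OF F], of f] assms by (auto simp: Hom_def)

lemma FAr_Add' [simp]:
  assumes "f \<in> Ar A" "g \<in> Ar A" "Dm A f = Dm A g" "Cd A f = Cd A g"
  shows "FAr F (Add A f g) = Add B (FAr F f) (FAr F g)"
  using additive_functor.FAr_Add[OF F, of f "Dm A f" "Cd A f" g] assms by (auto simp: Hom_def)

lemma FAr_Zero [simp]:
  assumes "X \<in> Ob A" "Y \<in> Ob A"
  shows "FAr F (Zero A X Y) = Zero B (FOb F X) (FOb F Y)"
proof -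
  have "Add B (FAr F (Zero A X Y)) (FAr F (Zero A X Y)) = FAr F (Add A (Zero A X Y) (Zero A X Y))"
    using assms by (subst FAr_Add') auto
  then show ?thesis
    using B.Add_cancel_Zero[of "FAr F (Zero A X Y)" "FAr F (Zero A X Y)"] assms by simp
qed

lemma FAr_square:
  assumes "g \<cdot>\<^bsub>A\<^esub> f = g' \<cdot>\<^bsub>A\<^esub> f'" "f \<in> Ar A" "g \<in> Ar A" "Cd A f = Dm A g"
    "f' \<in> Ar A" "g' \<in> Ar A" "Cd A f' = Dm A g'"
  shows "FAr F g \<cdot>\<^bsub>B\<^esub> FAr F f = FAr F g' \<cdot>\<^bsub>B\<^esub> FAr F f'"
  using arg_cong[OF assms(1), of "FAr F"] assms(2-) by simp

lemma FAr_vanish: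
  assumes "g \<cdot>\<^bsub>A\<^esub> f = Zero A (Dm A f) (Cd A g)" "f \<in> Ar A" "g \<in> Ar A" "Cd A f = Dm A g"
  shows "FAr F g \<cdot>\<^bsub>B\<^esub> FAr F f = Zero B (FOb F (Dm A f)) (FOb F (Cd A g))"
  using arg_cong[OF assms(1), of "FAr F"] assms(2-) by simp

end

end

section \<open>The left satellite\<close>

text \<open>
  Defined on bare families of arrows, so that the opposite categories yield the corresponding
  components of the right satellite.
\<close>

definition left_sat_map :: "('o, 'a, 'x) ab_cat_scheme \<Rightarrow> ('p, 'b, 'y) ab_cat_scheme
    \<Rightarrow> ('o \<Rightarrow> 'a) \<Rightarrow> ('o \<Rightarrow> 'a) \<Rightarrow> ('o, 'a, 'p, 'b) func \<Rightarrow> ('o, 'a, 'p, 'b) func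
    \<Rightarrow> ('o \<Rightarrow> 'b) \<Rightarrow> 'o \<Rightarrow> 'b" where
  "left_sat_map C D i p F G t X =
     (THE g. g \<in> Hom D (FOb (left_sat_ob C D i p F) X) (FOb (left_sat_ob C D i p G) X) \<and>
        ker_map D (FAr G (i X)) \<cdot>\<^bsub>D\<^esub> g = t (Dm C (i X)) \<cdot>\<^bsub>D\<^esub> ker_map D (FAr F (i X)))"

locale projective_presented = abelian_pair +
  fixes i p :: "'o \<Rightarrow> 'a"
  assumes presentations: "projective_presentations A i p"
begin

abbreviation S where "S \<equiv> left_sat_ob A B i p"

abbreviation K where "K F X \<equiv> ker_map B (FAr F (i X))"

lemma ses_ip: "X \<in> Ob A \<Longrightarrow> short_exact A (i X) (p X)"
  using presentations by (simp add: projective_presentations_def)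

lemma ip_types [simp]:
  assumes "X \<in> Ob A"
  shows "i X \<in> Ar A" "p X \<in> Ar A" "Cd A (i X) = Dm A (p X)" "Cd A (p X) = X"
    "p X \<cdot>\<^bsub>A\<^esub> i X = Zero A (Dm A (i X)) X"
  using presentations A.ses_types(1-4)[OF ses_ip[OF assms]] assms
  by (auto simp: projective_presentations_def)

lemma projective_p: "X \<in> Ob A \<Longrightarrow> projective A (Dm A (p X))"
  using presentations by (simp add: projective_presentations_def)

lemma lift_exists:
  assumes "X \<in> Ob A" "short_exact A a b" "f \<in> Ar A" "Dm A f = X" "Cd A f = Cd A b"
  obtains w where "ends A (i X) (p X) a b w f"
  by (rule A.ends_lift[OF ses_ip[OF assms(1)] assms(2) projective_p[OF assms(1)], of f])
    (use assms in auto)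

context
  fixes F assumes F [simp]: "additive_functor A B F"
begin

lemma kernel_K: "X \<in> Ob A \<Longrightarrow> is_kernel B (K F X) (FAr F (i X))"
  by (rule B.ker_map) (simp add: F)

lemma monic_K: "X \<in> Ob A \<Longrightarrow> monic B (K F X)"
  by (rule B.kernel_monic, rule kernel_K)

lemma K_types [simp]:
  assumes "X \<in> Ob A"
  shows "K F X \<in> Ar B" "Dm B (K F X) = FOb (S F) X" "Cd B (K F X) = FOb F (Dm A (i X))"
    "FAr F (i X) \<cdot>\<^bsub>B\<^esub> K F X = Zero B (FOb (S F) X) (FOb F (Dm A (p X)))" "FOb (S F) X \<in> Ob B"
proof -
  note * = B.kernel_types[OF kernel_K[OF assms]]
  show D: "Dm B (K F X) = FOb (S F) X"
    using assms by (simp add: left_sat_ob_def Let_def)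
  show "K F X \<in> Ar B" "Cd B (K F X) = FOb F (Dm A (i X))"
    "FAr F (i X) \<cdot>\<^bsub>B\<^esub> K F X = Zero B (FOb (S F) X) (FOb F (Dm A (p X)))"
    using * assms F by (auto simp: D)
  show "FOb (S F) X \<in> Ob B"
    using * B.Dm_Cd_Ob(1)[of "K F X"] D by simp
qed

text \<open>
  Independence of the chosen lift, for the arrow part of the satellite (with \<open>(a, b)\<close> one of the
  chosen presentations) as well as for connecting arrows (with \<open>f\<close> an identity).
\<close>

lemma K_independent:
  assumes "X \<in> Ob A" "short_exact A a b" "ends A (i X) (p X) a b w f" "ends A (i X) (p X) a b w' f"
  shows "FAr F w \<cdot>\<^bsub>B\<^esub> K F X = FAr F w' \<cdot>\<^bsub>B\<^esub> K F X"
proof -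
  note [simp] = ends_types[OF assms(3)] ends_types[OF assms(4)] A.ses_types(1-3)[OF assms(2)] assms(1)
  obtain h where [simp]: "h \<in> Ar A" "Dm A h = Dm A (p X)" "Cd A h = Dm A a"
    and w: "w = Add A w' (h \<cdot>\<^bsub>A\<^esub> i X)"
    using A.ends_unique[OF assms(3,4) ses_ip[OF assms(1)] assms(2)] by blast
  show ?thesis
    unfolding w using F by simp
qed

lemma K_lift:
  assumes "X \<in> Ob A" "short_exact A a b" "ends A (i X) (p X) a b w f"
  shows "FAr F a \<cdot>\<^bsub>B\<^esub> (FAr F w \<cdot>\<^bsub>B\<^esub> K F X) = Zero B (FOb (S F) X) (FOb F (Cd A a))"
proof -
  note [simp] = ends_types[OF assms(3)] A.ses_types(1-3)[OF assms(2)] assms(1) F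
  obtain u where [simp]: "u \<in> Ar A" "Dm A u = Dm A (p X)" "Cd A u = Dm A b"
    and u: "u \<cdot>\<^bsub>A\<^esub> i X = a \<cdot>\<^bsub>A\<^esub> w"
    using endsE[OF assms(3)] by blast
  have "FAr F a \<cdot>\<^bsub>B\<^esub> (FAr F w \<cdot>\<^bsub>B\<^esub> K F X) = FAr F u \<cdot>\<^bsub>B\<^esub> (FAr F (i X) \<cdot>\<^bsub>B\<^esub> K F X)"
    by (rule B.extend[OF FAr_square[OF F u[symmetric]]]) auto
  then show ?thesis
    by simp
qed

lemma S_arr:
  assumes X: "f \<in> Ar A" "Dm A f = X" "Cd A f = Y" and w: "ends A (i X) (p X) (i Y) (p Y) w f"
  shows "FAr (S F) f \<in> Ar B" "Dm B (FAr (S F) f) = FOb (S F) X" "Cd B (FAr (S F) f) = FOb (S F) Y"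
    "K F Y \<cdot>\<^bsub>B\<^esub> FAr (S F) f = FAr F w \<cdot>\<^bsub>B\<^esub> K F X"
proof -
  have XY [simp]: "X \<in> Ob A" "Y \<in> Ob A"
    using X by auto
  note [simp] = X ends_types(1-3)[OF w] F
  obtain g where g: "g \<in> Ar B" "Dm B g = FOb (S F) X" "Cd B g = FOb (S F) Y"
    "K F Y \<cdot>\<^bsub>B\<^esub> g = FAr F w \<cdot>\<^bsub>B\<^esub> K F X"
    using K_lift[OF XY(1) ses_ip[OF XY(2)] w]
      B.kernel_factor[OF kernel_K[OF XY(2)], of "FAr F w \<cdot>\<^bsub>B\<^esub> K F X"] by auto
  have "FAr (S F) f = (THE g. g \<in> Hom B (FOb (S F) X) (FOb (S F) Y) \<and>
      (\<exists>w. ends A (i X) (p X) (i Y) (p Y) w f \<and> K F Y \<cdot>\<^bsub>B\<^esub> g = FAr F w \<cdot>\<^bsub>B\<^esub> K F X))"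
    unfolding left_sat_ob_def Let_def using X
    by (auto simp: ends_def Hom_def intro!: arg_cong[of _ _ The] ext; metis)
  also have "\<dots> = g"
  proof (rule the_equality)
    show "g \<in> Hom B (FOb (S F) X) (FOb (S F) Y) \<and>
      (\<exists>w. ends A (i X) (p X) (i Y) (p Y) w f \<and> K F Y \<cdot>\<^bsub>B\<^esub> g = FAr F w \<cdot>\<^bsub>B\<^esub> K F X)"
      using g w by (auto simp: Hom_def)
    fix g' assume "g' \<in> Hom B (FOb (S F) X) (FOb (S F) Y) \<and>
      (\<exists>w. ends A (i X) (p X) (i Y) (p Y) w f \<and> K F Y \<cdot>\<^bsub>B\<^esub> g' = FAr F w \<cdot>\<^bsub>B\<^esub> K F X)"
    then obtain w' where w': "ends A (i X) (p X) (i Y) (p Y) w' f"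
      and g': "g' \<in> Ar B" "Dm B g' = FOb (S F) X" "Cd B g' = FOb (S F) Y"
        "K F Y \<cdot>\<^bsub>B\<^esub> g' = FAr F w' \<cdot>\<^bsub>B\<^esub> K F X"
      by (auto simp: Hom_def)
    show "g' = g"
      by (rule B.monic_cancel[OF monic_K[OF XY(2)]])
        (use g g' K_independent[OF XY(1) ses_ip[OF XY(2)] w w'] in auto)
  qed
  finally show "FAr (S F) f \<in> Ar B" "Dm B (FAr (S F) f) = FOb (S F) X" "Cd B (FAr (S F) f) = FOb (S F) Y"
    "K F Y \<cdot>\<^bsub>B\<^esub> FAr (S F) f = FAr F w \<cdot>\<^bsub>B\<^esub> K F X"
    using g by auto
qed

lemma additive_S: "additive_functor A B (S F)"
proof (rule additive_functorI)
  note [simp] = F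
  have lift: "\<exists>w. ends A (i (Dm A f)) (p (Dm A f)) (i (Cd A f)) (p (Cd A f)) w f" if "f \<in> Ar A" for f
    using lift_exists[of "Dm A f" "i (Cd A f)" "p (Cd A f)" f] ses_ip that by auto
  have T [simp]: "FAr (S F) f \<in> Ar B" "Dm B (FAr (S F) f) = FOb (S F) (Dm A f)"
    "Cd B (FAr (S F) f) = FOb (S F) (Cd A f)" if "f \<in> Ar A" for f
    using lift[OF that] S_arr(1-3)[OF that refl refl] by auto
  show "FOb (S F) \<in> Ob A \<rightarrow>\<^sub>E Ob B"
  proof (rule PiE_I)
    show "FOb (S F) X = undefined" if "X \<notin> Ob A" for X
      using that by (simp add: left_sat_ob_def Let_def)
  qed simp
  show "FAr (S F) \<in> extensional (Ar A)"
    by (simp add: left_sat_ob_def Let_def)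
  show "FAr (S F) f \<in> Hom B (FOb (S F) (Dm A f)) (FOb (S F) (Cd A f))" if "f \<in> Ar A" for f
    using that by (simp add: Hom_def)
  show "FAr (S F) (Id A X) = Id B (FOb (S F) X)" if [simp]: "X \<in> Ob A" for X
  proof (rule B.monic_cancel[OF monic_K[OF that]])
    have "ends A (i X) (p X) (i X) (p X) (Id A (Dm A (i X))) (Id A X)"
      using A.ends_Id[OF ses_ip[OF that]] by simp
    from S_arr(4)[OF _ _ _ this] show "K F X \<cdot>\<^bsub>B\<^esub> FAr (S F) (Id A X) = K F X \<cdot>\<^bsub>B\<^esub> Id B (FOb (S F) X)"
      by simp
  qed auto
  show "FAr (S F) (g \<cdot>\<^bsub>A\<^esub> f) = FAr (S F) g \<cdot>\<^bsub>B\<^esub> FAr (S F) f"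
    if [simp]: "f \<in> Ar A" "g \<in> Ar A" "Cd A f = Dm A g" for f g
  proof (rule B.monic_cancel[OF monic_K[of "Cd A g"]])
    obtain w where w: "ends A (i (Dm A f)) (p (Dm A f)) (i (Dm A g)) (p (Dm A g)) w f"
      using lift[of f] by auto
    obtain w' where w': "ends A (i (Dm A g)) (p (Dm A g)) (i (Cd A g)) (p (Cd A g)) w' g"
      using lift[of g] by auto
    note [simp] = ends_types(1-3)[OF w] ends_types(1-3)[OF w']
    have *: "ends A (i (Dm A f)) (p (Dm A f)) (i (Cd A g)) (p (Cd A g)) (w' \<cdot>\<^bsub>A\<^esub> w) (g \<cdot>\<^bsub>A\<^esub> f)"
      by (rule A.ends_Cmp[OF w w']) (simp_all add: ses_ip)
    have "K F (Cd A g) \<cdot>\<^bsub>B\<^esub> (FAr (S F) g \<cdot>\<^bsub>B\<^esub> FAr (S F) f)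
        = FAr F w' \<cdot>\<^bsub>B\<^esub> (K F (Dm A g) \<cdot>\<^bsub>B\<^esub> FAr (S F) f)"
      by (rule B.extend[OF S_arr(4)[OF _ _ _ w']]) auto
    also have "\<dots> = FAr F w' \<cdot>\<^bsub>B\<^esub> (FAr F w \<cdot>\<^bsub>B\<^esub> K F (Dm A f))"
      by (simp add: S_arr(4)[OF _ _ _ w])
    also have "\<dots> = K F (Cd A g) \<cdot>\<^bsub>B\<^esub> FAr (S F) (g \<cdot>\<^bsub>A\<^esub> f)"
      by (simp add: S_arr(4)[OF _ _ _ *])
    finally show "K F (Cd A g) \<cdot>\<^bsub>B\<^esub> FAr (S F) (g \<cdot>\<^bsub>A\<^esub> f)
        = K F (Cd A g) \<cdot>\<^bsub>B\<^esub> (FAr (S F) g \<cdot>\<^bsub>B\<^esub> FAr (S F) f)" ..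
  qed auto
  show "FAr (S F) (Add A f g) = Add B (FAr (S F) f) (FAr (S F) g)"
    if [simp]: "f \<in> Ar A" "g \<in> Ar A" "Dm A f = Dm A g" "Cd A f = Cd A g" for f g
  proof (rule B.monic_cancel[OF monic_K[of "Cd A g"]])
    obtain w where w: "ends A (i (Dm A g)) (p (Dm A g)) (i (Cd A g)) (p (Cd A g)) w f"
      using lift[of f] by auto
    obtain w' where w': "ends A (i (Dm A g)) (p (Dm A g)) (i (Cd A g)) (p (Cd A g)) w' g"
      using lift[of g] by auto
    note [simp] = ends_types(1-3)[OF w] ends_types(1-3)[OF w']
    have *: "ends A (i (Dm A g)) (p (Dm A g)) (i (Cd A g)) (p (Cd A g)) (Add A w w') (Add A f g)"
      by (rule A.ends_Add[OF w w']) (simp_all add: ses_ip)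
    show "K F (Cd A g) \<cdot>\<^bsub>B\<^esub> FAr (S F) (Add A f g)
        = K F (Cd A g) \<cdot>\<^bsub>B\<^esub> Add B (FAr (S F) f) (FAr (S F) g)"
      by (simp add: S_arr(4)[OF _ _ _ w] S_arr(4)[OF _ _ _ w'] S_arr(4)[OF _ _ _ *])
  qed auto
qed

end

text \<open>
  The composite is again induced by lifting \<open>b\<close> to \<open>(a, b)\<close>, so any other lift computes it.
\<close>

lemma connecting_vanishes:
  assumes G [simp]: "additive_functor A B G" and a: "short_exact A a b"
    and s: "ends A (i (Cd A b)) (p (Cd A b)) a b s (Id A (Cd A b))"
  shows "(FAr G s \<cdot>\<^bsub>B\<^esub> K G (Cd A b)) \<cdot>\<^bsub>B\<^esub> FAr (S G) b = Zero B (FOb (S G) (Dm A b)) (FOb G (Dm A a))"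
proof -
  note [simp] = A.ses_types(1-3)[OF a]
  define I Z where IZ: "I = Dm A b" "Z = Cd A b"
  have [simp]: "I \<in> Ob A" "Z \<in> Ob A" "Dm A b = I" "Cd A b = Z"
    by (simp_all add: IZ)
  have s: "ends A (i Z) (p Z) a b s (Id A Z)"
    using s by simp
  note [simp] = ends_types(1-3)[OF s] additive_S[OF G]
  obtain w where w: "ends A (i I) (p I) (i Z) (p Z) w b"
    by (rule lift_exists[of I "i Z" "p Z" b]) (simp_all add: ses_ip)
  note [simp] = ends_types(1-3)[OF w]
  have sw: "ends A (i I) (p I) a b (s \<cdot>\<^bsub>A\<^esub> w) b"
    using A.ends_Cmp[OF w s ses_ip ses_ip a] by simp
  \<comment> \<open>The chosen epimorphism from a projective object onto the middle object \<open>I\<close> of \<open>(a, b)\<close> is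
    itself a lift of \<open>b\<close>, and it restricts to zero on the syzygy.\<close>
  have zero: "ends A (i I) (p I) a b (Zero A (Dm A (i I)) (Dm A a)) b"
    by (rule endsI[where u = "p I"]) auto
  have "(FAr G s \<cdot>\<^bsub>B\<^esub> K G Z) \<cdot>\<^bsub>B\<^esub> FAr (S G) b = FAr G s \<cdot>\<^bsub>B\<^esub> (FAr G w \<cdot>\<^bsub>B\<^esub> K G I)"
    using S_arr[OF G _ _ _ w] by simp
  also have "\<dots> = FAr G (s \<cdot>\<^bsub>A\<^esub> w) \<cdot>\<^bsub>B\<^esub> K G I"
    by simp
  also have "\<dots> = FAr G (Zero A (Dm A (i I)) (Dm A a)) \<cdot>\<^bsub>B\<^esub> K G I"
    by (rule K_independent[OF G _ a sw zero]) simp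
  finally show ?thesis
    by simp
qed

lemma S_map:
  assumes F: "additive_functor A B F" and G: "additive_functor A B G"
    and t: "natural A B F G t" and X: "X \<in> Ob A"
  shows "left_sat_map A B i p F G t X \<in> Ar B"
    "Dm B (left_sat_map A B i p F G t X) = FOb (S F) X"
    "Cd B (left_sat_map A B i p F G t X) = FOb (S G) X"
    "K G X \<cdot>\<^bsub>B\<^esub> left_sat_map A B i p F G t X = t (Dm A (i X)) \<cdot>\<^bsub>B\<^esub> K F X"
proof -
  note [simp] = F G X natural_types[OF t]
  have "FAr G (i X) \<cdot>\<^bsub>B\<^esub> (t (Dm A (i X)) \<cdot>\<^bsub>B\<^esub> K F X)
      = t (Dm A (p X)) \<cdot>\<^bsub>B\<^esub> (FAr F (i X) \<cdot>\<^bsub>B\<^esub> K F X)"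
    by (rule B.extend) (use natural_square[OF t, of "i X"] in auto)
  also have "\<dots> = Zero B (FOb (S F) X) (FOb G (Dm A (p X)))"
    by simp
  finally obtain g where g: "g \<in> Ar B" "Dm B g = FOb (S F) X" "Cd B g = FOb (S G) X"
    "K G X \<cdot>\<^bsub>B\<^esub> g = t (Dm A (i X)) \<cdot>\<^bsub>B\<^esub> K F X"
    using B.kernel_factor[OF kernel_K[OF G X], of "t (Dm A (i X)) \<cdot>\<^bsub>B\<^esub> K F X"] by auto
  have "left_sat_map A B i p F G t X = g"
    unfolding left_sat_map_def
  proof (rule the_equality)
    fix g' assume g': "g' \<in> Hom B (FOb (S F) X) (FOb (S G) X) \<and>
      K G X \<cdot>\<^bsub>B\<^esub> g' = t (Dm A (i X)) \<cdot>\<^bsub>B\<^esub> K F X"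
    show "g' = g"
      by (rule B.monic_cancel[OF monic_K[OF G X]]) (use g g' in \<open>auto simp: Hom_def\<close>)
  qed (use g in \<open>simp add: Hom_def\<close>)
  then show "left_sat_map A B i p F G t X \<in> Ar B"
    "Dm B (left_sat_map A B i p F G t X) = FOb (S F) X"
    "Cd B (left_sat_map A B i p F G t X) = FOb (S G) X"
    "K G X \<cdot>\<^bsub>B\<^esub> left_sat_map A B i p F G t X = t (Dm A (i X)) \<cdot>\<^bsub>B\<^esub> K F X"
    using g by auto
qed

lemma natural_S_map:
  assumes F: "additive_functor A B F" and G: "additive_functor A B G" and t: "natural A B F G t"
  shows "natural A B (S F) (S G) (left_sat_map A B i p F G t)"
  unfolding natural_def
proof (intro conjI ballI)
  note [simp] = F G natural_types[OF t] S_map(1-3)[OF F G t] additive_S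
  show "left_sat_map A B i p F G t X \<in> Hom B (FOb (S F) X) (FOb (S G) X)" if "X \<in> Ob A" for X
    using that by (simp add: Hom_def)
  fix f assume [simp]: "f \<in> Ar A"
  define X Y where XY: "X = Dm A f" "Y = Cd A f"
  have [simp]: "X \<in> Ob A" "Y \<in> Ob A" "Dm A f = X" "Cd A f = Y"
    by (simp_all add: XY)
  let ?s = "left_sat_map A B i p F G t"
  obtain w where w: "ends A (i X) (p X) (i Y) (p Y) w f"
    using lift_exists[of X "i Y" "p Y" f] ses_ip by auto
  note [simp] = ends_types(1-3)[OF w]
  have "?s Y \<cdot>\<^bsub>B\<^esub> FAr (S F) f = FAr (S G) f \<cdot>\<^bsub>B\<^esub> ?s X"
  proof (rule B.monic_cancel[OF monic_K[OF G, of Y]])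
    have "K G Y \<cdot>\<^bsub>B\<^esub> (?s Y \<cdot>\<^bsub>B\<^esub> FAr (S F) f) = t (Dm A (i Y)) \<cdot>\<^bsub>B\<^esub> (K F Y \<cdot>\<^bsub>B\<^esub> FAr (S F) f)"
      by (rule B.extend[OF S_map(4)[OF F G t]]) auto
    also have "\<dots> = t (Dm A (i Y)) \<cdot>\<^bsub>B\<^esub> (FAr F w \<cdot>\<^bsub>B\<^esub> K F X)"
      by (simp add: S_arr(4)[OF F _ _ _ w])
    also have "\<dots> = FAr G w \<cdot>\<^bsub>B\<^esub> (t (Dm A (i X)) \<cdot>\<^bsub>B\<^esub> K F X)"
      by (rule B.extend) (use natural_square[OF t, of w] in auto)
    also have "\<dots> = FAr G w \<cdot>\<^bsub>B\<^esub> (K G X \<cdot>\<^bsub>B\<^esub> ?s X)"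
      by (simp add: S_map(4)[OF F G t])
    also have "\<dots> = K G Y \<cdot>\<^bsub>B\<^esub> (FAr (S G) f \<cdot>\<^bsub>B\<^esub> ?s X)"
      by (rule B.extend[OF S_arr(4)[OF G _ _ _ w, symmetric]]) auto
    finally show "K G Y \<cdot>\<^bsub>B\<^esub> (?s Y \<cdot>\<^bsub>B\<^esub> FAr (S F) f) = K G Y \<cdot>\<^bsub>B\<^esub> (FAr (S G) f \<cdot>\<^bsub>B\<^esub> ?s X)" .
  qed auto
  then show "?s (Cd A f) \<cdot>\<^bsub>B\<^esub> FAr (S F) f = FAr (S G) f \<cdot>\<^bsub>B\<^esub> ?s (Dm A f)"
    by simp
qed

lemma S_map_Id:
  assumes F: "additive_functor A B F" and X: "X \<in> Ob A"
    and t: "natural A B F F t" and tX: "t (Dm A (i X)) = Id B (FOb F (Dm A (i X)))"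
  shows "left_sat_map A B i p F F t X = Id B (FOb (S F) X)"
  by (rule B.monic_cancel[OF monic_K[OF F X]]) (use F X tX S_map[OF F F t X] in auto)

lemma S_map_Cmp:
  assumes F: "additive_functor A B F" and G: "additive_functor A B G" and H: "additive_functor A B H"
    and t: "natural A B F G t" and t': "natural A B G H t'" and t'': "natural A B F H t''"
    and X: "X \<in> Ob A" and tX: "t'' (Dm A (i X)) = t' (Dm A (i X)) \<cdot>\<^bsub>B\<^esub> t (Dm A (i X))"
  shows "left_sat_map A B i p F H t'' X = left_sat_map A B i p G H t' X \<cdot>\<^bsub>B\<^esub> left_sat_map A B i p F G t X"
proof (rule B.monic_cancel[OF monic_K[OF H X]])
  note [simp] = F G H X natural_types[OF t] natural_types[OF t'] S_map(1-3)[OF F G t]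
    S_map(1-3)[OF G H t'] S_map(1-3)[OF F H t'']
  have "K H X \<cdot>\<^bsub>B\<^esub> (left_sat_map A B i p G H t' X \<cdot>\<^bsub>B\<^esub> left_sat_map A B i p F G t X)
      = t' (Dm A (i X)) \<cdot>\<^bsub>B\<^esub> (K G X \<cdot>\<^bsub>B\<^esub> left_sat_map A B i p F G t X)"
    by (rule B.extend[OF S_map(4)[OF G H t']]) auto
  then show "K H X \<cdot>\<^bsub>B\<^esub> left_sat_map A B i p F H t'' X
      = K H X \<cdot>\<^bsub>B\<^esub> (left_sat_map A B i p G H t' X \<cdot>\<^bsub>B\<^esub> left_sat_map A B i p F G t X)"
    by (simp add: S_map(4)[OF F G t] S_map(4)[OF F H t''] tX)
qed (use F G H X S_map(1-3)[OF F G t X] S_map(1-3)[OF G H t' X] S_map(1-3)[OF F H t'' X] in auto)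

end

section \<open>The right satellite by duality\<close>

definition right_sat_map :: "('o, 'a, 'x) ab_cat_scheme \<Rightarrow> ('p, 'b, 'y) ab_cat_scheme
    \<Rightarrow> ('o \<Rightarrow> 'a) \<Rightarrow> ('o \<Rightarrow> 'a) \<Rightarrow> ('o, 'a, 'p, 'b) func \<Rightarrow> ('o, 'a, 'p, 'b) func
    \<Rightarrow> ('o \<Rightarrow> 'b) \<Rightarrow> 'o \<Rightarrow> 'b" where
  "right_sat_map C D j q F G t X =
     (THE g. g \<in> Hom D (FOb (right_sat_ob C D j q F) X) (FOb (right_sat_ob C D j q G) X) \<and>
        g \<cdot>\<^bsub>D\<^esub> coker_map D (FAr F (q X)) = coker_map D (FAr G (q X)) \<cdot>\<^bsub>D\<^esub> t (Cd C (q X)))"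

text \<open>
  The two satellites are literally the same construction, read in a pair of categories or in the
  pair of their opposites. All facts on the right satellite are obtained in this way.
\<close>

lemma left_sat_ob_opp [simp]: "left_sat_ob (opp C) (opp D) q j = right_sat_ob C D j q"
  by (simp add: right_sat_ob_def left_sat_ob_def fun_eq_iff Let_def)

lemma right_sat_ob_opp [simp]: "right_sat_ob (opp C) (opp D) p i = left_sat_ob C D i p"
  by (simp add: right_sat_ob_def left_sat_ob_def fun_eq_iff Let_def)

lemma left_sat_map_opp [simp]:
  "left_sat_map (opp C) (opp D) q j G F t = right_sat_map C D j q F G t"
  by (simp add: right_sat_map_def left_sat_map_def fun_eq_iff)

lemma right_sat_map_opp [simp]:
  "right_sat_map (opp C) (opp D) p i G F t = left_sat_map C D i p F G t"
  by (simp add: right_sat_map_def left_sat_map_def fun_eq_iff)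

locale satellites = projective_presented +
  fixes j q
  assumes injectives: "injective_presentations A j q"
begin

abbreviation T where "T \<equiv> right_sat_ob A B j q"

abbreviation Q where "Q F X \<equiv> coker_map B (FAr F (q X))"

lemma ses_jq: "X \<in> Ob A \<Longrightarrow> short_exact A (j X) (q X)"
  using injectives by (simp add: injective_presentations_def)

lemma dual: "projective_presented (opp A) (opp B) q j"
proof (intro projective_presented.intro projective_presented_axioms.intro abelian_pair_opp)
  show "projective_presentations (opp A) q j"
    using injectives A.short_exact_opp[OF ses_jq]
    by (simp add: projective_presentations_def injective_presentations_def)
qed

lemma satellites_opp: "satellites (opp A) (opp B) q j p i"
proof (intro satellites.intro satellites_axioms.intro dual)
  show "injective_presentations (opp A) p i"
    using presentations A.short_exact_opp[OF ses_ip]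
    by (simp add: projective_presentations_def injective_presentations_def)
qed

lemma jq_types [simp]:
  assumes "X \<in> Ob A"
  shows "j X \<in> Ar A" "q X \<in> Ar A" "Cd A (j X) = Dm A (q X)" "Dm A (j X) = X"
    "q X \<cdot>\<^bsub>A\<^esub> j X = Zero A X (Cd A (q X))"
  using injectives A.ses_types(1-4)[OF ses_jq[OF assms]] assms
  by (auto simp: injective_presentations_def)

lemma extension_exists:
  assumes "X \<in> Ob A" "short_exact A a b" "f \<in> Ar A" "Cd A f = X" "Dm A f = Dm A a"
  obtains w where "ends A a b (j X) (q X) f w"
  using projective_presented.lift_exists[OF dual, of X b a f] assms
    A.ends_opp[OF assms(2) ses_jq[OF assms(1)]] A.short_exact_opp[OF assms(2)] by auto

context
  fixes F assumes F: "additive_functor A B F"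
begin

lemma cokernel_Q: "X \<in> Ob A \<Longrightarrow> is_cokernel B (Q F X) (FAr F (q X))"
  using projective_presented.kernel_K[OF dual additive_functor_opp[OF F]] by simp

lemma epic_Q: "X \<in> Ob A \<Longrightarrow> epic B (Q F X)"
  by (rule B.cokernel_epic, rule cokernel_Q)

lemma Q_types [simp]:
  assumes "X \<in> Ob A"
  shows "Q F X \<in> Ar B" "Cd B (Q F X) = FOb (T F) X" "Dm B (Q F X) = FOb F (Cd A (q X))"
    "Q F X \<cdot>\<^bsub>B\<^esub> FAr F (q X) = Zero B (FOb F (Dm A (q X))) (FOb (T F) X)" "FOb (T F) X \<in> Ob B"
  using projective_presented.K_types[OF dual additive_functor_opp[OF F], of X] assms by auto

lemma T_arr:
  assumes "f \<in> Ar A" "Dm A f = X" "Cd A f = Y" and w: "ends A (j X) (q X) (j Y) (q Y) f w"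
  shows "FAr (T F) f \<in> Ar B" "Dm B (FAr (T F) f) = FOb (T F) X" "Cd B (FAr (T F) f) = FOb (T F) Y"
    "FAr (T F) f \<cdot>\<^bsub>B\<^esub> Q F X = Q F Y \<cdot>\<^bsub>B\<^esub> FAr F w"
proof -
  have XY: "X \<in> Ob A" "Y \<in> Ob A"
    using assms by auto
  have "ends (opp A) (q Y) (j Y) (q X) (j X) w f"
    using w A.ends_opp[OF ses_jq[OF XY(1)] ses_jq[OF XY(2)]] by simp
  from projective_presented.S_arr[OF dual additive_functor_opp[OF F] _ _ _ this]
  show "FAr (T F) f \<in> Ar B" "Dm B (FAr (T F) f) = FOb (T F) X" "Cd B (FAr (T F) f) = FOb (T F) Y"
    "FAr (T F) f \<cdot>\<^bsub>B\<^esub> Q F X = Q F Y \<cdot>\<^bsub>B\<^esub> FAr F w"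
    using assms by auto
qed

lemma additive_T: "additive_functor A B (T F)"
proof -
  note * = projective_presented.additive_S[OF dual additive_functor_opp[OF F]]
  show ?thesis
    by (rule abelian_pair.additive_functorI[OF abelian_pair_axioms])
      (use is_functor.FOb_PiE[OF additive_functor.axioms(3)[OF *]]
        is_functor.FAr_PiE[OF additive_functor.axioms(3)[OF *]]
        abelian_pair.FAr_types[OF abelian_pair_opp *] abelian_pair.FAr_Id'[OF abelian_pair_opp *]
        abelian_pair.FAr_Cmp'[OF abelian_pair_opp *] abelian_pair.FAr_Add'[OF abelian_pair_opp *]
        in \<open>auto simp: Hom_def PiE_def\<close>)
qed

end

context
  fixes F G t
  assumes F: "additive_functor A B F" and G: "additive_functor A B G" and t: "natural A B F G t"
begin

lemma T_map:
  assumes X: "X \<in> Ob A"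
  shows "right_sat_map A B j q F G t X \<in> Ar B"
    "Dm B (right_sat_map A B j q F G t X) = FOb (T F) X"
    "Cd B (right_sat_map A B j q F G t X) = FOb (T G) X"
    "right_sat_map A B j q F G t X \<cdot>\<^bsub>B\<^esub> Q F X = Q G X \<cdot>\<^bsub>B\<^esub> t (Cd A (q X))"
  using projective_presented.S_map[OF dual additive_functor_opp[OF G] additive_functor_opp[OF F], of t X]
    t X by simp_all

lemma natural_T_map: "natural A B (T F) (T G) (right_sat_map A B j q F G t)"
  using projective_presented.natural_S_map[OF dual additive_functor_opp[OF G] additive_functor_opp[OF F], of t]
    t by simp

end

lemma T_map_Id:
  assumes F: "additive_functor A B F" and X: "X \<in> Ob A"
    and t: "natural A B F F t" and tX: "t (Cd A (q X)) = Id B (FOb F (Cd A (q X)))"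
  shows "right_sat_map A B j q F F t X = Id B (FOb (T F) X)"
  using projective_presented.S_map_Id[OF dual additive_functor_opp[OF F], of X t] X t tX by simp

lemma T_map_Cmp:
  assumes F: "additive_functor A B F" and G: "additive_functor A B G" and H: "additive_functor A B H"
    and t: "natural A B F G t" and t': "natural A B G H t'" and t'': "natural A B F H t''"
    and X: "X \<in> Ob A" and tX: "t'' (Cd A (q X)) = t' (Cd A (q X)) \<cdot>\<^bsub>B\<^esub> t (Cd A (q X))"
  shows "right_sat_map A B j q F H t'' X = right_sat_map A B j q G H t' X \<cdot>\<^bsub>B\<^esub> right_sat_map A B j q F G t X"
  using projective_presented.S_map_Cmp[OF dual additive_functor_opp[OF H] additive_functor_opp[OF G]
      additive_functor_opp[OF F], of t' t t'' X] assms by simp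

end

section \<open>The counit and the unit\<close>

text \<open>
  The component at \<open>X\<close> is the factorization of the connecting arrow of \<open>0 \<rightarrow> X \<rightarrow> I \<rightarrow> \<Sigma>X \<rightarrow> 0\<close> through
  the cokernel of \<open>S G(I) \<rightarrow> S G(\<Sigma>X)\<close>.
\<close>

definition sat_counit :: "('o, 'a, 'x) ab_cat_scheme \<Rightarrow> ('p, 'b, 'y) ab_cat_scheme
    \<Rightarrow> ('o \<Rightarrow> 'a) \<Rightarrow> ('o \<Rightarrow> 'a) \<Rightarrow> ('o \<Rightarrow> 'a) \<Rightarrow> ('o \<Rightarrow> 'a) \<Rightarrow> ('o, 'a, 'p, 'b) func \<Rightarrow> 'o \<Rightarrow> 'b" where
  "sat_counit C D i p j q G X =
     (let Z = Cd C (q X); S = left_sat_ob C D i p in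
      THE c. c \<in> Hom D (FOb (right_sat_ob C D j q (S G)) X) (FOb G X) \<and>
        (\<exists>s. ends C (i Z) (p Z) (j X) (q X) s (Id C Z) \<and>
           c \<cdot>\<^bsub>D\<^esub> coker_map D (FAr (S G) (q X)) = FAr G s \<cdot>\<^bsub>D\<^esub> ker_map D (FAr G (i Z))))"

context satellites
begin

lemma connecting_exists:
  assumes "X \<in> Ob A"
  obtains s where "ends A (i (Cd A (q X))) (p (Cd A (q X))) (j X) (q X) s (Id A (Cd A (q X)))"
  using lift_exists[of "Cd A (q X)" "j X" "q X" "Id A (Cd A (q X))"] assms ses_jq by auto

lemma counit:
  assumes G [simp]: "additive_functor A B G" and X [simp]: "X \<in> Ob A"
    and s: "ends A (i (Cd A (q X))) (p (Cd A (q X))) (j X) (q X) s (Id A (Cd A (q X)))"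
  shows "sat_counit A B i p j q G X \<in> Ar B"
    "Dm B (sat_counit A B i p j q G X) = FOb (T (S G)) X"
    "Cd B (sat_counit A B i p j q G X) = FOb G X"
    "sat_counit A B i p j q G X \<cdot>\<^bsub>B\<^esub> Q (S G) X = FAr G s \<cdot>\<^bsub>B\<^esub> K G (Cd A (q X))"
proof -
  define Z where "Z = Cd A (q X)"
  have [simp]: "Z \<in> Ob A" "Cd A (q X) = Z"
    by (simp_all add: Z_def)
  have s: "ends A (i Z) (p Z) (j X) (q X) s (Id A Z)"
    using s by simp
  note [simp] = ends_types(1-3)[OF s] additive_S[OF G]
  have "(FAr G s \<cdot>\<^bsub>B\<^esub> K G Z) \<cdot>\<^bsub>B\<^esub> FAr (S G) (q X) = Zero B (FOb (S G) (Dm A (q X))) (FOb G X)"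
    using connecting_vanishes[OF G ses_jq[OF X], of s] s by simp
  then obtain c where c: "c \<in> Ar B" "Dm B c = FOb (T (S G)) X" "Cd B c = FOb G X"
    "c \<cdot>\<^bsub>B\<^esub> Q (S G) X = FAr G s \<cdot>\<^bsub>B\<^esub> K G Z"
    using B.cokernel_factor[OF cokernel_Q[OF additive_S[OF G] X], of "FAr G s \<cdot>\<^bsub>B\<^esub> K G Z"] by auto
  have "sat_counit A B i p j q G X = c"
    unfolding sat_counit_def Let_def
  proof (rule the_equality)
    fix c' assume "c' \<in> Hom B (FOb (T (S G)) X) (FOb G X) \<and>
      (\<exists>s. ends A (i (Cd A (q X))) (p (Cd A (q X))) (j X) (q X) s (Id A (Cd A (q X))) \<and>
        c' \<cdot>\<^bsub>B\<^esub> Q (S G) X = FAr G s \<cdot>\<^bsub>B\<^esub> K G (Cd A (q X)))"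
    then obtain s' where s': "ends A (i Z) (p Z) (j X) (q X) s' (Id A Z)"
      and c': "c' \<in> Ar B" "Dm B c' = FOb (T (S G)) X" "Cd B c' = FOb G X"
        "c' \<cdot>\<^bsub>B\<^esub> Q (S G) X = FAr G s' \<cdot>\<^bsub>B\<^esub> K G Z"
      by (auto simp: Hom_def)
    show "c' = c"
      by (rule B.epic_cancel[OF epic_Q[OF additive_S[OF G] X]])
        (use c c' K_independent[OF G _ ses_jq[OF X] s s'] in auto)
  qed (use c s in \<open>auto simp: Hom_def\<close>)
  with c show "sat_counit A B i p j q G X \<in> Ar B"
    "Dm B (sat_counit A B i p j q G X) = FOb (T (S G)) X"
    "Cd B (sat_counit A B i p j q G X) = FOb G X"
    "sat_counit A B i p j q G X \<cdot>\<^bsub>B\<^esub> Q (S G) X = FAr G s \<cdot>\<^bsub>B\<^esub> K G (Cd A (q X))"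
    by auto
qed

lemma counit_types [simp]:
  assumes "additive_functor A B G" "X \<in> Ob A"
  shows "sat_counit A B i p j q G X \<in> Ar B"
    "Dm B (sat_counit A B i p j q G X) = FOb (T (S G)) X"
    "Cd B (sat_counit A B i p j q G X) = FOb G X"
  using counit(1-3)[OF assms] connecting_exists[OF assms(2)] by blast+

text \<open>
  Going around the square either way lifts the same arrow \<open>\<Sigma>X \<rightarrow> \<Sigma>Y\<close> to the sequence
  \<open>0 \<rightarrow> Y \<rightarrow> I \<rightarrow> \<Sigma>Y \<rightarrow> 0\<close>.
\<close>

lemma natural_counit:
  assumes G [simp]: "additive_functor A B G"
  shows "natural A B (T (S G)) G (sat_counit A B i p j q G)"
  unfolding natural_def
proof (intro conjI ballI)
  let ?c = "sat_counit A B i p j q G"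
  show "?c X \<in> Hom B (FOb (T (S G)) X) (FOb G X)" if "X \<in> Ob A" for X
    using that by (simp add: Hom_def)
  fix f assume [simp]: "f \<in> Ar A"
  define X Y where XY: "X = Dm A f" "Y = Cd A f"
  define ZX ZY where Z: "ZX = Cd A (q X)" "ZY = Cd A (q Y)"
  have XY' [simp]: "X \<in> Ob A" "Y \<in> Ob A" "Dm A f = X" "Cd A f = Y"
    "ZX \<in> Ob A" "ZY \<in> Ob A" "Cd A (q X) = ZX" "Cd A (q Y) = ZY"
    by (simp_all add: XY Z)
  have SG [simp]: "additive_functor A B (S G)" and TSG [simp]: "additive_functor A B (T (S G))"
    by (simp_all add: additive_S additive_T)
  obtain s where s: "ends A (i ZX) (p ZX) (j X) (q X) s (Id A ZX)"
    using connecting_exists[of X] by auto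
  obtain s' where s': "ends A (i ZY) (p ZY) (j Y) (q Y) s' (Id A ZY)"
    using connecting_exists[of Y] by auto
  obtain w where w: "ends A (j X) (q X) (j Y) (q Y) f w"
    by (rule extension_exists[of Y "j X" "q X" f]) (simp_all add: ses_jq)
  note [simp] = ends_types(1-3)[OF s] ends_types(1-3)[OF s'] ends_types(4-6)[OF w]
  obtain v where v: "ends A (i ZX) (p ZX) (i ZY) (p ZY) v w"
    by (rule lift_exists[of ZX "i ZY" "p ZY" w]) (simp_all add: ses_ip)
  note [simp] = ends_types(1-3)[OF v]
  have *: "ends A (i ZX) (p ZX) (j Y) (q Y) (s' \<cdot>\<^bsub>A\<^esub> v) w" "ends A (i ZX) (p ZX) (j Y) (q Y) (f \<cdot>\<^bsub>A\<^esub> s) w"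
    using A.ends_Cmp[OF v s'] A.ends_Cmp[OF s w] by (simp_all add: ses_ip ses_jq)
  have "?c Y \<cdot>\<^bsub>B\<^esub> FAr (T (S G)) f = FAr G f \<cdot>\<^bsub>B\<^esub> ?c X"
  proof (rule B.epic_cancel[OF epic_Q[OF SG, of X]])
    have "(?c Y \<cdot>\<^bsub>B\<^esub> FAr (T (S G)) f) \<cdot>\<^bsub>B\<^esub> Q (S G) X = ?c Y \<cdot>\<^bsub>B\<^esub> (Q (S G) Y \<cdot>\<^bsub>B\<^esub> FAr (S G) w)"
      by (simp add: T_arr(4)[OF SG _ _ _ w])
    also have "\<dots> = FAr G s' \<cdot>\<^bsub>B\<^esub> (K G ZY \<cdot>\<^bsub>B\<^esub> FAr (S G) w)"
      using counit(4)[OF G, of Y s'] s' by (intro B.extend) auto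
    also have "\<dots> = FAr G (s' \<cdot>\<^bsub>A\<^esub> v) \<cdot>\<^bsub>B\<^esub> K G ZX"
      by (simp add: S_arr(4)[OF G _ _ _ v])
    also have "\<dots> = FAr G (f \<cdot>\<^bsub>A\<^esub> s) \<cdot>\<^bsub>B\<^esub> K G ZX"
      by (rule K_independent[OF G _ ses_jq *]) simp_all
    also have "\<dots> = FAr G f \<cdot>\<^bsub>B\<^esub> (?c X \<cdot>\<^bsub>B\<^esub> Q (S G) X)"
      using counit(4)[OF G, of X s] s by simp
    finally show "(?c Y \<cdot>\<^bsub>B\<^esub> FAr (T (S G)) f) \<cdot>\<^bsub>B\<^esub> Q (S G) X = (FAr G f \<cdot>\<^bsub>B\<^esub> ?c X) \<cdot>\<^bsub>B\<^esub> Q (S G) X"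
      by simp
  qed auto
  then show "?c (Cd A f) \<cdot>\<^bsub>B\<^esub> FAr (T (S G)) f = FAr G f \<cdot>\<^bsub>B\<^esub> ?c (Dm A f)"
    by simp
qed

lemma counit_square:
  assumes G [simp]: "additive_functor A B G" and H [simp]: "additive_functor A B H"
    and t: "natural A B G H t" and X [simp]: "X \<in> Ob A"
    and t': "natural A B (S G) (S H) t'" and t'X: "t' (Cd A (q X)) = left_sat_map A B i p G H t (Cd A (q X))"
  shows "sat_counit A B i p j q H X \<cdot>\<^bsub>B\<^esub> right_sat_map A B j q (S G) (S H) t' X
    = t X \<cdot>\<^bsub>B\<^esub> sat_counit A B i p j q G X"
proof (rule B.epic_cancel[OF epic_Q[OF additive_S[OF G] X]])
  define Z where "Z = Cd A (q X)"
  have [simp]: "Z \<in> Ob A" "Cd A (q X) = Z"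
    by (simp_all add: Z_def)
  obtain s where s: "ends A (i Z) (p Z) (j X) (q X) s (Id A Z)"
    using connecting_exists[of X] by auto
  have SG [simp]: "additive_functor A B (S G)" and SH [simp]: "additive_functor A B (S H)"
    by (simp_all add: additive_S)
  note [simp] = ends_types(1-3)[OF s] natural_types[OF t] T_map(1-3)[OF SG SH t'] S_map(1-3)[OF G H t]
  have "(sat_counit A B i p j q H X \<cdot>\<^bsub>B\<^esub> right_sat_map A B j q (S G) (S H) t' X) \<cdot>\<^bsub>B\<^esub> Q (S G) X
      = sat_counit A B i p j q H X \<cdot>\<^bsub>B\<^esub> (Q (S H) X \<cdot>\<^bsub>B\<^esub> left_sat_map A B i p G H t Z)"
    using T_map(4)[OF SG SH t' X] t'X by simp
  also have "\<dots> = FAr H s \<cdot>\<^bsub>B\<^esub> (K H Z \<cdot>\<^bsub>B\<^esub> left_sat_map A B i p G H t Z)"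
    using counit(4)[OF H X, of s] s by (intro B.extend) auto
  also have "\<dots> = FAr H s \<cdot>\<^bsub>B\<^esub> (t (Dm A (i Z)) \<cdot>\<^bsub>B\<^esub> K G Z)"
    by (simp add: S_map(4)[OF G H t])
  also have "\<dots> = t X \<cdot>\<^bsub>B\<^esub> (FAr G s \<cdot>\<^bsub>B\<^esub> K G Z)"
    using natural_square[OF t, of s] by (intro B.extend) auto
  also have "\<dots> = t X \<cdot>\<^bsub>B\<^esub> (sat_counit A B i p j q G X \<cdot>\<^bsub>B\<^esub> Q (S G) X)"
    using counit(4)[OF G X, of s] s by simp
  finally show "(sat_counit A B i p j q H X \<cdot>\<^bsub>B\<^esub> right_sat_map A B j q (S G) (S H) t' X) \<cdot>\<^bsub>B\<^esub> Q (S G) X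
      = (t X \<cdot>\<^bsub>B\<^esub> sat_counit A B i p j q G X) \<cdot>\<^bsub>B\<^esub> Q (S G) X"
    by simp
qed (use T_map(1-3)[OF additive_S[OF G] additive_S[OF H] t' X] natural_types[OF t X]
      additive_S[OF G] in simp_all)

end

text \<open>
  Passing to the opposite categories exchanges the two satellites, left and right adjoints, and
  hence unit and counit.
\<close>

abbreviation sat_unit :: "('o, 'a, 'x) ab_cat_scheme \<Rightarrow> ('p, 'b, 'y) ab_cat_scheme
    \<Rightarrow> ('o \<Rightarrow> 'a) \<Rightarrow> ('o \<Rightarrow> 'a) \<Rightarrow> ('o \<Rightarrow> 'a) \<Rightarrow> ('o \<Rightarrow> 'a) \<Rightarrow> ('o, 'a, 'p, 'b) func \<Rightarrow> 'o \<Rightarrow> 'b" where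
  "sat_unit C D i p j q \<equiv> sat_counit (opp C) (opp D) q j p i"

lemma (in abelian) ends_unique_right:
  assumes "ends C a b a' b' w f" "ends C a b a' b' w f'" "short_exact C a b" "short_exact C a' b'"
  obtains h where "h \<in> Ar C" "Dm C h = Cd C b" "Cd C h = Dm C b'" "f = Add C f' (b' \<cdot> h)"
proof -
  have "ends (opp C) b' a' b a f w" "ends (opp C) b' a' b a f' w"
    using assms ends_opp[OF assms(3,4)] by auto
  then obtain h where "h \<in> Ar C" "Dm C h = Cd C b" "Cd C h = Cd C a'" "f = Add C f' (b' \<cdot> h)"
    using abelian.ends_unique[OF abelian_opp _ _ short_exact_opp[OF assms(4)] short_exact_opp[OF assms(3)]]
    by (metis opp_simps(2-4,6,7))
  then show thesis
    using that ses_types(3)[OF assms(4)] by simp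
qed

context satellites
begin

lemma unit:
  assumes F [simp]: "additive_functor A B F" and X [simp]: "X \<in> Ob A"
    and v: "ends A (i X) (p X) (j (Dm A (i X))) (q (Dm A (i X))) (Id A (Dm A (i X))) v"
  shows "K (T F) X \<cdot>\<^bsub>B\<^esub> sat_unit A B i p j q F X = Q F (Dm A (i X)) \<cdot>\<^bsub>B\<^esub> FAr F v"
  using satellites.counit(4)[OF satellites_opp additive_functor_opp[OF F], of X v] v
  by (simp add: A.ends_opp[OF ses_ip ses_jq])

lemma natural_unit:
  assumes "additive_functor A B F"
  shows "natural A B F (S (T F)) (sat_unit A B i p j q F)"
  using satellites.natural_counit[OF satellites_opp additive_functor_opp[OF assms]] by simp

lemma unit_square:
  assumes "additive_functor A B G" "additive_functor A B H"
    and "natural A B G H t" "X \<in> Ob A"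
    and "natural A B (T G) (T H) t'" "t' (Dm A (i X)) = right_sat_map A B j q G H t (Dm A (i X))"
  shows "left_sat_map A B i p (T G) (T H) t' X \<cdot>\<^bsub>B\<^esub> sat_unit A B i p j q G X
    = sat_unit A B i p j q H X \<cdot>\<^bsub>B\<^esub> t X"
  using satellites.counit_square[OF satellites_opp additive_functor_opp[OF assms(2)]
      additive_functor_opp[OF assms(1)], of t X t'] assms by simp

text \<open>
  Let \<open>Z = \<Sigma>X\<close> and \<open>W = \<Omega>Z\<close>. The unit at \<open>Z\<close> comes from an extension \<open>v : Z \<rightarrow> \<Sigma>W\<close> of the identity of
  \<open>W\<close>, the counit at \<open>X\<close> from a lift \<open>s : W \<rightarrow> X\<close> of the identity of \<open>Z\<close>; extending \<open>s\<close> further to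
  \<open>r : \<Sigma>W \<rightarrow> Z\<close>, the composite of the two transformations is induced by \<open>r v\<close>. Both \<open>r v\<close> and the
  identity of \<open>Z\<close> are right ends belonging to the left end \<open>s\<close>, so they differ by an arrow that
  factors through \<open>q X\<close>.
\<close>

lemma triangle:
  assumes F [simp]: "additive_functor A B F" and X [simp]: "X \<in> Ob A"
    and e: "natural A B F (S (T F)) e" and eX: "e (Cd A (q X)) = sat_unit A B i p j q F (Cd A (q X))"
  shows "sat_counit A B i p j q (T F) X \<cdot>\<^bsub>B\<^esub> right_sat_map A B j q F (S (T F)) e X = Id B (FOb (T F) X)"
proof (rule B.epic_cancel[OF epic_Q[OF F X]])
  define Z where "Z = Cd A (q X)"
  have [simp]: "Z \<in> Ob A" "Cd A (q X) = Z"
    by (simp_all add: Z_def)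
  define W where "W = Dm A (i Z)"
  have [simp]: "W \<in> Ob A" "Dm A (i Z) = W"
    by (simp_all add: W_def)
  have TF [simp]: "additive_functor A B (T F)" and STF [simp]: "additive_functor A B (S (T F))"
    by (simp_all add: additive_S additive_T)
  obtain s where s: "ends A (i Z) (p Z) (j X) (q X) s (Id A Z)"
    using connecting_exists[of X] by auto
  obtain v where v: "ends A (i Z) (p Z) (j W) (q W) (Id A W) v"
    by (rule extension_exists[of W "i Z" "p Z" "Id A W"]) (simp_all add: ses_ip)
  note [simp] = ends_types(1-3)[OF s] ends_types(4-6)[OF v]
  obtain r where r: "ends A (j W) (q W) (j X) (q X) s r"
    by (rule extension_exists[of X "j W" "q W" s]) (simp_all add: ses_jq)
  note [simp] = ends_types(4-6)[OF r] natural_types[OF e] T_map(1-3)[OF F STF e] T_arr(1-3)[OF TF _ _ _ r]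
  have "ends A (i Z) (p Z) (j X) (q X) s (r \<cdot>\<^bsub>A\<^esub> v)"
    using A.ends_Cmp[OF v r] by (simp add: ses_ip ses_jq)
  then obtain h where [simp]: "h \<in> Ar A" "Dm A h = Z" "Cd A h = Dm A (q X)"
    and rv: "r \<cdot>\<^bsub>A\<^esub> v = Add A (Id A Z) (q X \<cdot>\<^bsub>A\<^esub> h)"
    using A.ends_unique_right[OF _ s] by (auto simp: ses_ip ses_jq)
  have "(sat_counit A B i p j q (T F) X \<cdot>\<^bsub>B\<^esub> right_sat_map A B j q F (S (T F)) e X) \<cdot>\<^bsub>B\<^esub> Q F X
      = sat_counit A B i p j q (T F) X \<cdot>\<^bsub>B\<^esub> (Q (S (T F)) X \<cdot>\<^bsub>B\<^esub> e Z)"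
    using T_map(4)[OF F STF e X] by simp
  also have "\<dots> = FAr (T F) s \<cdot>\<^bsub>B\<^esub> (K (T F) Z \<cdot>\<^bsub>B\<^esub> e Z)"
    using counit(4)[OF TF X, of s] s by (intro B.extend) auto
  also have "K (T F) Z \<cdot>\<^bsub>B\<^esub> e Z = Q F W \<cdot>\<^bsub>B\<^esub> FAr F v"
    using unit[OF F, of Z v] v eX by simp
  also have "FAr (T F) s \<cdot>\<^bsub>B\<^esub> (Q F W \<cdot>\<^bsub>B\<^esub> FAr F v) = Q F X \<cdot>\<^bsub>B\<^esub> (FAr F r \<cdot>\<^bsub>B\<^esub> FAr F v)"
    using T_arr(4)[OF F _ _ _ r] by (intro B.extend) (auto simp: T_arr(1-3)[OF F _ _ _ r])
  also have "FAr F r \<cdot>\<^bsub>B\<^esub> FAr F v = FAr F (Add A (Id A Z) (q X \<cdot>\<^bsub>A\<^esub> h))"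
    unfolding rv[symmetric] by simp
  also have "Q F X \<cdot>\<^bsub>B\<^esub> \<dots> = Add B (Q F X) (Q F X \<cdot>\<^bsub>B\<^esub> (FAr F (q X) \<cdot>\<^bsub>B\<^esub> FAr F h))"
    by simp
  also have "Q F X \<cdot>\<^bsub>B\<^esub> (FAr F (q X) \<cdot>\<^bsub>B\<^esub> FAr F h) = Zero B (FOb F Z) (FOb (T F) X)"
    using B.extend_Zero[of "Q F X" "FAr F (q X)" "FAr F h"] by simp
  finally show "(sat_counit A B i p j q (T F) X \<cdot>\<^bsub>B\<^esub> right_sat_map A B j q F (S (T F)) e X) \<cdot>\<^bsub>B\<^esub> Q F X
      = Id B (FOb (T F) X) \<cdot>\<^bsub>B\<^esub> Q F X"
    by simp
qed (use T_map(1-3)[OF F additive_S[OF additive_T[OF F]] e X] additive_T[OF F] in simp_all)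

lemma triangle_opp:
  assumes "additive_functor A B F" "X \<in> Ob A"
    and "natural A B (T (S F)) F e" "e (Dm A (i X)) = sat_counit A B i p j q F (Dm A (i X))"
  shows "left_sat_map A B i p (T (S F)) F e X \<cdot>\<^bsub>B\<^esub> sat_unit A B i p j q (S F) X = Id B (FOb (S F) X)"
proof -
  \<comment> \<open>The double opposite of a category may differ from it by a record extension, which the counit
    does not see.\<close>
  have "sat_counit (opp (opp A)) (opp (opp B)) i p j q F = sat_counit A B i p j q F"
    by (simp add: sat_counit_def fun_eq_iff Let_def ends_def)
  then show ?thesis
    using satellites.triangle[OF satellites_opp additive_functor_opp[OF assms(1)], of X e] assms by simp
qed

end

section \<open>Connecting sequences of half-exact functors\<close>

text \<open>
  An arrow into the biproduct killed by \<open>(a, g)\<close> has a second component in the kernel of \<open>p\<close>, hence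
  of the form \<open>i z\<close>, and then its first component is forced to be \<open>-s z\<close> because \<open>a\<close> is a
  monomorphism. The sequence is the mapping cone of the morphism \<open>(s, g)\<close> from
  \<open>i\<close> to \<open>a\<close>, regarded as complexes with two terms.
\<close>

lemma (in abelian) rotated_short_exact:
  assumes a: "short_exact C a b" and i: "short_exact C i p"
    and types [simp]: "Cd C b = Y" "Cd C p = Y" "g \<in> Ar C" "Dm C g = Dm C p" "Cd C g = Dm C b"
      "s \<in> Ar C" "Dm C s = Dm C i" "Cd C s = Dm C a"
      "s' \<in> Ar C" "Dm C s' = Dm C i" "Cd C s' = Dm C a"
    and bg: "b \<cdot> g = p" and as: "a \<cdot> s = g \<cdot> i" and ss: "Add C s s' = Zero C (Dm C i) (Dm C a)"
    and S: "is_biproduct C (Dm C a) (Dm C p) S i\<^sub>1 i\<^sub>2 p\<^sub>1 p\<^sub>2"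
  shows "short_exact C (Add C (i\<^sub>1 \<cdot> s') (i\<^sub>2 \<cdot> i)) (Add C (a \<cdot> p\<^sub>1) (g \<cdot> p\<^sub>2))"
proof -
  note [simp] = ses_types(1-4)[OF a] ses_types(1-4)[OF i] biproduct_simps[OF S]
  let ?m = "Add C (i\<^sub>1 \<cdot> s') (i\<^sub>2 \<cdot> i)" and ?n = "Add C (a \<cdot> p\<^sub>1) (g \<cdot> p\<^sub>2)"
  have kernel: "is_kernel C ?m ?n"
  proof (rule is_kernelI)
    show "monic C ?m"
    proof (rule monicI)
      fix y assume [simp]: "y \<in> Ar C" "Cd C y = Dm C ?m" and my: "?m \<cdot> y = Zero C (Dm C y) (Cd C ?m)"
      have "p\<^sub>2 \<cdot> (?m \<cdot> y) = Zero C (Dm C y) (Dm C p)"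
        unfolding my by simp
      then have "i \<cdot> y = Zero C (Dm C y) (Dm C p)"
        by simp
      then show "y = Zero C (Dm C y) (Dm C ?m)"
        using monic_Zero[OF ses_types(7)[OF i], of y] by simp
    qed simp
    have "?n \<cdot> ?m = Add C (a \<cdot> s') (a \<cdot> s)"
      by (simp add: as)
    also have "\<dots> = a \<cdot> Add C s s'"
      by (subst Add_commute) auto
    finally show "?n \<cdot> ?m = Zero C (Dm C ?m) (Cd C ?n)"
      by (simp add: ss)
    fix x assume x [simp]: "x \<in> Ar C" "Cd C x = Dm C ?n" and nx: "?n \<cdot> x = Zero C (Dm C x) (Cd C ?n)"
    have [simp]: "Cd C x = S"
      using x(2) by simp
    have nx': "Add C (a \<cdot> (p\<^sub>1 \<cdot> x)) (g \<cdot> (p\<^sub>2 \<cdot> x)) = Zero C (Dm C x) (Dm C b)"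
      using nx by simp
    have "b \<cdot> Add C (a \<cdot> (p\<^sub>1 \<cdot> x)) (g \<cdot> (p\<^sub>2 \<cdot> x)) = p \<cdot> (p\<^sub>2 \<cdot> x)"
      using extend_Zero[of b a "p\<^sub>1 \<cdot> x"] by (simp add: extend[of b g p "Id C (Dm C p)"] bg)
    then have "p \<cdot> (p\<^sub>2 \<cdot> x) = Zero C (Dm C x) Y"
      unfolding nx' by simp
    then obtain z where z [simp]: "z \<in> Ar C" "Dm C z = Dm C x" "Cd C z = Dm C i" and iz: "i \<cdot> z = p\<^sub>2 \<cdot> x"
      using kernel_factor[OF ses_types(5)[OF i], of "p\<^sub>2 \<cdot> x"] by auto
    have "g \<cdot> (i \<cdot> z) = a \<cdot> (s \<cdot> z)"
      by (rule extend) (simp_all add: as)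
    then have "a \<cdot> Add C (p\<^sub>1 \<cdot> x) (s \<cdot> z) = Zero C (Dm C x) (Dm C b)"
      using nx' by (simp add: iz)
    then have "Add C (p\<^sub>1 \<cdot> x) (s \<cdot> z) = Zero C (Dm C x) (Dm C a)"
      using monic_Zero[OF ses_types(7)[OF a], of "Add C (p\<^sub>1 \<cdot> x) (s \<cdot> z)"] by simp
    moreover have "Add C s s' \<cdot> z = Zero C (Dm C x) (Dm C a)"
      unfolding ss by simp
    ultimately have "Add C (s \<cdot> z) (p\<^sub>1 \<cdot> x) = Add C (s \<cdot> z) (s' \<cdot> z)"
      by (subst Add_commute) auto
    then have p1x: "p\<^sub>1 \<cdot> x = s' \<cdot> z"
      by (rule Add_cancel) auto
    have "Add C (i\<^sub>1 \<cdot> p\<^sub>1) (i\<^sub>2 \<cdot> p\<^sub>2) \<cdot> x = x"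
      by (subst biproduct_sum[OF S]) simp
    then have "?m \<cdot> z = x"
      by (simp add: p1x iz)
    then show "\<exists>u. u \<in> Ar C \<and> Dm C u = Dm C x \<and> Cd C u = Dm C ?m \<and> ?m \<cdot> u = x"
      by (intro exI[of _ z]) simp
  qed auto
  have "epic C ?n"
  proof (rule epicI)
    fix h assume h [simp]: "h \<in> Ar C" "Dm C h = Cd C ?n" and hn: "h \<cdot> ?n = Zero C (Dm C ?n) (Cd C h)"
    have [simp]: "Dm C h = Dm C b"
      using h(2) by simp
    have "h \<cdot> a = (h \<cdot> ?n) \<cdot> i\<^sub>1" and hg: "h \<cdot> g = (h \<cdot> ?n) \<cdot> i\<^sub>2"
      by simp_all
    then have ha: "h \<cdot> a = Zero C (Dm C a) (Cd C h)" and hg: "h \<cdot> g = Zero C (Dm C g) (Cd C h)"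
      unfolding hn by simp_all
    obtain h' where h' [simp]: "h' \<in> Ar C" "Dm C h' = Y" "Cd C h' = Cd C h" and hb: "h' \<cdot> b = h"
      using cokernel_factor[OF ses_types(6)[OF a], of h] ha by auto
    have "h' \<cdot> p = (h' \<cdot> b) \<cdot> g"
      by (simp add: bg)
    also have "\<dots> = Zero C (Dm C p) (Cd C h)"
      unfolding hb hg by simp
    finally have "h' = Zero C Y (Cd C h)"
      using epic_Zero[OF ses_types(8)[OF i], of h'] by simp
    then show "h = Zero C (Cd C ?n) (Cd C h)"
      using hb by simp
  qed simp
  with kernel show ?thesis
    using epic_cokernel_of_kernel by (simp add: short_exact_iff)
qed

context projective_presented
begin

lemma rotation_exists:
  assumes a: "short_exact A a b" and b: "Cd A b = Y" and Y [simp]: "Y \<in> Ob A"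
    and s: "ends A (i Y) (p Y) a b s (Id A Y)"
  obtains m n i\<^sub>1 i\<^sub>2 p\<^sub>1 p\<^sub>2 s' Z where "short_exact A m n"
    "is_biproduct A (Dm A a) (Dm A (p Y)) Z i\<^sub>1 i\<^sub>2 p\<^sub>1 p\<^sub>2"
    "m = Add A (i\<^sub>1 \<cdot>\<^bsub>A\<^esub> s') (i\<^sub>2 \<cdot>\<^bsub>A\<^esub> i Y)" "n \<cdot>\<^bsub>A\<^esub> i\<^sub>1 = a" "p Y \<cdot>\<^bsub>A\<^esub> p\<^sub>2 = b \<cdot>\<^bsub>A\<^esub> n"
    "n \<in> Ar A" "Dm A n = Z" "Cd A n = Dm A b"
    "s' \<in> Ar A" "Dm A s' = Dm A (i Y)" "Cd A s' = Dm A a"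
    "Add A s s' = Zero A (Dm A (i Y)) (Dm A a)"
proof -
  note [simp] = A.ses_types(1-4)[OF a] ends_types(1-3)[OF s] b
  obtain g where [simp]: "g \<in> Ar A" "Dm A g = Dm A (p Y)" "Cd A g = Dm A b"
    and g: "g \<cdot>\<^bsub>A\<^esub> i Y = a \<cdot>\<^bsub>A\<^esub> s" "b \<cdot>\<^bsub>A\<^esub> g = p Y"
    using endsE[OF s] by (auto simp: b)
  obtain s' where s' [simp]: "s' \<in> Ar A" "Dm A s' = Dm A (i Y)" "Cd A s' = Dm A a"
    and ss: "Add A s s' = Zero A (Dm A (i Y)) (Dm A a)"
    by (rule A.negative[of s]) simp_all
  obtain Z i\<^sub>1 i\<^sub>2 p\<^sub>1 p\<^sub>2 where S: "is_biproduct A (Dm A a) (Dm A (p Y)) Z i\<^sub>1 i\<^sub>2 p\<^sub>1 p\<^sub>2"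
    using A.ex_biproduct[of "Dm A a" "Dm A (p Y)"] by auto
  note [simp] = A.biproduct_simps[OF S]
  let ?n = "Add A (a \<cdot>\<^bsub>A\<^esub> p\<^sub>1) (g \<cdot>\<^bsub>A\<^esub> p\<^sub>2)"
  have "b \<cdot>\<^bsub>A\<^esub> (g \<cdot>\<^bsub>A\<^esub> p\<^sub>2) = p Y \<cdot>\<^bsub>A\<^esub> p\<^sub>2"
    unfolding g(2)[symmetric] by simp
  moreover have "b \<cdot>\<^bsub>A\<^esub> (a \<cdot>\<^bsub>A\<^esub> p\<^sub>1) = Zero A Z Y"
    using A.extend_Zero[of b a p\<^sub>1] by simp
  ultimately have "b \<cdot>\<^bsub>A\<^esub> ?n = p Y \<cdot>\<^bsub>A\<^esub> p\<^sub>2"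
    by simp
  then show thesis
    by (intro that[of "Add A (i\<^sub>1 \<cdot>\<^bsub>A\<^esub> s') (i\<^sub>2 \<cdot>\<^bsub>A\<^esub> i Y)" ?n Z i\<^sub>1 i\<^sub>2 p\<^sub>1 p\<^sub>2 s']
        A.rotated_short_exact[OF a ses_ip[OF Y] _ _ _ _ _ _ _ _ _ _ _ g(2) g(1)[symmetric] ss S])
      (use S ss in auto)
qed

text \<open>
  By half-exactness \<open>F(\<Omega>Y) \<rightarrow> F(A') \<oplus> F(P) \<rightarrow> F(E)\<close> is exact, where \<open>(a, b)\<close> is
  \<open>0 \<rightarrow> A' \<rightarrow> E \<rightarrow> Y \<rightarrow> 0\<close>. An element \<open>x\<close> of \<open>F(A')\<close> killed by \<open>F(a)\<close> gives the element \<open>(x, 0)\<close> of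
  the middle term, which comes from an element of \<open>F(\<Omega>Y)\<close> that dies in \<open>F(P)\<close>.
\<close>

lemma connecting_exact:
  assumes F [simp]: "additive_functor A B F" and half: "half_exact A B F"
    and a: "short_exact A a b" and b: "Cd A b = Y" and Y [simp]: "Y \<in> Ob A"
    and s: "ends A (i Y) (p Y) a b s (Id A Y)"
  shows "exact B (FAr F s \<cdot>\<^bsub>B\<^esub> K F Y) (FAr F a)"
proof -
  note [simp] = A.ses_types(1-4)[OF a] ends_types(1-3)[OF s] b
  obtain m n i\<^sub>1 i\<^sub>2 p\<^sub>1 p\<^sub>2 s' Z where mn: "short_exact A m n"
    and S: "is_biproduct A (Dm A a) (Dm A (p Y)) Z i\<^sub>1 i\<^sub>2 p\<^sub>1 p\<^sub>2"
    and m: "m = Add A (i\<^sub>1 \<cdot>\<^bsub>A\<^esub> s') (i\<^sub>2 \<cdot>\<^bsub>A\<^esub> i Y)" and n: "n \<cdot>\<^bsub>A\<^esub> i\<^sub>1 = a"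
    and [simp]: "n \<in> Ar A" "Dm A n = Z" "Cd A n = Dm A b"
      "s' \<in> Ar A" "Dm A s' = Dm A (i Y)" "Cd A s' = Dm A a"
    and ss: "Add A s s' = Zero A (Dm A (i Y)) (Dm A a)"
    by (rule rotation_exists[OF a b Y s])
  note [simp] = A.biproduct_simps[OF S]
  have m' [simp]: "m \<in> Ar A" "Dm A m = Dm A (i Y)" "Cd A m = Z" "p\<^sub>1 \<cdot>\<^bsub>A\<^esub> m = s'" "p\<^sub>2 \<cdot>\<^bsub>A\<^esub> m = i Y"
    by (simp_all add: m)
  have Fmn: "exact B (FAr F m) (FAr F n)"
    using half mn by (simp add: half_exact_def)
  have "FAr F a \<cdot>\<^bsub>B\<^esub> (FAr F s \<cdot>\<^bsub>B\<^esub> K F Y) = Zero B (FOb (S F) Y) (FOb F (Dm A b))"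
    using K_lift[OF F Y a s] by simp
  moreover have "\<exists>t y. epic B t \<and> Cd B t = Dm B x \<and> y \<in> Ar B \<and> Dm B y = Dm B t \<and> Cd B y = FOb (S F) Y
      \<and> (FAr F s \<cdot>\<^bsub>B\<^esub> K F Y) \<cdot>\<^bsub>B\<^esub> y = x \<cdot>\<^bsub>B\<^esub> t"
    if [simp]: "x \<in> Ar B" "Cd B x = FOb F (Dm A a)"
      and ax: "FAr F a \<cdot>\<^bsub>B\<^esub> x = Zero B (Dm B x) (FOb F (Dm A b))" for x
  proof -
    have "FAr F n \<cdot>\<^bsub>B\<^esub> FAr F i\<^sub>1 = FAr F a"
      unfolding n[symmetric] by simp
    then have "FAr F n \<cdot>\<^bsub>B\<^esub> (FAr F i\<^sub>1 \<cdot>\<^bsub>B\<^esub> x) = Zero B (Dm B x) (FOb F (Dm A b))"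
      using B.extend[of "FAr F n" "FAr F i\<^sub>1" "FAr F a" "Id B (FOb F (Dm A a))" x] ax by simp
    then obtain t y where t: "epic B t" and [simp]: "Cd B t = Dm B x" "y \<in> Ar B" "Dm B y = Dm B t"
        "Cd B y = FOb F (Dm A (i Y))" and my: "FAr F m \<cdot>\<^bsub>B\<^esub> y = (FAr F i\<^sub>1 \<cdot>\<^bsub>B\<^esub> x) \<cdot>\<^bsub>B\<^esub> t"
      using Fmn[unfolded B.exact_iff[OF FAr_types(1)[OF F m'(1)] FAr_types(1)[OF F \<open>n \<in> Ar A\<close>], simplified],
          THEN conjunct2, rule_format, of "FAr F i\<^sub>1 \<cdot>\<^bsub>B\<^esub> x"] by auto
    note [simp] = B.epic_Ar[OF t]
    have [simp]: "FAr F p\<^sub>1 \<cdot>\<^bsub>B\<^esub> (FAr F m \<cdot>\<^bsub>B\<^esub> y) = FAr F s' \<cdot>\<^bsub>B\<^esub> y"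
      "FAr F p\<^sub>2 \<cdot>\<^bsub>B\<^esub> (FAr F m \<cdot>\<^bsub>B\<^esub> y) = FAr F (i Y) \<cdot>\<^bsub>B\<^esub> y"
      unfolding m'(4,5)[symmetric] by (simp_all del: m'(4,5))
    have [simp]: "FAr F p\<^sub>1 \<cdot>\<^bsub>B\<^esub> (FAr F i\<^sub>1 \<cdot>\<^bsub>B\<^esub> (x \<cdot>\<^bsub>B\<^esub> t)) = x \<cdot>\<^bsub>B\<^esub> t"
      using B.retract[of "FAr F p\<^sub>1" "FAr F i\<^sub>1" "x \<cdot>\<^bsub>B\<^esub> t"] FAr_Cmp'[OF F, of i\<^sub>1 p\<^sub>1] by simp
    have [simp]: "FAr F p\<^sub>2 \<cdot>\<^bsub>B\<^esub> (FAr F i\<^sub>1 \<cdot>\<^bsub>B\<^esub> (x \<cdot>\<^bsub>B\<^esub> t)) = Zero B (Dm B t) (FOb F (Dm A (p Y)))"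
      using B.extend_Zero[of "FAr F p\<^sub>2" "FAr F i\<^sub>1" "x \<cdot>\<^bsub>B\<^esub> t"] FAr_Cmp'[OF F, of i\<^sub>1 p\<^sub>2] by simp
    have s'y: "FAr F s' \<cdot>\<^bsub>B\<^esub> y = x \<cdot>\<^bsub>B\<^esub> t"
      and iy: "FAr F (i Y) \<cdot>\<^bsub>B\<^esub> y = Zero B (Dm B t) (FOb F (Dm A (p Y)))"
      using arg_cong[OF my, of "\<lambda>z. FAr F p\<^sub>1 \<cdot>\<^bsub>B\<^esub> z"] arg_cong[OF my, of "\<lambda>z. FAr F p\<^sub>2 \<cdot>\<^bsub>B\<^esub> z"] by simp_all
    \<comment> \<open>As \<open>F s\<close> is the negative of \<open>F s'\<close>, the sought preimage of \<open>x t\<close> is the negative of \<open>y\<close>.\<close>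
    obtain y' where [simp]: "y' \<in> Ar B" "Dm B y' = Dm B t" "Cd B y' = FOb F (Dm A (i Y))"
      and yy: "Add B y y' = Zero B (Dm B t) (FOb F (Dm A (i Y)))"
      by (rule B.negative[of y]) simp_all
    have "FAr F (i Y) \<cdot>\<^bsub>B\<^esub> Add B y y' = FAr F (i Y) \<cdot>\<^bsub>B\<^esub> y'"
      by (simp add: iy)
    then have "FAr F (i Y) \<cdot>\<^bsub>B\<^esub> y' = Zero B (Dm B t) (FOb F (Dm A (p Y)))"
      unfolding yy by simp
    then obtain z where [simp]: "z \<in> Ar B" "Dm B z = Dm B t" "Cd B z = FOb (S F) Y" and z: "K F Y \<cdot>\<^bsub>B\<^esub> z = y'"
      using B.kernel_factor[OF kernel_K[OF F Y], of y'] by auto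
    have "Add B (FAr F s \<cdot>\<^bsub>B\<^esub> y) (FAr F s \<cdot>\<^bsub>B\<^esub> y') = FAr F s \<cdot>\<^bsub>B\<^esub> Add B y y'"
      by simp
    also have "\<dots> = FAr F (Add A s s') \<cdot>\<^bsub>B\<^esub> y"
      unfolding yy ss by simp
    also have "\<dots> = Add B (FAr F s \<cdot>\<^bsub>B\<^esub> y) (x \<cdot>\<^bsub>B\<^esub> t)"
      by (simp add: s'y)
    finally have "FAr F s \<cdot>\<^bsub>B\<^esub> y' = x \<cdot>\<^bsub>B\<^esub> t"
      by (rule B.Add_cancel) auto
    then show ?thesis
      using t by (intro exI[of _ t] exI[of _ z]) (simp add: z)
  qed
  ultimately show ?thesis
    by (subst B.exact_iff) auto
qed

text \<open>
  The kernel of the connecting arrow is the kernel of \<open>F(\<Omega>Y) \<rightarrow> F(A') \<oplus> F(P)\<close>, which the previous lemma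
  computes as an image of \<open>S F(E)\<close> when it is applied to the rotated sequence. The projection of the
  rotated sequence to the chosen presentation of \<open>Y\<close> lies over \<open>b\<close>; therefore the connecting arrow of
  the rotated sequence is \<open>S F(b)\<close>.
\<close>

lemma connecting_exact':
  assumes F [simp]: "additive_functor A B F" and half: "half_exact A B F"
    and a: "short_exact A a b" and b: "Cd A b = Y" and Y [simp]: "Y \<in> Ob A"
    and s: "ends A (i Y) (p Y) a b s (Id A Y)"
  shows "exact B (FAr (S F) b) (FAr F s \<cdot>\<^bsub>B\<^esub> K F Y)"
proof -
  define E where "E = Dm A b"
  note [simp] = A.ses_types(1-4)[OF a] ends_types(1-3)[OF s] b
  have [simp]: "E \<in> Ob A" "Dm A b = E"
    by (simp_all add: E_def)
  obtain m n i\<^sub>1 i\<^sub>2 p\<^sub>1 p\<^sub>2 s' Z where mn: "short_exact A m n"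
    and S: "is_biproduct A (Dm A a) (Dm A (p Y)) Z i\<^sub>1 i\<^sub>2 p\<^sub>1 p\<^sub>2"
    and m: "m = Add A (i\<^sub>1 \<cdot>\<^bsub>A\<^esub> s') (i\<^sub>2 \<cdot>\<^bsub>A\<^esub> i Y)" and pp: "p Y \<cdot>\<^bsub>A\<^esub> p\<^sub>2 = b \<cdot>\<^bsub>A\<^esub> n"
    and [simp]: "n \<in> Ar A" "Dm A n = Z" "Cd A n = Dm A b"
      "s' \<in> Ar A" "Dm A s' = Dm A (i Y)" "Cd A s' = Dm A a"
    and ss: "Add A s s' = Zero A (Dm A (i Y)) (Dm A a)"
    by (rule rotation_exists[OF a b Y s])
  note [simp] = A.biproduct_simps[OF S]
  have m' [simp]: "m \<in> Ar A" "Dm A m = Dm A (i Y)" "Cd A m = Z" "p\<^sub>1 \<cdot>\<^bsub>A\<^esub> m = s'" "p\<^sub>2 \<cdot>\<^bsub>A\<^esub> m = i Y"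
    by (simp_all add: m)
  have [simp]: "Z \<in> Ob A"
    using A.Dm_Cd_Ob(2)[OF m'(1)] m'(3) by simp
  obtain w where w: "ends A (i E) (p E) m n w (Id A E)"
    by (rule lift_exists[of E m n "Id A E"]) (simp_all add: mn)
  note [simp] = ends_types(1-3)[OF w]
  obtain u where [simp]: "u \<in> Ar A" "Dm A u = Dm A (p E)" "Cd A u = Z"
    and u: "u \<cdot>\<^bsub>A\<^esub> i E = m \<cdot>\<^bsub>A\<^esub> w" "n \<cdot>\<^bsub>A\<^esub> u = p E"
    using endsE[OF w] by auto
  have wb: "ends A (i E) (p E) (i Y) (p Y) w b"
  proof (rule endsI[where u = "p\<^sub>2 \<cdot>\<^bsub>A\<^esub> u"])
    show "(p\<^sub>2 \<cdot>\<^bsub>A\<^esub> u) \<cdot>\<^bsub>A\<^esub> i E = i Y \<cdot>\<^bsub>A\<^esub> w"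
      using A.extend[of p\<^sub>2 m "i Y" "Id A (Dm A (i Y))" w] by (simp add: u)
    show "p Y \<cdot>\<^bsub>A\<^esub> (p\<^sub>2 \<cdot>\<^bsub>A\<^esub> u) = b \<cdot>\<^bsub>A\<^esub> p E"
      using A.extend[OF pp, of u] by (simp add: u)
  qed auto
  note [simp] = S_arr(1-3)[OF F _ _ _ wb]
  have KS: "K F Y \<cdot>\<^bsub>B\<^esub> FAr (S F) b = FAr F w \<cdot>\<^bsub>B\<^esub> K F E"
    by (rule S_arr(4)[OF F _ _ _ wb]) simp_all
  have ex: "exact B (FAr F w \<cdot>\<^bsub>B\<^esub> K F E) (FAr F m)"
    by (rule connecting_exact[OF F half mn _ _ w]) simp_all
  have ex1: "\<exists>t y. epic B t \<and> Cd B t = Dm B x \<and> y \<in> Ar B \<and> Dm B y = Dm B t \<and> Cd B y = FOb (S F) E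
      \<and> (FAr F w \<cdot>\<^bsub>B\<^esub> K F E) \<cdot>\<^bsub>B\<^esub> y = x \<cdot>\<^bsub>B\<^esub> t"
    if "x \<in> Ar B" "Cd B x = FOb F (Dm A (i Y))" "FAr F m \<cdot>\<^bsub>B\<^esub> x = Zero B (Dm B x) (FOb F Z)" for x
    using ex that by (subst (asm) B.exact_iff) simp_all
  have "(FAr F s \<cdot>\<^bsub>B\<^esub> K F Y) \<cdot>\<^bsub>B\<^esub> FAr (S F) b = Zero B (FOb (S F) E) (FOb F (Dm A a))"
    using connecting_vanishes[OF F a, of s] s by simp
  moreover have "\<exists>t y. epic B t \<and> Cd B t = Dm B x \<and> y \<in> Ar B \<and> Dm B y = Dm B t \<and> Cd B y = FOb (S F) E
      \<and> FAr (S F) b \<cdot>\<^bsub>B\<^esub> y = x \<cdot>\<^bsub>B\<^esub> t"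
    if [simp]: "x \<in> Ar B" "Cd B x = FOb (S F) Y"
      and sx: "(FAr F s \<cdot>\<^bsub>B\<^esub> K F Y) \<cdot>\<^bsub>B\<^esub> x = Zero B (Dm B x) (FOb F (Dm A a))" for x
  proof -
    let ?x = "K F Y \<cdot>\<^bsub>B\<^esub> x"
    have sx': "FAr F s \<cdot>\<^bsub>B\<^esub> ?x = Zero B (Dm B x) (FOb F (Dm A a))"
      using sx by simp
    have "Add B (FAr F s \<cdot>\<^bsub>B\<^esub> ?x) (FAr F s' \<cdot>\<^bsub>B\<^esub> ?x) = FAr F (Add A s s') \<cdot>\<^bsub>B\<^esub> ?x"
      by simp
    then have s'x: "FAr F s' \<cdot>\<^bsub>B\<^esub> ?x = Zero B (Dm B x) (FOb F (Dm A a))"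
      unfolding ss sx' by simp
    have ix: "FAr F (i Y) \<cdot>\<^bsub>B\<^esub> ?x = Zero B (Dm B x) (FOb F (Dm A (p Y)))"
      using B.extend_Zero[of "FAr F (i Y)" "K F Y" x] by simp
    have "FAr F m \<cdot>\<^bsub>B\<^esub> ?x = Zero B (Dm B x) (FOb F Z)"
      unfolding m by (simp add: s'x ix)
    then obtain t y where t: "epic B t" and [simp]: "Cd B t = Dm B x" "y \<in> Ar B" "Dm B y = Dm B t"
        "Cd B y = FOb (S F) E" and wy: "(FAr F w \<cdot>\<^bsub>B\<^esub> K F E) \<cdot>\<^bsub>B\<^esub> y = ?x \<cdot>\<^bsub>B\<^esub> t"
      using ex1[of ?x] by auto
    note [simp] = B.epic_Ar[OF t]
    have "(K F Y \<cdot>\<^bsub>B\<^esub> FAr (S F) b) \<cdot>\<^bsub>B\<^esub> y = ?x \<cdot>\<^bsub>B\<^esub> t"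
      unfolding KS by (rule wy)
    then have "K F Y \<cdot>\<^bsub>B\<^esub> (FAr (S F) b \<cdot>\<^bsub>B\<^esub> y) = K F Y \<cdot>\<^bsub>B\<^esub> (x \<cdot>\<^bsub>B\<^esub> t)"
      by simp
    then have "FAr (S F) b \<cdot>\<^bsub>B\<^esub> y = x \<cdot>\<^bsub>B\<^esub> t"
      by (rule B.monic_cancel[OF monic_K[OF F Y], rotated -1]) simp_all
    then show ?thesis
      using t by (intro exI[of _ t] exI[of _ y]) simp
  qed
  ultimately show ?thesis
    by (subst B.exact_iff) simp_all
qed

end

text \<open>
  The sequence \<open>S F(I) \<rightarrow> S F(\<Sigma>X) \<rightarrow> F(X) \<rightarrow> F(I)\<close> is exact, and the counit is induced by its middle
  arrow on the cokernel of the first.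
\<close>

lemma (in satellites) counit_kernel:
  assumes F [simp]: "additive_functor A B F" and half: "half_exact A B F" and X [simp]: "X \<in> Ob A"
  shows "is_kernel B (sat_counit A B i p j q F X) (FAr F (j X))"
proof -
  obtain s where s: "ends A (i (Cd A (q X))) (p (Cd A (q X))) (j X) (q X) s (Id A (Cd A (q X)))"
    using connecting_exists[OF X] by auto
  note [simp] = ends_types(1-3)[OF s] additive_S[OF F]
  show ?thesis
  proof (rule B.kernel_from_exact[OF connecting_exact'[OF F half ses_jq[OF X] refl _ s]
        connecting_exact[OF F half ses_jq[OF X] refl _ s] cokernel_Q[OF additive_S[OF F] X]])
    show "sat_counit A B i p j q F X \<cdot>\<^bsub>B\<^esub> Q (S F) X = FAr F s \<cdot>\<^bsub>B\<^esub> K F (Cd A (q X))"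
      by (rule counit(4)[OF F X s])
  qed simp_all
qed

section \<open>The category of additive functors\<close>

context category
begin

lemma isomorphism_Cmp:
  assumes "isomorphism_in C f" "isomorphism_in C g" "Cd C f = Dm C g"
  shows "isomorphism_in C (g \<cdot> f)"
proof -
  obtain f' where f': "f' \<in> Ar C" "Dm C f' = Cd C f" "Cd C f' = Dm C f"
      "f' \<cdot> f = Id C (Dm C f)" "f \<cdot> f' = Id C (Cd C f)" and [simp]: "f \<in> Ar C"
    using assms(1) by (auto simp: isomorphism_in_def Hom_def)
  obtain g' where g': "g' \<in> Ar C" "Dm C g' = Cd C g" "Cd C g' = Dm C g"
      "g' \<cdot> g = Id C (Dm C g)" "g \<cdot> g' = Id C (Cd C g)" and [simp]: "g \<in> Ar C"
    using assms(2) by (auto simp: isomorphism_in_def Hom_def)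
  note [simp] = f'(1-3) g'(1-3) assms(3)
  have "(f' \<cdot> g') \<cdot> (g \<cdot> f) = Id C (Dm C f)" "(g \<cdot> f) \<cdot> (f' \<cdot> g') = Id C (Cd C g)"
    using retract[of g' g f] retract[of f f' g'] f'(4,5) g'(4,5) by simp_all
  then show ?thesis
    unfolding isomorphism_in_def by (intro conjI bexI[of _ "f' \<cdot> g'"]) (auto simp: Hom_def)
qed

end

lemma is_functor_comp:
  assumes "is_functor C D F" "is_functor D E G"
  shows "is_functor C E (comp_functor C G F)"
proof -
  interpret F: is_functor C D F by fact
  interpret G: is_functor D E G by fact
  have F [simp]: "FAr F f \<in> Ar D" "Dm D (FAr F f) = FOb F (Dm C f)" "Cd D (FAr F f) = FOb F (Cd C f)"
    if "f \<in> Ar C" for f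
    using F.FAr_Hom[of f "Dm C f" "Cd C f"] that by (auto simp: Hom_def)
  show ?thesis
  proof (intro is_functor.intro is_functor_axioms.intro F.source.category_axioms G.target.category_axioms)
    fix f X Y assume f: "f \<in> Hom C X Y"
    then show "FAr (comp_functor C G F) f
        \<in> Hom E (FOb (comp_functor C G F) X) (FOb (comp_functor C G F) Y)"
      using G.FAr_Hom[OF F.FAr_Hom[OF f]] by (auto simp: comp_functor_def Hom_def)
    fix g Z assume "g \<in> Hom C Y Z"
    then show "FAr (comp_functor C G F) (g \<cdot>\<^bsub>C\<^esub> f)
        = FAr (comp_functor C G F) g \<cdot>\<^bsub>E\<^esub> FAr (comp_functor C G F) f"
      using f F.FAr_Cmp[of f X Y g Z] G.FAr_Cmp[of "FAr F f" "FOb F X" "FOb F Y" "FAr F g" "FOb F Z"]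
      by (auto simp: comp_functor_def Hom_def)
  qed (use F.FOb_PiE F.FAr_PiE G.FOb_PiE G.FAr_PiE F.FAr_Id G.FAr_Id in
      \<open>auto simp: comp_functor_def PiE_iff extensional_def\<close>)
qed

lemma is_functor_id: "category C \<Longrightarrow> is_functor C C (id_functor C)"
  by (intro is_functor.intro is_functor_axioms.intro)
    (auto simp: id_functor_def Hom_def category.Dm_in_Ob category.Cd_in_Ob category.Id_types category.Cmp_types)

context abelian_pair
begin

abbreviation \<F> where "\<F> \<equiv> functor_cat A B"

lemma Ob_functor_cat [simp]: "F \<in> Ob \<F> \<longleftrightarrow> additive_functor A B F"
  by (simp add: functor_cat_def)

lemma functor_cat_simps [simp]:
  "Dm \<F> \<tau> = NSrc \<tau>" "Cd \<F> \<tau> = NTgt \<tau>"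
  "NSrc (\<sigma> \<cdot>\<^bsub>\<F>\<^esub> \<tau>) = NSrc \<tau>" "NTgt (\<sigma> \<cdot>\<^bsub>\<F>\<^esub> \<tau>) = NTgt \<sigma>"
  "X \<in> Ob A \<Longrightarrow> NMap (\<sigma> \<cdot>\<^bsub>\<F>\<^esub> \<tau>) X = NMap \<sigma> X \<cdot>\<^bsub>B\<^esub> NMap \<tau> X"
  "X \<in> Ob A \<Longrightarrow> NMap (Id \<F> F) X = Id B (FOb F X)"
  "NSrc (Id \<F> F) = F" "NTgt (Id \<F> F) = F"
  by (simp_all add: functor_cat_def)

lemma Hom_functor_cat:
  "\<tau> \<in> Hom \<F> F G \<longleftrightarrow> additive_functor A B F \<and> additive_functor A B G \<and> NSrc \<tau> = F \<and> NTgt \<tau> = G \<and>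
     NMap \<tau> \<in> extensional (Ob A) \<and> natural A B F G (NMap \<tau>)"
proof -
  have "nat_trans A B \<tau> \<longleftrightarrow> is_functor A B (NSrc \<tau>) \<and> is_functor A B (NTgt \<tau>) \<and>
     NMap \<tau> \<in> extensional (Ob A) \<and> natural A B (NSrc \<tau>) (NTgt \<tau>) (NMap \<tau>)"
    by (auto simp: nat_trans_def nat_trans_axioms_def natural_def Hom_def)
  then show ?thesis
    using additive_functor.axioms(3) by (auto simp: Hom_def functor_cat_def)
qed

lemma Ar_functor_cat: "\<tau> \<in> Ar \<F> \<longleftrightarrow> \<tau> \<in> Hom \<F> (NSrc \<tau>) (NTgt \<tau>)"
  by (simp add: Hom_def)

lemma natural_restrict [simp]: "natural A B F G (restrict t (Ob A)) \<longleftrightarrow> natural A B F G t"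
  by (auto simp: natural_def)

lemma Hom_functor_catI:
  assumes "additive_functor A B F" "additive_functor A B G" "natural A B F G t"
  shows "\<lparr>NSrc = F, NTgt = G, NMap = restrict t (Ob A)\<rparr> \<in> Hom \<F> F G"
  using assms by (simp add: Hom_functor_cat)

lemma ntrans_eqI:
  assumes "\<sigma> \<in> Hom \<F> F G" "\<tau> \<in> Hom \<F> F G" "\<And>X. X \<in> Ob A \<Longrightarrow> NMap \<sigma> X = NMap \<tau> X"
  shows "\<sigma> = \<tau>"
proof -
  have "NMap \<sigma> = NMap \<tau>"
    using assms by (intro extensionalityI[of _ "Ob A"]) (auto simp: Hom_functor_cat)
  then show ?thesis
    using assms(1,2) by (cases \<sigma>; cases \<tau>) (simp add: Hom_functor_cat)
qed

lemma natural_Id: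
  assumes "additive_functor A B F"
  shows "natural A B F F (\<lambda>X. Id B (FOb F X))"
  using assms by (simp add: natural_def Hom_def)

lemma natural_Cmp:
  assumes F: "additive_functor A B F" and G: "additive_functor A B G" and H: "additive_functor A B H"
    and t: "natural A B F G t" and t': "natural A B G H t'"
  shows "natural A B F H (\<lambda>X. t' X \<cdot>\<^bsub>B\<^esub> t X)"
  unfolding natural_def
proof (intro conjI ballI)
  note [simp] = F G H natural_types[OF t] natural_types[OF t']
  show "t' X \<cdot>\<^bsub>B\<^esub> t X \<in> Hom B (FOb F X) (FOb H X)" if "X \<in> Ob A" for X
    using that by (simp add: Hom_def)
  fix f assume [simp]: "f \<in> Ar A"
  have "(t' (Cd A f) \<cdot>\<^bsub>B\<^esub> t (Cd A f)) \<cdot>\<^bsub>B\<^esub> FAr F f = t' (Cd A f) \<cdot>\<^bsub>B\<^esub> (FAr G f \<cdot>\<^bsub>B\<^esub> t (Dm A f))"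
    using natural_square[OF t, of f] by simp
  also have "\<dots> = FAr H f \<cdot>\<^bsub>B\<^esub> (t' (Dm A f) \<cdot>\<^bsub>B\<^esub> t (Dm A f))"
    by (rule B.extend[OF natural_square[OF t']]) auto
  finally show "(t' (Cd A f) \<cdot>\<^bsub>B\<^esub> t (Cd A f)) \<cdot>\<^bsub>B\<^esub> FAr F f
      = FAr H f \<cdot>\<^bsub>B\<^esub> (t' (Dm A f) \<cdot>\<^bsub>B\<^esub> t (Dm A f))" .
qed

lemma Id_functor_cat: "Id \<F> F = \<lparr>NSrc = F, NTgt = F, NMap = restrict (\<lambda>X. Id B (FOb F X)) (Ob A)\<rparr>"
  by (simp add: functor_cat_def)

lemma Cmp_functor_cat: "\<sigma> \<cdot>\<^bsub>\<F>\<^esub> \<tau> =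
    \<lparr>NSrc = NSrc \<tau>, NTgt = NTgt \<sigma>, NMap = restrict (\<lambda>X. NMap \<sigma> X \<cdot>\<^bsub>B\<^esub> NMap \<tau> X) (Ob A)\<rparr>"
  by (simp add: functor_cat_def)

lemma category_functor_cat: "category \<F>"
proof
  show "Dm \<F> \<tau> \<in> Ob \<F>" "Cd \<F> \<tau> \<in> Ob \<F>" if "\<tau> \<in> Ar \<F>" for \<tau>
    using that by (simp_all add: functor_cat_def)
  show Id: "Id \<F> F \<in> Hom \<F> F F" if "F \<in> Ob \<F>" for F
    unfolding Id_functor_cat using that by (intro Hom_functor_catI natural_Id) auto
  show Cmp: "\<tau> \<cdot>\<^bsub>\<F>\<^esub> \<sigma> \<in> Hom \<F> F H" if "\<sigma> \<in> Hom \<F> F G" "\<tau> \<in> Hom \<F> G H" for \<sigma> \<tau> F G H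
    unfolding Cmp_functor_cat using that natural_Cmp[of F G H "NMap \<sigma>" "NMap \<tau>"]
    by (simp add: Hom_functor_cat)
  show "\<sigma> \<cdot>\<^bsub>\<F>\<^esub> Id \<F> F = \<sigma>" if \<sigma>: "\<sigma> \<in> Hom \<F> F G" for \<sigma> F G
  proof (rule ntrans_eqI)
    show "\<sigma> \<cdot>\<^bsub>\<F>\<^esub> Id \<F> F \<in> Hom \<F> F G"
      using \<sigma> by (intro Cmp[OF Id]) (auto simp: Hom_functor_cat)
  qed (use \<sigma> in \<open>auto simp: Hom_functor_cat natural_types\<close>)
  show "Id \<F> G \<cdot>\<^bsub>\<F>\<^esub> \<sigma> = \<sigma>" if \<sigma>: "\<sigma> \<in> Hom \<F> F G" for \<sigma> F G
  proof (rule ntrans_eqI)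
    show "Id \<F> G \<cdot>\<^bsub>\<F>\<^esub> \<sigma> \<in> Hom \<F> F G"
      using \<sigma> by (intro Cmp[OF _ Id]) (auto simp: Hom_functor_cat)
  qed (use \<sigma> in \<open>auto simp: Hom_functor_cat natural_types\<close>)
  show "(\<upsilon> \<cdot>\<^bsub>\<F>\<^esub> \<tau>) \<cdot>\<^bsub>\<F>\<^esub> \<sigma> = \<upsilon> \<cdot>\<^bsub>\<F>\<^esub> (\<tau> \<cdot>\<^bsub>\<F>\<^esub> \<sigma>)"
    if *: "\<sigma> \<in> Hom \<F> F G" "\<tau> \<in> Hom \<F> G H" "\<upsilon> \<in> Hom \<F> H K" for \<sigma> \<tau> \<upsilon> F G H K
    by (rule ntrans_eqI[OF Cmp[OF *(1) Cmp[OF *(2,3)]] Cmp[OF Cmp[OF *(1,2)] *(3)]])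
      (use * in \<open>auto simp: Hom_functor_cat natural_types\<close>)
qed

text \<open>
  Inverses of the components of a natural family are automatically natural.
\<close>

lemma isomorphism_functor_cat:
  assumes F: "additive_functor A B F" and G: "additive_functor A B G" and t: "natural A B F G t"
    and v: "\<And>X. X \<in> Ob A \<Longrightarrow> v X \<in> Hom B (FOb G X) (FOb F X) \<and>
      v X \<cdot>\<^bsub>B\<^esub> t X = Id B (FOb F X) \<and> t X \<cdot>\<^bsub>B\<^esub> v X = Id B (FOb G X)"
  shows "isomorphism_in \<F> \<lparr>NSrc = F, NTgt = G, NMap = restrict t (Ob A)\<rparr>" (is "isomorphism_in \<F> ?t")
proof -
  note [simp] = F G natural_types[OF t]
  have v' [simp]: "v X \<in> Ar B" "Dm B (v X) = FOb G X" "Cd B (v X) = FOb F X"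
    "v X \<cdot>\<^bsub>B\<^esub> t X = Id B (FOb F X)" "t X \<cdot>\<^bsub>B\<^esub> v X = Id B (FOb G X)" if "X \<in> Ob A" for X
    using v[OF that] by (auto simp: Hom_def)
  have "natural A B G F v"
    unfolding natural_def
  proof (intro conjI ballI)
    fix f assume [simp]: "f \<in> Ar A"
    have "t (Cd A f) \<cdot>\<^bsub>B\<^esub> (FAr F f \<cdot>\<^bsub>B\<^esub> v (Dm A f)) = FAr G f \<cdot>\<^bsub>B\<^esub> (t (Dm A f) \<cdot>\<^bsub>B\<^esub> v (Dm A f))"
      by (rule B.extend[OF natural_square[OF t]]) auto
    then have "v (Cd A f) \<cdot>\<^bsub>B\<^esub> (t (Cd A f) \<cdot>\<^bsub>B\<^esub> (FAr F f \<cdot>\<^bsub>B\<^esub> v (Dm A f))) = v (Cd A f) \<cdot>\<^bsub>B\<^esub> FAr G f"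
      by simp
    then show "v (Cd A f) \<cdot>\<^bsub>B\<^esub> FAr G f = FAr F f \<cdot>\<^bsub>B\<^esub> v (Dm A f)"
      using B.retract[of "v (Cd A f)" "t (Cd A f)" "FAr F f \<cdot>\<^bsub>B\<^esub> v (Dm A f)"] by simp
  qed (use v in auto)
  then have v'': "\<lparr>NSrc = G, NTgt = F, NMap = restrict v (Ob A)\<rparr> \<in> Hom \<F> G F" (is "?v \<in> _")
    by (intro Hom_functor_catI) simp_all
  have t': "?t \<in> Hom \<F> F G"
    using t by (intro Hom_functor_catI) simp_all
  interpret \<F>: category \<F>
    by (rule category_functor_cat)
  have "?v \<cdot>\<^bsub>\<F>\<^esub> ?t = Id \<F> F"
    by (rule ntrans_eqI[OF \<F>.Cmp_in_Hom[OF t' v''] \<F>.Id_in_Hom]) simp_all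
  moreover have "?t \<cdot>\<^bsub>\<F>\<^esub> ?v = Id \<F> G"
    by (rule ntrans_eqI[OF \<F>.Cmp_in_Hom[OF v'' t'] \<F>.Id_in_Hom]) simp_all
  ultimately show ?thesis
    unfolding isomorphism_in_def using t' v'' by (intro conjI bexI[of _ ?v]) (auto simp: Hom_def)
qed

text \<open>
  Both satellites act on a natural transformation through its components only. It remains to check
  the functor laws componentwise.
\<close>

lemma endofunctorI:
  assumes add: "\<And>F. additive_functor A B F \<Longrightarrow> additive_functor A B (P F)"
    and nat: "\<And>F G t. additive_functor A B F \<Longrightarrow> additive_functor A B G \<Longrightarrow> natural A B F G t
      \<Longrightarrow> natural A B (P F) (P G) (m F G t)"
    and Id: "\<And>F t X. additive_functor A B F \<Longrightarrow> X \<in> Ob A \<Longrightarrow> natural A B F F t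
      \<Longrightarrow> (\<And>Y. Y \<in> Ob A \<Longrightarrow> t Y = Id B (FOb F Y)) \<Longrightarrow> m F F t X = Id B (FOb (P F) X)"
    and Cmp: "\<And>F G H t t' t'' X. additive_functor A B F \<Longrightarrow> additive_functor A B G
      \<Longrightarrow> additive_functor A B H \<Longrightarrow> natural A B F G t \<Longrightarrow> natural A B G H t' \<Longrightarrow> natural A B F H t''
      \<Longrightarrow> X \<in> Ob A \<Longrightarrow> (\<And>Y. Y \<in> Ob A \<Longrightarrow> t'' Y = t' Y \<cdot>\<^bsub>B\<^esub> t Y)
      \<Longrightarrow> m F H t'' X = m G H t' X \<cdot>\<^bsub>B\<^esub> m F G t X"
  shows "is_functor \<F> \<F>
    \<lparr>FOb = (\<lambda>F \<in> Ob \<F>. P F),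
     FAr = (\<lambda>\<tau> \<in> Ar \<F>. \<lparr>NSrc = P (NSrc \<tau>), NTgt = P (NTgt \<tau>),
                        NMap = (\<lambda>X \<in> Ob A. m (NSrc \<tau>) (NTgt \<tau>) (NMap \<tau>) X)\<rparr>)\<rparr>"
    (is "is_functor _ _ ?P")
proof -
  interpret \<F>: category \<F>
    by (rule category_functor_cat)
  have arr: "FAr ?P \<tau> = \<lparr>NSrc = P F, NTgt = P G, NMap = restrict (m F G (NMap \<tau>)) (Ob A)\<rparr>"
    if "\<tau> \<in> Hom \<F> F G" for \<tau> F G
    using that by (auto simp: Hom_def restrict_def)
  have Hom: "FAr ?P \<tau> \<in> Hom \<F> (P F) (P G)" if "\<tau> \<in> Hom \<F> F G" for \<tau> F G
    unfolding arr[OF that] using that by (intro Hom_functor_catI add nat) (auto simp: Hom_functor_cat)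
  show ?thesis
  proof (intro is_functor.intro is_functor_axioms.intro category_functor_cat)
    show "FOb ?P \<in> Ob \<F> \<rightarrow>\<^sub>E Ob \<F>"
      by (auto simp: add)
    show "FAr ?P \<in> Ar \<F> \<rightarrow>\<^sub>E Ar \<F>"
    proof (rule PiE_I)
      show "FAr ?P \<tau> \<in> Ar \<F>" if "\<tau> \<in> Ar \<F>" for \<tau>
        using Hom[of \<tau>] that unfolding Ar_functor_cat[of \<tau>] by (simp add: Hom_def)
    qed simp
    show "FAr ?P \<tau> \<in> Hom \<F> (FOb ?P F) (FOb ?P G)" if "\<tau> \<in> Hom \<F> F G" for \<tau> F G
      using Hom[OF that] that by (simp add: Hom_functor_cat)
    show "FAr ?P (Id \<F> F) = Id \<F> (FOb ?P F)" if F: "F \<in> Ob \<F>" for F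
    proof -
      have F': "additive_functor A B F"
        using F by simp
      have I: "Id \<F> F \<in> Hom \<F> F F"
        by (rule \<F>.Id_in_Hom[OF F])
      have "FAr ?P (Id \<F> F) = Id \<F> (P F)"
      proof (rule ntrans_eqI[OF Hom[OF I] \<F>.Id_in_Hom])
        fix X assume X: "X \<in> Ob A"
        show "NMap (FAr ?P (Id \<F> F)) X = NMap (Id \<F> (P F)) X"
          unfolding arr[OF I] using X I by (simp add: Hom_functor_cat Id)
      qed (simp add: add F')
      then show ?thesis
        using F by simp
    qed
    show "FAr ?P (\<tau> \<cdot>\<^bsub>\<F>\<^esub> \<sigma>) = FAr ?P \<tau> \<cdot>\<^bsub>\<F>\<^esub> FAr ?P \<sigma>"
      if \<sigma>: "\<sigma> \<in> Hom \<F> F G" and \<tau>: "\<tau> \<in> Hom \<F> G H" for \<sigma> \<tau> F G H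
    proof (rule ntrans_eqI[OF Hom[OF \<F>.Cmp_in_Hom[OF \<sigma> \<tau>]] \<F>.Cmp_in_Hom[OF Hom[OF \<sigma>] Hom[OF \<tau>]]])
      fix X assume X: "X \<in> Ob A"
      have "m F H (NMap (\<tau> \<cdot>\<^bsub>\<F>\<^esub> \<sigma>)) X = m G H (NMap \<tau>) X \<cdot>\<^bsub>B\<^esub> m F G (NMap \<sigma>) X"
        using \<sigma> \<tau> \<F>.Cmp_in_Hom[OF \<sigma> \<tau>] X by (intro Cmp) (auto simp: Hom_functor_cat)
      then show "NMap (FAr ?P (\<tau> \<cdot>\<^bsub>\<F>\<^esub> \<sigma>)) X = NMap (FAr ?P \<tau> \<cdot>\<^bsub>\<F>\<^esub> FAr ?P \<sigma>) X"
        unfolding arr[OF \<F>.Cmp_in_Hom[OF \<sigma> \<tau>]] arr[OF \<sigma>] arr[OF \<tau>] using X by simp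
    qed
  qed
qed

end

section \<open>The adjunction of the satellites\<close>

context satellites
begin

abbreviation S\<^sub>l where "S\<^sub>l \<equiv> left_satellite A B i p"

abbreviation S\<^sub>r where "S\<^sub>r \<equiv> right_satellite A B j q"

lemma left_satellite_eq: "S\<^sub>l = \<lparr>FOb = (\<lambda>F \<in> Ob \<F>. S F),
    FAr = (\<lambda>\<tau> \<in> Ar \<F>. \<lparr>NSrc = S (NSrc \<tau>), NTgt = S (NTgt \<tau>),
      NMap = (\<lambda>X \<in> Ob A. left_sat_map A B i p (NSrc \<tau>) (NTgt \<tau>) (NMap \<tau>) X)\<rparr>)\<rparr>"
  by (simp add: left_satellite_def Let_def left_sat_map_def)

lemma right_satellite_eq: "S\<^sub>r = \<lparr>FOb = (\<lambda>F \<in> Ob \<F>. T F),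
    FAr = (\<lambda>\<tau> \<in> Ar \<F>. \<lparr>NSrc = T (NSrc \<tau>), NTgt = T (NTgt \<tau>),
      NMap = (\<lambda>X \<in> Ob A. right_sat_map A B j q (NSrc \<tau>) (NTgt \<tau>) (NMap \<tau>) X)\<rparr>)\<rparr>"
  by (simp add: right_satellite_def Let_def right_sat_map_def)

lemma functor_left_satellite: "is_functor \<F> \<F> S\<^sub>l"
  unfolding left_satellite_eq
  by (rule endofunctorI) (auto intro: additive_S natural_S_map S_map_Id S_map_Cmp)

lemma functor_right_satellite: "is_functor \<F> \<F> S\<^sub>r"
  unfolding right_satellite_eq
  by (rule endofunctorI) (auto intro: additive_T natural_T_map T_map_Id T_map_Cmp)

lemma FOb_satellites [simp]:
  assumes "additive_functor A B F"
  shows "FOb S\<^sub>l F = S F" "FOb S\<^sub>r F = T F"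
  using assms by (simp_all add: left_satellite_eq right_satellite_eq)

lemma FAr_satellites:
  assumes "\<tau> \<in> Hom \<F> F G"
  shows "FAr S\<^sub>l \<tau> = \<lparr>NSrc = S F, NTgt = S G, NMap = restrict (left_sat_map A B i p F G (NMap \<tau>)) (Ob A)\<rparr>"
    "FAr S\<^sub>r \<tau> = \<lparr>NSrc = T F, NTgt = T G, NMap = restrict (right_sat_map A B j q F G (NMap \<tau>)) (Ob A)\<rparr>"
  using assms by (auto simp: left_satellite_eq right_satellite_eq Hom_def restrict_def)

definition counit_at where
  "counit_at G = \<lparr>NSrc = T (S G), NTgt = G, NMap = restrict (sat_counit A B i p j q G) (Ob A)\<rparr>"

definition unit_at where
  "unit_at F = \<lparr>NSrc = F, NTgt = S (T F), NMap = restrict (sat_unit A B i p j q F) (Ob A)\<rparr>"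

definition counit_trans where
  "counit_trans = \<lparr>NSrc = comp_functor \<F> S\<^sub>r S\<^sub>l, NTgt = id_functor \<F>, NMap = restrict counit_at (Ob \<F>)\<rparr>"

definition unit_trans where
  "unit_trans = \<lparr>NSrc = id_functor \<F>, NTgt = comp_functor \<F> S\<^sub>l S\<^sub>r, NMap = restrict unit_at (Ob \<F>)\<rparr>"

lemma counit_at_Hom: "additive_functor A B G \<Longrightarrow> counit_at G \<in> Hom \<F> (T (S G)) G"
  unfolding counit_at_def by (intro Hom_functor_catI natural_counit additive_T additive_S)

lemma unit_at_Hom: "additive_functor A B F \<Longrightarrow> unit_at F \<in> Hom \<F> F (S (T F))"
  unfolding unit_at_def by (intro Hom_functor_catI natural_unit additive_T additive_S)

lemma satellite_adjunction: "adjunction \<F> \<F> S\<^sub>r S\<^sub>l unit_trans counit_trans"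
proof -
  interpret \<F>: category \<F>
    by (rule category_functor_cat)
  interpret l: is_functor \<F> \<F> S\<^sub>l
    by (rule functor_left_satellite)
  interpret r: is_functor \<F> \<F> S\<^sub>r
    by (rule functor_right_satellite)
  have l: "FAr S\<^sub>l \<tau> \<in> Hom \<F> (S F) (S G)" and r: "FAr S\<^sub>r \<tau> \<in> Hom \<F> (T F) (T G)"
    if "\<tau> \<in> Hom \<F> F G" for F G \<tau>
    using l.FAr_Hom[OF that] r.FAr_Hom[OF that] that by (simp_all add: Hom_functor_cat)
  have "nat_trans \<F> \<F> counit_trans"
  proof (intro nat_trans.intro nat_trans_axioms.intro)
    show "NMap counit_trans Y \<cdot>\<^bsub>\<F>\<^esub> FAr (NSrc counit_trans) \<tau> = FAr (NTgt counit_trans) \<tau> \<cdot>\<^bsub>\<F>\<^esub> NMap counit_trans X"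
      if \<tau>: "\<tau> \<in> Hom \<F> X Y" for \<tau> X Y
    proof -
      have X: "additive_functor A B X" and Y: "additive_functor A B Y" and t: "natural A B X Y (NMap \<tau>)"
        and \<tau>': "\<tau> \<in> Ar \<F>"
        using \<tau> by (auto simp: Hom_functor_cat Ar_functor_cat)
      have "counit_at Y \<cdot>\<^bsub>\<F>\<^esub> FAr S\<^sub>r (FAr S\<^sub>l \<tau>) = \<tau> \<cdot>\<^bsub>\<F>\<^esub> counit_at X"
      proof (rule ntrans_eqI)
        show "counit_at Y \<cdot>\<^bsub>\<F>\<^esub> FAr S\<^sub>r (FAr S\<^sub>l \<tau>) \<in> Hom \<F> (T (S X)) Y"
          by (rule \<F>.Cmp_in_Hom[OF r[OF l[OF \<tau>]] counit_at_Hom[OF Y]])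
        show "\<tau> \<cdot>\<^bsub>\<F>\<^esub> counit_at X \<in> Hom \<F> (T (S X)) Y"
          by (rule \<F>.Cmp_in_Hom[OF counit_at_Hom[OF X] \<tau>])
        fix Z assume Z: "Z \<in> Ob A"
        have "natural A B (S X) (S Y) (restrict (left_sat_map A B i p X Y (NMap \<tau>)) (Ob A))"
          using natural_S_map[OF X Y t] by simp
        moreover have "NMap (FAr S\<^sub>r (FAr S\<^sub>l \<tau>)) Z = right_sat_map A B j q (S X) (S Y)
            (restrict (left_sat_map A B i p X Y (NMap \<tau>)) (Ob A)) Z"
          by (subst FAr_satellites(2)[OF l[OF \<tau>]]) (simp add: FAr_satellites(1)[OF \<tau>] Z)
        ultimately show "NMap (counit_at Y \<cdot>\<^bsub>\<F>\<^esub> FAr S\<^sub>r (FAr S\<^sub>l \<tau>)) Z = NMap (\<tau> \<cdot>\<^bsub>\<F>\<^esub> counit_at X) Z"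
          using Z counit_square[OF X Y t Z] by (simp add: counit_at_def)
      qed
      then show ?thesis
        using X Y \<tau>' by (simp add: counit_trans_def comp_functor_def id_functor_def)
    qed
  qed (use is_functor_comp[OF functor_left_satellite functor_right_satellite]
      is_functor_id[OF category_functor_cat] counit_at_Hom in
      \<open>auto simp: counit_trans_def comp_functor_def id_functor_def additive_S\<close>)
  moreover have "nat_trans \<F> \<F> unit_trans"
  proof (intro nat_trans.intro nat_trans_axioms.intro)
    show "NMap unit_trans Y \<cdot>\<^bsub>\<F>\<^esub> FAr (NSrc unit_trans) \<tau> = FAr (NTgt unit_trans) \<tau> \<cdot>\<^bsub>\<F>\<^esub> NMap unit_trans X"
      if \<tau>: "\<tau> \<in> Hom \<F> X Y" for \<tau> X Y
    proof -
      have X: "additive_functor A B X" and Y: "additive_functor A B Y" and t: "natural A B X Y (NMap \<tau>)"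
        and \<tau>': "\<tau> \<in> Ar \<F>"
        using \<tau> by (auto simp: Hom_functor_cat Ar_functor_cat)
      have "unit_at Y \<cdot>\<^bsub>\<F>\<^esub> \<tau> = FAr S\<^sub>l (FAr S\<^sub>r \<tau>) \<cdot>\<^bsub>\<F>\<^esub> unit_at X"
      proof (rule ntrans_eqI)
        show "FAr S\<^sub>l (FAr S\<^sub>r \<tau>) \<cdot>\<^bsub>\<F>\<^esub> unit_at X \<in> Hom \<F> X (S (T Y))"
          by (rule \<F>.Cmp_in_Hom[OF unit_at_Hom[OF X] l[OF r[OF \<tau>]]])
        show "unit_at Y \<cdot>\<^bsub>\<F>\<^esub> \<tau> \<in> Hom \<F> X (S (T Y))"
          by (rule \<F>.Cmp_in_Hom[OF \<tau> unit_at_Hom[OF Y]])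
        fix Z assume Z: "Z \<in> Ob A"
        have "natural A B (T X) (T Y) (restrict (right_sat_map A B j q X Y (NMap \<tau>)) (Ob A))"
          using natural_T_map[OF X Y t] by simp
        moreover have "NMap (FAr S\<^sub>l (FAr S\<^sub>r \<tau>)) Z = left_sat_map A B i p (T X) (T Y)
            (restrict (right_sat_map A B j q X Y (NMap \<tau>)) (Ob A)) Z"
          by (subst FAr_satellites(1)[OF r[OF \<tau>]]) (simp add: FAr_satellites(2)[OF \<tau>] Z)
        ultimately show "NMap (unit_at Y \<cdot>\<^bsub>\<F>\<^esub> \<tau>) Z = NMap (FAr S\<^sub>l (FAr S\<^sub>r \<tau>) \<cdot>\<^bsub>\<F>\<^esub> unit_at X) Z"
          using Z unit_square[OF X Y t Z] by (simp add: unit_at_def)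
      qed
      then show ?thesis
        using X Y \<tau>' by (simp add: unit_trans_def comp_functor_def id_functor_def)
    qed
  qed (use is_functor_comp[OF functor_right_satellite functor_left_satellite]
      is_functor_id[OF category_functor_cat] unit_at_Hom in
      \<open>auto simp: unit_trans_def comp_functor_def id_functor_def additive_T\<close>)
  moreover have "adjunction_axioms \<F> \<F> S\<^sub>r S\<^sub>l unit_trans counit_trans"
  proof
    fix F assume "F \<in> Ob \<F>"
    then have F [simp]: "additive_functor A B F"
      by simp
    note u = unit_at_Hom[OF F] and c = counit_at_Hom[OF F]
    have "counit_at (T F) \<cdot>\<^bsub>\<F>\<^esub> FAr S\<^sub>r (unit_at F) = Id \<F> (T F)"
    proof (rule ntrans_eqI[OF \<F>.Cmp_in_Hom[OF r[OF u] counit_at_Hom[OF additive_T[OF F]]] \<F>.Id_in_Hom])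
      fix X assume X: "X \<in> Ob A"
      show "NMap (counit_at (T F) \<cdot>\<^bsub>\<F>\<^esub> FAr S\<^sub>r (unit_at F)) X = NMap (Id \<F> (T F)) X"
        using X triangle[OF F X, of "NMap (unit_at F)"] u
        by (simp add: FAr_satellites(2)[OF u] counit_at_def) (simp add: unit_at_def natural_unit)
    qed (simp add: additive_T)
    then show "NMap counit_trans (FOb S\<^sub>r F) \<cdot>\<^bsub>\<F>\<^esub> FAr S\<^sub>r (NMap unit_trans F) = Id \<F> (FOb S\<^sub>r F)"
      by (simp add: counit_trans_def unit_trans_def additive_T)
    have "FAr S\<^sub>l (counit_at F) \<cdot>\<^bsub>\<F>\<^esub> unit_at (S F) = Id \<F> (S F)"
    proof (rule ntrans_eqI[OF \<F>.Cmp_in_Hom[OF unit_at_Hom[OF additive_S[OF F]] l[OF c]] \<F>.Id_in_Hom])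
      fix X assume X: "X \<in> Ob A"
      show "NMap (FAr S\<^sub>l (counit_at F) \<cdot>\<^bsub>\<F>\<^esub> unit_at (S F)) X = NMap (Id \<F> (S F)) X"
        using X triangle_opp[OF F X, of "NMap (counit_at F)"] c
        by (simp add: FAr_satellites(1)[OF c] unit_at_def) (simp add: counit_at_def natural_counit)
    qed (simp add: additive_S)
    then show "FAr S\<^sub>l (NMap counit_trans F) \<cdot>\<^bsub>\<F>\<^esub> NMap unit_trans (FOb S\<^sub>l F) = Id \<F> (FOb S\<^sub>l F)"
      by (simp add: counit_trans_def unit_trans_def additive_S)
  qed (simp_all add: counit_trans_def unit_trans_def)
  ultimately show ?thesis
    by (intro adjunction.intro functor_left_satellite functor_right_satellite)
qed

end

text \<open>
  An adjunction is determined by its left and its right adjoint only up to an automorphism of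
  either of them, so the counits of two adjunctions differ by an automorphism.
\<close>

context adjunction
begin

lemma arrows:
  assumes "Y \<in> Ob D"
  shows "NMap \<epsilon> Y \<in> Hom D (FOb L (FOb R Y)) Y" "FOb R Y \<in> Ob C" "FOb L (FOb R Y) \<in> Ob D"
    "NMap \<eta> (FOb R Y) \<in> Hom C (FOb R Y) (FOb R (FOb L (FOb R Y)))"
proof -
  show R: "FOb R Y \<in> Ob C"
    using right.FOb_PiE assms by auto
  then show "FOb L (FOb R Y) \<in> Ob D"
    using left.FOb_PiE by auto
  show "NMap \<epsilon> Y \<in> Hom D (FOb L (FOb R Y)) Y"
    using counit.NMap_Hom[OF assms] assms by (simp add: counit_src counit_tgt comp_functor_def id_functor_def)
  show "NMap \<eta> (FOb R Y) \<in> Hom C (FOb R Y) (FOb R (FOb L (FOb R Y)))"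
    using unit.NMap_Hom[OF R] R by (simp add: unit_src unit_tgt comp_functor_def id_functor_def)
qed

lemma transpose_inverse:
  assumes Y: "Y \<in> Ob D" and f: "f \<in> Hom D (FOb L (FOb R Y)) Y"
  shows "NMap \<epsilon> Y \<cdot>\<^bsub>D\<^esub> FAr L (FAr R f \<cdot>\<^bsub>C\<^esub> NMap \<eta> (FOb R Y)) = f"
proof -
  note [simp] = Y arrows[OF Y]
  note \<epsilon> = arrows(1)[OF Y] and \<epsilon>' = arrows(1)[OF arrows(3)[OF Y]] and \<eta> = arrows(4)[OF Y]
  note Rf = right.FAr_Hom[OF f]
  have "NMap \<epsilon> Y \<cdot>\<^bsub>D\<^esub> FAr L (FAr R f \<cdot>\<^bsub>C\<^esub> NMap \<eta> (FOb R Y))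
      = NMap \<epsilon> Y \<cdot>\<^bsub>D\<^esub> (FAr L (FAr R f) \<cdot>\<^bsub>D\<^esub> FAr L (NMap \<eta> (FOb R Y)))"
    using left.FAr_Cmp[OF \<eta> Rf] by simp
  also have "\<dots> = (NMap \<epsilon> Y \<cdot>\<^bsub>D\<^esub> FAr L (FAr R f)) \<cdot>\<^bsub>D\<^esub> FAr L (NMap \<eta> (FOb R Y))"
    by (rule left.target.Cmp_assoc[OF left.FAr_Hom[OF \<eta>] left.FAr_Hom[OF Rf] \<epsilon>, symmetric])
  also have "NMap \<epsilon> Y \<cdot>\<^bsub>D\<^esub> FAr L (FAr R f) = f \<cdot>\<^bsub>D\<^esub> NMap \<epsilon> (FOb L (FOb R Y))"
    using counit.naturality[OF f] f by (simp add: counit_src counit_tgt comp_functor_def id_functor_def Hom_def)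
  also have "(f \<cdot>\<^bsub>D\<^esub> NMap \<epsilon> (FOb L (FOb R Y))) \<cdot>\<^bsub>D\<^esub> FAr L (NMap \<eta> (FOb R Y))
      = f \<cdot>\<^bsub>D\<^esub> (NMap \<epsilon> (FOb L (FOb R Y)) \<cdot>\<^bsub>D\<^esub> FAr L (NMap \<eta> (FOb R Y)))"
    by (rule left.target.Cmp_assoc[OF left.FAr_Hom[OF \<eta>] \<epsilon>' f])
  also have "\<dots> = f"
    using triangle_left[of "FOb R Y"] left.target.Cmp_Id[OF f] by simp
  finally show ?thesis .
qed

lemma transpose_transpose:
  assumes Y: "Y \<in> Ob D" and x: "x \<in> Hom C (FOb R Y) (FOb R Y)"
  shows "FAr R (NMap \<epsilon> Y \<cdot>\<^bsub>D\<^esub> FAr L x) \<cdot>\<^bsub>C\<^esub> NMap \<eta> (FOb R Y) = x"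
proof -
  note [simp] = Y arrows[OF Y]
  note \<epsilon> = arrows(1)[OF Y] and \<eta> = arrows(4)[OF Y] and Lx = left.FAr_Hom[OF x]
  have "FAr R (NMap \<epsilon> Y \<cdot>\<^bsub>D\<^esub> FAr L x) \<cdot>\<^bsub>C\<^esub> NMap \<eta> (FOb R Y)
      = (FAr R (NMap \<epsilon> Y) \<cdot>\<^bsub>C\<^esub> FAr R (FAr L x)) \<cdot>\<^bsub>C\<^esub> NMap \<eta> (FOb R Y)"
    using right.FAr_Cmp[OF Lx \<epsilon>] by simp
  also have "\<dots> = FAr R (NMap \<epsilon> Y) \<cdot>\<^bsub>C\<^esub> (FAr R (FAr L x) \<cdot>\<^bsub>C\<^esub> NMap \<eta> (FOb R Y))"
    by (rule left.source.Cmp_assoc[OF \<eta> right.FAr_Hom[OF Lx] right.FAr_Hom[OF \<epsilon>]])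
  also have "FAr R (FAr L x) \<cdot>\<^bsub>C\<^esub> NMap \<eta> (FOb R Y) = NMap \<eta> (FOb R Y) \<cdot>\<^bsub>C\<^esub> x"
    using unit.naturality[OF x] x by (simp add: unit_src unit_tgt comp_functor_def id_functor_def Hom_def)
  also have "FAr R (NMap \<epsilon> Y) \<cdot>\<^bsub>C\<^esub> (NMap \<eta> (FOb R Y) \<cdot>\<^bsub>C\<^esub> x)
      = (FAr R (NMap \<epsilon> Y) \<cdot>\<^bsub>C\<^esub> NMap \<eta> (FOb R Y)) \<cdot>\<^bsub>C\<^esub> x"
    by (rule left.source.Cmp_assoc[OF x \<eta> right.FAr_Hom[OF \<epsilon>], symmetric])
  also have "\<dots> = x"
    using triangle_right[of Y] left.source.Id_Cmp[OF x] by simp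
  finally show ?thesis .
qed

end

lemma counits_differ_by_automorphism:
  assumes "adjunction C D L R \<eta> \<epsilon>" "adjunction C D L R \<eta>' \<epsilon>'" and Y: "Y \<in> Ob D"
  shows "\<exists>u \<in> Hom D (FOb L (FOb R Y)) (FOb L (FOb R Y)).
    isomorphism_in D u \<and> NMap \<epsilon> Y \<cdot>\<^bsub>D\<^esub> u = NMap \<epsilon>' Y"
proof -
  interpret one: adjunction C D L R \<eta> \<epsilon> by fact
  interpret two: adjunction C D L R \<eta>' \<epsilon>' by fact
  let ?X = "FOb R Y"
  define a where "a = FAr R (NMap \<epsilon>' Y) \<cdot>\<^bsub>C\<^esub> NMap \<eta> ?X"
  define a' where "a' = FAr R (NMap \<epsilon> Y) \<cdot>\<^bsub>C\<^esub> NMap \<eta>' ?X"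
  note \<epsilon> = one.arrows(1)[OF Y] and \<epsilon>' = two.arrows(1)[OF Y]
    and \<eta> = one.arrows(4)[OF Y] and \<eta>' = two.arrows(4)[OF Y] and X = one.arrows(2)[OF Y]
  have a: "a \<in> Hom C ?X ?X" and a': "a' \<in> Hom C ?X ?X"
    unfolding a_def a'_def
    by (rule one.left.source.Cmp_in_Hom[OF \<eta> one.right.FAr_Hom[OF \<epsilon>']],
        rule one.left.source.Cmp_in_Hom[OF \<eta>' one.right.FAr_Hom[OF \<epsilon>]])
  note La = one.left.FAr_Hom[OF a] and La' = one.left.FAr_Hom[OF a']
  have ea: "NMap \<epsilon> Y \<cdot>\<^bsub>D\<^esub> FAr L a = NMap \<epsilon>' Y" and ea': "NMap \<epsilon>' Y \<cdot>\<^bsub>D\<^esub> FAr L a' = NMap \<epsilon> Y"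
    unfolding a_def a'_def by (rule one.transpose_inverse[OF Y \<epsilon>'], rule two.transpose_inverse[OF Y \<epsilon>])
  have "NMap \<epsilon> Y \<cdot>\<^bsub>D\<^esub> FAr L (a \<cdot>\<^bsub>C\<^esub> a') = NMap \<epsilon> Y"
    using one.left.target.Cmp_assoc[OF La' La \<epsilon>] one.left.FAr_Cmp[OF a' a] by (simp add: ea ea')
  moreover have "FAr R (NMap \<epsilon> Y) \<cdot>\<^bsub>C\<^esub> NMap \<eta> ?X = Id C ?X"
    by (rule one.triangle_right[OF Y])
  ultimately have aa': "a \<cdot>\<^bsub>C\<^esub> a' = Id C ?X"
    using one.transpose_transpose[OF Y one.left.source.Cmp_in_Hom[OF a' a]] by simp
  have "NMap \<epsilon>' Y \<cdot>\<^bsub>D\<^esub> FAr L (a' \<cdot>\<^bsub>C\<^esub> a) = NMap \<epsilon>' Y"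
    using one.left.target.Cmp_assoc[OF La La' \<epsilon>'] one.left.FAr_Cmp[OF a a'] by (simp add: ea ea')
  moreover have "FAr R (NMap \<epsilon>' Y) \<cdot>\<^bsub>C\<^esub> NMap \<eta>' ?X = Id C ?X"
    by (rule two.triangle_right[OF Y])
  ultimately have a'a: "a' \<cdot>\<^bsub>C\<^esub> a = Id C ?X"
    using two.transpose_transpose[OF Y one.left.source.Cmp_in_Hom[OF a a']] by simp
  have "FAr L a' \<cdot>\<^bsub>D\<^esub> FAr L a = Id D (FOb L ?X)" "FAr L a \<cdot>\<^bsub>D\<^esub> FAr L a' = Id D (FOb L ?X)"
    using one.left.FAr_Cmp[OF a a'] one.left.FAr_Cmp[OF a' a] one.left.FAr_Id[OF X] by (simp_all add: aa' a'a)
  then have "isomorphism_in D (FAr L a)"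
    unfolding isomorphism_in_def using La La' by (intro conjI bexI[of _ "FAr L a'"]) (auto simp: Hom_def)
  then show ?thesis
    using La ea by blast
qed

section \<open>The injective stabilization\<close>

lemma (in preadditive) kernels_isomorphic:
  assumes k: "is_kernel C k f" and k': "is_kernel C k' f"
  obtains u v where "u \<in> Hom C (Dm C k) (Dm C k')" "v \<in> Hom C (Dm C k') (Dm C k)" "k' \<cdot> u = k"
    "v \<cdot> u = Id C (Dm C k)" "u \<cdot> v = Id C (Dm C k')"
proof -
  note [simp] = kernel_types[OF k] kernel_types[OF k']
  obtain u where [simp]: "u \<in> Ar C" "Dm C u = Dm C k" "Cd C u = Dm C k'" and u: "k' \<cdot> u = k"
    using kernel_factor[OF k', of k] by auto
  obtain v where [simp]: "v \<in> Ar C" "Dm C v = Dm C k'" "Cd C v = Dm C k" and v: "k \<cdot> v = k'"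
    using kernel_factor[OF k, of k'] by auto
  have "k \<cdot> (v \<cdot> u) = (k \<cdot> v) \<cdot> u"
    by simp
  also have "\<dots> = k"
    by (simp only: u v)
  finally have "v \<cdot> u = Id C (Dm C k)"
    by (intro monic_cancel[OF kernel_monic[OF k], of _ "Id C (Dm C k)"]) simp_all
  moreover have "k' \<cdot> (u \<cdot> v) = (k' \<cdot> u) \<cdot> v"
    by simp
  then have "k' \<cdot> (u \<cdot> v) = k'"
    by (simp only: u v)
  then have "u \<cdot> v = Id C (Dm C k')"
    by (intro monic_cancel[OF kernel_monic[OF k'], of _ "Id C (Dm C k')"]) simp_all
  ultimately show thesis
    using u by (intro that[of u v]) (auto simp: Hom_def)
qed

lemma (in preadditive) kernel_of_equivalent:
  assumes k: "is_kernel C k f" and [simp]: "g \<in> Ar C" "h \<in> Ar C" "h' \<in> Ar C"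
    "Dm C h = Cd C f" "Dm C h' = Cd C g" and g: "h \<cdot> f = g" and f: "h' \<cdot> g = f"
  shows "is_kernel C k g"
proof (rule is_kernelI[OF kernel_monic[OF k]])
  note [simp] = kernel_types[OF k]
  have [simp]: "Cd C h = Cd C g" "Dm C g = Dm C f" "Cd C h' = Cd C f"
    using Cmp_types[of f h] Cmp_types(3)[of g h'] g f by simp_all
  show "Cd C k = Dm C g" by simp
  have "(h \<cdot> f) \<cdot> k = Zero C (Dm C k) (Cd C g)"
    by simp
  then show "g \<cdot> k = Zero C (Dm C k) (Cd C g)"
    by (simp only: g)
  fix x assume [simp]: "x \<in> Ar C" "Cd C x = Dm C g" and "g \<cdot> x = Zero C (Dm C x) (Cd C g)"
  then have "(h' \<cdot> g) \<cdot> x = Zero C (Dm C x) (Cd C f)"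
    by simp
  then have "f \<cdot> x = Zero C (Dm C x) (Cd C f)"
    by (simp only: f)
  then show "\<exists>u. u \<in> Ar C \<and> Dm C u = Dm C x \<and> Cd C u = Dm C k \<and> k \<cdot> u = x"
    using kernel_factor[OF k, of x] by auto
qed simp

locale injective_copresented = abelian_pair +
  fixes \<iota> \<delta> F
  assumes copresentations: "injective_copresentations A \<iota> \<delta>"
    and F [simp]: "additive_functor A B F"
begin

abbreviation N where "N X \<equiv> ker_map B (NMap (rho A B \<iota> \<delta> F) X)"

lemma copresentation:
  assumes "X \<in> Ob A"
  shows "\<iota> X \<in> Ar A" "\<delta> X \<in> Ar A" "Dm A (\<iota> X) = X" "Cd A (\<iota> X) = Dm A (\<delta> X)"
    "\<delta> X \<cdot>\<^bsub>A\<^esub> \<iota> X = Zero A X (Cd A (\<delta> X))" "monic A (\<iota> X)" "injective A (Cd A (\<iota> X))"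
proof -
  have *: "Dm A (\<iota> X) = X" "monic A (\<iota> X)" "injective A (Cd A (\<iota> X))" "exact A (\<iota> X) (\<delta> X)"
    using copresentations assms by (auto simp: injective_copresentations_def)
  then have "\<delta> X \<in> Ar A" "Cd A (\<iota> X) = Dm A (\<delta> X)"
    by (auto simp: exact_def is_image_def is_kernel_def is_cokernel_def)
  then show "\<iota> X \<in> Ar A" "\<delta> X \<in> Ar A" "Dm A (\<iota> X) = X" "Cd A (\<iota> X) = Dm A (\<delta> X)"
    "\<delta> X \<cdot>\<^bsub>A\<^esub> \<iota> X = Zero A X (Cd A (\<delta> X))" "monic A (\<iota> X)" "injective A (Cd A (\<iota> X))"
    using * A.monic_Ar[OF *(2)] A.exact_iff[of "\<iota> X" "\<delta> X"] by auto
qed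

text \<open>
  The component \<open>F(X) \<rightarrow> R\<^sup>0F(X)\<close> of \<open>\<rho>\<close> followed by the monomorphism \<open>R\<^sup>0F(X) \<rightarrow> F(I\<^sup>0)\<close> is
  \<open>F(\<iota>)\<close>, so both arrows have the same kernels.
\<close>

lemma kernel_N:
  assumes X [simp]: "X \<in> Ob A"
  shows "is_kernel B (N X) (FAr F (\<iota> X))"
proof -
  note [simp] = copresentation(1-5)[OF X]
  let ?k = "ker_map B (FAr F (\<delta> X))"
  have k: "is_kernel B ?k (FAr F (\<delta> X))"
    by (rule B.ker_map) simp
  note [simp] = B.kernel_types[OF k]
  have R0: "FOb (R0 A B \<iota> \<delta> F) X = Dm B ?k"
    by (simp add: R0_def Let_def)
  have "FAr F (\<delta> X) \<cdot>\<^bsub>B\<^esub> FAr F (\<iota> X) = Zero B (FOb F X) (FOb F (Cd A (\<delta> X)))"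
    using FAr_vanish[OF F, of "\<delta> X" "\<iota> X"] by simp
  then obtain r where r [simp]: "r \<in> Ar B" "Dm B r = FOb F X" "Cd B r = Dm B ?k"
    and kr: "?k \<cdot>\<^bsub>B\<^esub> r = FAr F (\<iota> X)"
    using B.kernel_factor[OF k, of "FAr F (\<iota> X)"] by auto
  have "NMap (rho A B \<iota> \<delta> F) X =
      (THE r. r \<in> Hom B (FOb F X) (Dm B ?k) \<and> ?k \<cdot>\<^bsub>B\<^esub> r = FAr F (\<iota> X))"
    by (simp add: rho_def R0)
  also have "\<dots> = r"
  proof (rule the_equality)
    fix r' assume "r' \<in> Hom B (FOb F X) (Dm B ?k) \<and> ?k \<cdot>\<^bsub>B\<^esub> r' = FAr F (\<iota> X)"
    then show "r' = r"
      using kr by (intro B.monic_cancel[OF B.kernel_monic[OF k], of r' r]) (auto simp: Hom_def)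
  qed (use kr in \<open>simp add: Hom_def\<close>)
  finally have rho: "NMap (rho A B \<iota> \<delta> F) X = r" .
  have n: "is_kernel B (N X) r"
    unfolding rho by (rule B.ker_map) simp
  note [simp] = B.kernel_types[OF n]
  show ?thesis
  proof (rule B.is_kernelI[OF B.kernel_monic[OF n]])
    have "(?k \<cdot>\<^bsub>B\<^esub> r) \<cdot>\<^bsub>B\<^esub> N X = Zero B (Dm B (N X)) (FOb F (Cd A (\<iota> X)))"
      by simp
    then show "FAr F (\<iota> X) \<cdot>\<^bsub>B\<^esub> N X = Zero B (Dm B (N X)) (Cd B (FAr F (\<iota> X)))"
      unfolding kr by simp
    fix h assume [simp]: "h \<in> Ar B" "Cd B h = Dm B (FAr F (\<iota> X))"
      and z: "FAr F (\<iota> X) \<cdot>\<^bsub>B\<^esub> h = Zero B (Dm B h) (Cd B (FAr F (\<iota> X)))"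
    have [simp]: "Cd B h = FOb F X"
      by simp
    have "?k \<cdot>\<^bsub>B\<^esub> (r \<cdot>\<^bsub>B\<^esub> h) = (?k \<cdot>\<^bsub>B\<^esub> r) \<cdot>\<^bsub>B\<^esub> h"
      by simp
    also have "\<dots> = Zero B (Dm B h) (FOb F (Cd A (\<iota> X)))"
      unfolding kr z by simp
    finally have "r \<cdot>\<^bsub>B\<^esub> h = Zero B (Dm B h) (Cd B r)"
      using B.monic_Zero[OF B.kernel_monic[OF k], of "r \<cdot>\<^bsub>B\<^esub> h"] by simp
    then show "\<exists>u. u \<in> Ar B \<and> Dm B u = Dm B h \<and> Cd B u = Dm B (N X) \<and> N X \<cdot>\<^bsub>B\<^esub> u = h"
      using B.kernel_factor[OF n, of h] by auto
  qed simp_all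
qed

lemma monic_N: "X \<in> Ob A \<Longrightarrow> monic B (N X)"
  by (rule B.kernel_monic, rule kernel_N)

abbreviation F' where "F' \<equiv> inj_stab A B \<iota> \<delta> F"

lemma N_types [simp]:
  assumes "X \<in> Ob A"
  shows "N X \<in> Ar B" "Dm B (N X) = FOb F' X" "Cd B (N X) = FOb F X" "FOb F' X \<in> Ob B"
proof -
  note * = B.kernel_types[OF kernel_N[OF assms]]
  show D: "Dm B (N X) = FOb F' X"
    using assms by (simp add: inj_stab_def inj_stab_incl_def ntrans_ker_def Let_def)
  show "N X \<in> Ar B" "Cd B (N X) = FOb F X"
    using * assms copresentation[OF assms] by auto
  show "FOb F' X \<in> Ob B"
    using * B.Dm_Cd_Ob(1)[of "N X"] D by simp
qed

lemma stab_arr: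
  assumes f [simp]: "f \<in> Ar A"
  shows "FAr F' f \<in> Ar B" "Dm B (FAr F' f) = FOb F' (Dm A f)" "Cd B (FAr F' f) = FOb F' (Cd A f)"
    "N (Cd A f) \<cdot>\<^bsub>B\<^esub> FAr F' f = FAr F f \<cdot>\<^bsub>B\<^esub> N (Dm A f)"
proof -
  define X Y where XY: "X = Dm A f" "Y = Cd A f"
  have XY' [simp]: "X \<in> Ob A" "Y \<in> Ob A" "Dm A f = X" "Cd A f = Y"
    by (simp_all add: XY)
  note [simp] = copresentation(1-4)[OF XY'(1)] copresentation(1-4)[OF XY'(2)]
  have "\<iota> Y \<cdot>\<^bsub>A\<^esub> f \<in> Hom A (Dm A (\<iota> X)) (Cd A (\<iota> Y))"
    by (simp add: Hom_def)
  then have "\<exists>u \<in> Hom A (Cd A (\<iota> X)) (Cd A (\<iota> Y)). u \<cdot>\<^bsub>A\<^esub> \<iota> X = \<iota> Y \<cdot>\<^bsub>A\<^esub> f"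
    using copresentation(6)[OF XY'(1)] copresentation(7)[OF XY'(2)] unfolding injective_def by blast
  then obtain u where [simp]: "u \<in> Ar A" "Dm A u = Dm A (\<delta> X)" "Cd A u = Dm A (\<delta> Y)"
    and u: "u \<cdot>\<^bsub>A\<^esub> \<iota> X = \<iota> Y \<cdot>\<^bsub>A\<^esub> f"
    by (auto simp: Hom_def)
  have "FAr F (\<iota> Y) \<cdot>\<^bsub>B\<^esub> (FAr F f \<cdot>\<^bsub>B\<^esub> N X) = FAr F u \<cdot>\<^bsub>B\<^esub> (FAr F (\<iota> X) \<cdot>\<^bsub>B\<^esub> N X)"
    by (rule B.extend[OF FAr_square[OF F u[symmetric]]]) auto
  also have "\<dots> = Zero B (FOb F' X) (FOb F (Cd A (\<iota> Y)))"
    using B.kernel_types(4)[OF kernel_N[OF XY'(1)]] by simp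
  finally obtain g where g: "g \<in> Ar B" "Dm B g = FOb F' X" "Cd B g = FOb F' Y"
    "N Y \<cdot>\<^bsub>B\<^esub> g = FAr F f \<cdot>\<^bsub>B\<^esub> N X"
    using B.kernel_factor[OF kernel_N[OF XY'(2)], of "FAr F f \<cdot>\<^bsub>B\<^esub> N X"] by auto
  have "FAr F' f = (THE g. g \<in> Hom B (FOb F' X) (FOb F' Y) \<and> N Y \<cdot>\<^bsub>B\<^esub> g = FAr F f \<cdot>\<^bsub>B\<^esub> N X)"
    unfolding N_types(2)[OF XY'(1), symmetric] N_types(2)[OF XY'(2), symmetric]
    by (simp add: inj_stab_def inj_stab_incl_def ntrans_ker_def Let_def rho_def del: N_types)
  also have "\<dots> = g"
  proof (rule the_equality)
    fix g' assume "g' \<in> Hom B (FOb F' X) (FOb F' Y) \<and> N Y \<cdot>\<^bsub>B\<^esub> g' = FAr F f \<cdot>\<^bsub>B\<^esub> N X"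
    then show "g' = g"
      using g by (intro B.monic_cancel[OF monic_N[OF XY'(2)], of g' g]) (auto simp: Hom_def)
  qed (use g in \<open>simp add: Hom_def\<close>)
  finally show "FAr F' f \<in> Ar B" "Dm B (FAr F' f) = FOb F' (Dm A f)" "Cd B (FAr F' f) = FOb F' (Cd A f)"
    "N (Cd A f) \<cdot>\<^bsub>B\<^esub> FAr F' f = FAr F f \<cdot>\<^bsub>B\<^esub> N (Dm A f)"
    using g by auto
qed

lemma additive_stab: "additive_functor A B F'"
proof (rule additive_functorI)
  note [simp] = stab_arr(1-3)
  show "FOb F' \<in> Ob A \<rightarrow>\<^sub>E Ob B"
  proof (rule PiE_I)
    show "FOb F' X = undefined" if "X \<notin> Ob A" for X
      using that by (simp add: inj_stab_def inj_stab_incl_def ntrans_ker_def Let_def)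
  qed simp
  show "FAr F' \<in> extensional (Ar A)"
    by (simp add: inj_stab_def inj_stab_incl_def ntrans_ker_def Let_def)
  show "FAr F' f \<in> Hom B (FOb F' (Dm A f)) (FOb F' (Cd A f))" if "f \<in> Ar A" for f
    using that by (simp add: Hom_def)
  show "FAr F' (Id A X) = Id B (FOb F' X)" if [simp]: "X \<in> Ob A" for X
    by (rule B.monic_cancel[OF monic_N[OF that]]) (use stab_arr(4)[of "Id A X"] in simp_all)
  show "FAr F' (g \<cdot>\<^bsub>A\<^esub> f) = FAr F' g \<cdot>\<^bsub>B\<^esub> FAr F' f"
    if [simp]: "f \<in> Ar A" "g \<in> Ar A" "Cd A f = Dm A g" for f g
  proof (rule B.monic_cancel[OF monic_N[of "Cd A g"]])
    have "N (Cd A g) \<cdot>\<^bsub>B\<^esub> (FAr F' g \<cdot>\<^bsub>B\<^esub> FAr F' f) = FAr F g \<cdot>\<^bsub>B\<^esub> (N (Dm A g) \<cdot>\<^bsub>B\<^esub> FAr F' f)"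
      by (rule B.extend[OF stab_arr(4)]) auto
    then show "N (Cd A g) \<cdot>\<^bsub>B\<^esub> FAr F' (g \<cdot>\<^bsub>A\<^esub> f) = N (Cd A g) \<cdot>\<^bsub>B\<^esub> (FAr F' g \<cdot>\<^bsub>B\<^esub> FAr F' f)"
      using stab_arr(4)[of f] stab_arr(4)[of "g \<cdot>\<^bsub>A\<^esub> f"] by simp
  qed simp_all
  show "FAr F' (Add A f g) = Add B (FAr F' f) (FAr F' g)"
    if [simp]: "f \<in> Ar A" "g \<in> Ar A" "Dm A f = Dm A g" "Cd A f = Cd A g" for f g
    by (rule B.monic_cancel[OF monic_N[of "Cd A g"]])
      (use stab_arr(4)[of f] stab_arr(4)[of g] stab_arr(4)[of "Add A f g"] in simp_all)
qed

lemma stab_incl: "inj_stab_incl A B \<iota> \<delta> F = \<lparr>NSrc = F', NTgt = F, NMap = restrict N (Ob A)\<rparr>"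
  by (simp add: inj_stab_def inj_stab_incl_def ntrans_ker_def Let_def rho_def restrict_def)

lemma natural_N: "natural A B F' F N"
  using stab_arr(4) by (simp add: natural_def Hom_def)

lemma isomorphism_to_stab:
  assumes G [simp]: "additive_functor A B G" and c: "natural A B G F c"
    and kernel: "\<And>X. X \<in> Ob A \<Longrightarrow> is_kernel B (c X) (FAr F (\<iota> X))"
  obtains \<theta> where "\<theta> \<in> Hom \<F> G F'" "isomorphism_in \<F> \<theta>"
    "inj_stab_incl A B \<iota> \<delta> F \<cdot>\<^bsub>\<F>\<^esub> \<theta> = \<lparr>NSrc = G, NTgt = F, NMap = restrict c (Ob A)\<rparr>"
proof -
  have "\<forall>X \<in> Ob A. \<exists>u v. u \<in> Hom B (FOb G X) (FOb F' X) \<and> v \<in> Hom B (FOb F' X) (FOb G X) \<and>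
      N X \<cdot>\<^bsub>B\<^esub> u = c X \<and> v \<cdot>\<^bsub>B\<^esub> u = Id B (FOb G X) \<and> u \<cdot>\<^bsub>B\<^esub> v = Id B (FOb F' X)"
  proof
    fix X assume X: "X \<in> Ob A"
    show "\<exists>u v. u \<in> Hom B (FOb G X) (FOb F' X) \<and> v \<in> Hom B (FOb F' X) (FOb G X) \<and>
      N X \<cdot>\<^bsub>B\<^esub> u = c X \<and> v \<cdot>\<^bsub>B\<^esub> u = Id B (FOb G X) \<and> u \<cdot>\<^bsub>B\<^esub> v = Id B (FOb F' X)"
      using B.kernels_isomorphic[OF kernel[OF X] kernel_N[OF X]] N_types(2)[OF X] natural_types(2)[OF c X]
      by metis
  qed
  then obtain u v where uv: "\<And>X. X \<in> Ob A \<Longrightarrow> u X \<in> Hom B (FOb G X) (FOb F' X) \<and> v X \<in> Hom B (FOb F' X) (FOb G X) \<and>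
      N X \<cdot>\<^bsub>B\<^esub> u X = c X \<and> v X \<cdot>\<^bsub>B\<^esub> u X = Id B (FOb G X) \<and> u X \<cdot>\<^bsub>B\<^esub> v X = Id B (FOb F' X)"
    by metis
  have u [simp]: "u X \<in> Ar B" "Dm B (u X) = FOb G X" "Cd B (u X) = FOb F' X" and Nu: "N X \<cdot>\<^bsub>B\<^esub> u X = c X"
    if "X \<in> Ob A" for X
    using uv[OF that] by (auto simp: Hom_def)
  note [simp] = natural_types[OF c] stab_arr(1-3)
  have nat: "natural A B G F' u"
    unfolding natural_def
  proof (intro conjI ballI)
    fix f assume [simp]: "f \<in> Ar A"
    show "u (Cd A f) \<cdot>\<^bsub>B\<^esub> FAr G f = FAr F' f \<cdot>\<^bsub>B\<^esub> u (Dm A f)"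
    proof (rule B.monic_cancel[OF monic_N[of "Cd A f"]])
      have "N (Cd A f) \<cdot>\<^bsub>B\<^esub> (u (Cd A f) \<cdot>\<^bsub>B\<^esub> FAr G f) = (N (Cd A f) \<cdot>\<^bsub>B\<^esub> u (Cd A f)) \<cdot>\<^bsub>B\<^esub> FAr G f"
        by simp
      also have "\<dots> = FAr F f \<cdot>\<^bsub>B\<^esub> c (Dm A f)"
        using natural_square[OF c, of f] by (simp only: Nu A.Dm_Cd_Ob \<open>f \<in> Ar A\<close>)
      also have "\<dots> = FAr F f \<cdot>\<^bsub>B\<^esub> (N (Dm A f) \<cdot>\<^bsub>B\<^esub> u (Dm A f))"
        by (simp add: Nu)
      also have "\<dots> = N (Cd A f) \<cdot>\<^bsub>B\<^esub> (FAr F' f \<cdot>\<^bsub>B\<^esub> u (Dm A f))"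
        by (rule B.extend[OF stab_arr(4)[symmetric]]) auto
      finally show "N (Cd A f) \<cdot>\<^bsub>B\<^esub> (u (Cd A f) \<cdot>\<^bsub>B\<^esub> FAr G f) = N (Cd A f) \<cdot>\<^bsub>B\<^esub> (FAr F' f \<cdot>\<^bsub>B\<^esub> u (Dm A f))" .
    qed simp_all
  qed (use uv in auto)
  interpret \<F>: category \<F>
    by (rule category_functor_cat)
  let ?\<theta> = "\<lparr>NSrc = G, NTgt = F', NMap = restrict u (Ob A)\<rparr>"
  have \<theta>: "?\<theta> \<in> Hom \<F> G F'"
    by (rule Hom_functor_catI[OF G additive_stab nat])
  have incl: "inj_stab_incl A B \<iota> \<delta> F \<in> Hom \<F> F' F"
    unfolding stab_incl by (rule Hom_functor_catI[OF additive_stab F natural_N])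
  show thesis
  proof (rule that[OF \<theta>])
    show "isomorphism_in \<F> ?\<theta>"
      by (rule isomorphism_functor_cat[OF G additive_stab nat, of v]) (use uv in auto)
    show "inj_stab_incl A B \<iota> \<delta> F \<cdot>\<^bsub>\<F>\<^esub> ?\<theta> = \<lparr>NSrc = G, NTgt = F, NMap = restrict c (Ob A)\<rparr>"
      by (rule ntrans_eqI[OF \<F>.Cmp_in_Hom[OF \<theta> incl] Hom_functor_catI[OF G F c]])
        (simp add: stab_incl Nu)
  qed
qed

end

section \<open>The counit and the injective stabilization\<close>

theorem proposition5p4:
  fixes A :: "('o, 'a, 'x) ab_cat_scheme" and B :: "('p, 'b, 'y) ab_cat_scheme"
    and F :: "('o, 'a, 'p, 'b) func"
    and \<iota> \<delta> i p j q :: "'o \<Rightarrow> 'a"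
  defines "S\<^sub>l \<equiv> left_satellite A B i p"
    and "S\<^sub>r \<equiv> right_satellite A B j q"
    and "\<F> \<equiv> functor_cat A B"
  assumes "abelian A" and "abelian B"
    and "enough_injectives A" and "enough_projectives A"
    and "additive_functor A B F" and "half_exact A B F"
    and "injective_copresentations A \<iota> \<delta>"
    and "projective_presentations A i p"
    and "injective_presentations A j q"
  shows "(\<exists>\<eta> c. adjunction \<F> \<F> S\<^sub>r S\<^sub>l \<eta> c) \<and>
    (\<forall>\<eta> c. adjunction \<F> \<F> S\<^sub>r S\<^sub>l \<eta> c \<longrightarrow>
      (\<exists>\<theta> \<in> Hom \<F> (FOb S\<^sub>r (FOb S\<^sub>l F)) (inj_stab A B \<iota> \<delta> F).
         isomorphism_in \<F> \<theta> \<and> inj_stab_incl A B \<iota> \<delta> F \<cdot>\<^bsub>\<F>\<^esub> \<theta> = NMap c F))"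
proof -
  interpret abelian_pair A B
    by (intro abelian_pair.intro assms)
  interpret satellites A B i p j q
    by (intro satellites.intro projective_presented.intro projective_presented_axioms.intro
        satellites_axioms.intro abelian_pair_axioms assms)
  interpret injective_copresented A B \<iota> \<delta> F
    by (intro injective_copresented.intro injective_copresented_axioms.intro abelian_pair_axioms assms)
  interpret \<F>: category \<F>
    unfolding \<F>_def by (rule category_functor_cat)
  let ?c = "sat_counit A B i p j q F"
  have adj: "adjunction \<F> \<F> S\<^sub>r S\<^sub>l unit_trans counit_trans"
    unfolding \<F>_def S\<^sub>l_def S\<^sub>r_def by (rule satellite_adjunction)
  have kernel: "is_kernel B (?c X) (FAr F (\<iota> X))" if X [simp]: "X \<in> Ob A" for X
  proof -
    \<comment> \<open>The embeddings \<open>j X\<close> and \<open>\<iota> X\<close> of \<open>X\<close> into injective objects extend along each other.\<close>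
    note [simp] = copresentation(1-4)[OF X]
    have "j X \<in> Hom A (Dm A (\<iota> X)) (Cd A (j X))" "\<iota> X \<in> Hom A (Dm A (j X)) (Cd A (\<iota> X))"
      by (simp_all add: Hom_def)
    moreover have "injective A (Cd A (j X))" "monic A (j X)"
      using assms(12) A.ses_types(7)[OF ses_jq[OF X]] by (auto simp: injective_presentations_def)
    ultimately obtain h h' where h [simp]: "h \<in> Ar A" "Dm A h = Cd A (\<iota> X)" "Cd A h = Cd A (j X)"
        "h' \<in> Ar A" "Dm A h' = Cd A (j X)" "Cd A h' = Cd A (\<iota> X)"
      and hj: "h \<cdot>\<^bsub>A\<^esub> \<iota> X = j X" "h' \<cdot>\<^bsub>A\<^esub> j X = \<iota> X"
      using copresentation(6,7)[OF X] unfolding injective_def Hom_def by blast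
    show ?thesis
    proof (rule B.kernel_of_equivalent[OF counit_kernel[OF F assms(9) X], where h = "FAr F h'" and h' = "FAr F h"])
      show "FAr F h' \<cdot>\<^bsub>B\<^esub> FAr F (j X) = FAr F (\<iota> X)"
        unfolding hj(2)[symmetric] by simp
      show "FAr F h \<cdot>\<^bsub>B\<^esub> FAr F (\<iota> X) = FAr F (j X)"
        unfolding hj(1)[symmetric] by simp
    qed simp_all
  qed
  obtain \<theta> where \<theta>: "\<theta> \<in> Hom \<F> (T (S F)) F'" and iso: "isomorphism_in \<F> \<theta>"
    and incl: "inj_stab_incl A B \<iota> \<delta> F \<cdot>\<^bsub>\<F>\<^esub> \<theta> = counit_at F"
    using isomorphism_to_stab[OF additive_T[OF additive_S[OF F]] natural_counit[OF F] kernel]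
    unfolding counit_at_def \<F>_def by blast
  have "\<exists>\<theta> \<in> Hom \<F> (FOb S\<^sub>r (FOb S\<^sub>l F)) F'.
      isomorphism_in \<F> \<theta> \<and> inj_stab_incl A B \<iota> \<delta> F \<cdot>\<^bsub>\<F>\<^esub> \<theta> = NMap c F"
    if c: "adjunction \<F> \<F> S\<^sub>r S\<^sub>l \<eta> c" for \<eta> c
  proof -
    have ob: "FOb S\<^sub>r (FOb S\<^sub>l F) = T (S F)"
      unfolding S\<^sub>l_def S\<^sub>r_def by (simp add: additive_S)
    have F_Ob: "F \<in> Ob \<F>"
      unfolding \<F>_def by simp
    obtain u where u: "u \<in> Hom \<F> (T (S F)) (T (S F))" "isomorphism_in \<F> u"
      and cu: "counit_at F \<cdot>\<^bsub>\<F>\<^esub> u = NMap c F"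
      using counits_differ_by_automorphism[OF adj c F_Ob] F_Ob
      unfolding ob by (auto simp: counit_trans_def \<F>_def)
    have \<alpha>: "inj_stab_incl A B \<iota> \<delta> F \<in> Hom \<F> F' F"
      unfolding stab_incl \<F>_def by (rule Hom_functor_catI[OF additive_stab F natural_N])
    have "inj_stab_incl A B \<iota> \<delta> F \<cdot>\<^bsub>\<F>\<^esub> (\<theta> \<cdot>\<^bsub>\<F>\<^esub> u) = NMap c F"
      by (simp only: \<F>.Cmp_assoc[OF u(1) \<theta> \<alpha>, symmetric] incl cu)
    moreover have "isomorphism_in \<F> (\<theta> \<cdot>\<^bsub>\<F>\<^esub> u)"
      using u \<theta> iso by (intro \<F>.isomorphism_Cmp) (auto simp: Hom_def)
    ultimately show ?thesis
      using \<F>.Cmp_in_Hom[OF u(1) \<theta>] unfolding ob by blast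
  qed
  with adj show ?thesis
    by blast
qed

end
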